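(* Let $T>0$ and let $y\in\mathcal{H}^T$ be a solution of $-y''+qy=0$ on $(0,x(T))$. Then the control $f=(W^T)^{-1}y$ (i.e. the control for which $u^f(\cdot,T)=y$ in the system with Dirichlet boundary control) is the unique solution in $\mathcal{F}^T$ of the equation $$C^Tf=y'(0)\,\varkappa^T-y(0)\,(R^T)^*\varkappa^T,$$ where $\varkappa^T(t)=T-t$, $0\leqslant t\leqslant T$.
   Context: All functions are real; smooth means $C^\infty$. Let $\rho,q\in C^\infty[0,\infty)$ with $\rho(x)>0$ and $\int_0^\infty\rho^{1/2}(x)\,dx=\infty$. Put $\tau(x)=\int_0^x\rho^{1/2}(s)\,ds$ and let $x(\cdot)$ be the inverse function of $\tau(\cdot)$. All functions of time are extended by zero to $t<0$. Dirichlet problem: $\rho u_{tt}-u_{xx}+qu=0$ for $x>0,\ t>0$; $u|_{t=0}=u_t|_{t=0}=0$ for $x\geqslant0$; $u|_{x=0}=f$ for $t\geqslant0$. For smooth $f$ vanishing near $t=0$ it has a unique classical smooth solution $u=u^f(x,t)$, and $$u^f(x,t)=\left[\tfrac{\rho(x)}{\rho(0)}\right]^{-1/4}f(t-\tau(x))+\int_0^{t-\tau(x)}w(x,t-s)f(s)\,ds,$$ where $w$ is the regular part of the fundamental solution $u^\delta(x,t)=\left[\tfrac{\rho(x)}{\rho(0)}\right]^{-1/4}\delta(t-\tau(x))+w(x,t)$ (the solution for $f=\delta$); $w$ is determined by $\rho,q$, is smooth in $\{(x,t):0\leqslant\tau(x)\leqslant t\}$ and vanishes for $t<\tau(x)$.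 For $f\in L_2^{\rm loc}(0,\infty)$ the solution $u^f$ is defined as the right-hand side of this formula; its restriction to $0\leqslant t\leqslant T$ depends only on $f|_{[0,T]}$. Spaces: $\mathcal{F}^T=L_2(0,T)$; $\mathcal{H}^T=L_{2,\rho}(0,x(T))$ with inner product $(u,v)=\int_0^{x(T)}u(x)v(x)\rho(x)\,dx$. Control operator: $W^T:\mathcal{F}^T\to\mathcal{H}^T$, $(W^Tf)(x)=u^f(x,T)$, $0\leqslant x\leqslant x(T)$; it is a bounded bijection with bounded inverse. Connecting operator: $C^T=(W^T)^*W^T:\mathcal{F}^T\to\mathcal{F}^T$. Response operator: $R^T$ in $\mathcal{F}^T$ with domain $\{f\in H^1[0,T]:f(0)=0\}$, $R^Tf=u^f_x(0,\cdot)$; explicitly $$(R^Tf)(t)=-\alpha f'(t)+\beta f(t)+\int_0^tr(t-s)f(s)\,ds,\quad 0\leqslant t\leqslant T,$$ with $\alpha=\rho^{1/2}(0)$, $\beta=-[4\rho(0)]^{-1}\rho'(0)$, $r=w_x(0,\cdot)\in C^\infty[0,T]$. $(R^T)^*$ is its Hilbert space adjoint in $\mathcal{F}^T$. *)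

theory Defs
  imports "HOL-Analysis.Analysis"
begin

section \<open>Smoothness up to the boundary\<close>

text \<open>Derivatives are taken within \<open>S\<close>, hence one-sided at boundary points. The sets used below
  (half-line, quadrant, wedge) have a cone of interior points at each of their points, so these
  derivatives are unique.\<close>

primrec Ck_on :: "nat \<Rightarrow> 'a::real_normed_vector set \<Rightarrow> ('a \<Rightarrow> real) \<Rightarrow> bool" where
  "Ck_on 0 S f = continuous_on S f"
| "Ck_on (Suc k) S f =
     (\<exists>f'. (\<forall>x\<in>S. (f has_derivative f' x) (at x within S)) \<and> (\<forall>v. Ck_on k S (\<lambda>x. f' x v)))"

definition smooth_on :: "'a::real_normed_vector set \<Rightarrow> ('a \<Rightarrow> real) \<Rightarrow> bool" where
  "smooth_on S f \<longleftrightarrow> (\<forall>k. Ck_on k S f)"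


section \<open>Travel time, Dirichlet problem, fundamental solution\<close>

definition tau :: "(real \<Rightarrow> real) \<Rightarrow> real \<Rightarrow> real" where
  "tau \<rho> x = (LBINT s:{0..x}. sqrt (\<rho> s))"

definition xinv :: "(real \<Rightarrow> real) \<Rightarrow> real \<Rightarrow> real" where
  "xinv \<rho> = the_inv_into {0..} (tau \<rho>)"

definition admissible_coeffs :: "(real \<Rightarrow> real) \<Rightarrow> (real \<Rightarrow> real) \<Rightarrow> bool" where
  "admissible_coeffs \<rho> q \<longleftrightarrow>
     smooth_on {0..} \<rho> \<and> smooth_on {0..} q \<and> (\<forall>x\<ge>0. \<rho> x > 0) \<and>
     (\<integral>\<^sup>+x\<in>{0..}. ennreal (sqrt (\<rho> x)) \<partial>lborel) = \<infinity>"

definition classical_solution ::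
  "(real \<Rightarrow> real) \<Rightarrow> (real \<Rightarrow> real) \<Rightarrow> (real \<Rightarrow> real) \<Rightarrow> (real \<Rightarrow> real \<Rightarrow> real) \<Rightarrow> bool" where
  "classical_solution \<rho> q f u \<longleftrightarrow>
     smooth_on ({0..} \<times> {0..}) (\<lambda>(x, t). u x t) \<and>
     (\<forall>x>0. \<forall>t>0. \<rho> x * deriv (deriv (\<lambda>s. u x s)) t - deriv (deriv (\<lambda>z. u z t)) x + q x * u x t = 0) \<and>
     (\<forall>x\<ge>0. u x 0 = 0 \<and> ((\<lambda>t. u x t) has_real_derivative 0) (at 0 within {0..})) \<and>
     (\<forall>t\<ge>0. u 0 t = f t)"

definition ext0 :: "(real \<Rightarrow> real) \<Rightarrow> real \<Rightarrow> real" where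
  "ext0 f t = (if t < 0 then 0 else f t)"

text \<open>\<open>u_sol \<rho> w f x t\<close> is \<open>u\<^sup>f(x,t)\<close>; the integral is over the empty set when \<open>t \<le> \<tau>(x)\<close>.\<close>

definition u_sol ::
  "(real \<Rightarrow> real) \<Rightarrow> (real \<Rightarrow> real \<Rightarrow> real) \<Rightarrow> (real \<Rightarrow> real) \<Rightarrow> real \<Rightarrow> real \<Rightarrow> real" where
  "u_sol \<rho> w f x t =
     (\<rho> x / \<rho> 0) powr (- 1 / 4) * ext0 f (t - tau \<rho> x)
     + (LBINT s:{0<..<t - tau \<rho> x}. w x (t - s) * f s)"

text \<open>That \<open>(\<rho>/\<rho>(0))\<^sup>-\<^sup>1\<^sup>/\<^sup>4 \<delta>(t - \<tau>(x)) + w(x,t)\<close> is the solution for \<open>f = \<delta>\<close> is expressed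
  by testing: its time convolution with any smooth control vanishing near \<open>t = 0\<close>, which is
  \<open>u_sol \<rho> w f\<close>, solves the Dirichlet problem classically. Uniqueness of classical solutions and
  continuity of \<open>w\<close> on the wedge determine \<open>w\<close> for \<open>x \<ge> 0\<close>.\<close>

definition regular_part ::
  "(real \<Rightarrow> real) \<Rightarrow> (real \<Rightarrow> real) \<Rightarrow> (real \<Rightarrow> real \<Rightarrow> real) \<Rightarrow> bool" where
  "regular_part \<rho> q w \<longleftrightarrow>
     smooth_on {(x, t). 0 \<le> x \<and> tau \<rho> x \<le> t} (\<lambda>(x, t). w x t) \<and>
     (\<forall>x\<ge>0. \<forall>t<tau \<rho> x. w x t = 0) \<and>
     (\<forall>f. smooth_on {0..} f \<and> (\<exists>\<epsilon>>0. \<forall>t\<in>{0..<\<epsilon>}. f t = 0)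
        \<longrightarrow> classical_solution \<rho> q f (u_sol \<rho> w f))"


section \<open>Real \<open>L\<^sub>2\<close> spaces and Hilbert space adjoints\<close>

text \<open>Elements of \<open>L\<^sub>2\<close> are represented by functions; equality of elements is equality almost
  everywhere.\<close>

definition L2 :: "'a measure \<Rightarrow> ('a \<Rightarrow> real) set" where
  "L2 M = {f \<in> borel_measurable M. integrable M (\<lambda>x. (f x)\<^sup>2)}"

definition L2_inner :: "'a measure \<Rightarrow> ('a \<Rightarrow> real) \<Rightarrow> ('a \<Rightarrow> real) \<Rightarrow> real" where
  "L2_inner M f g = (\<integral>x. f x * g x \<partial>M)"

text \<open>For an operator \<open>A\<close> from \<open>L2 M\<close> to \<open>L2 N\<close> with dense domain \<open>D\<close>: \<open>v\<close> is in the domain of the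
  adjoint iff some \<open>g\<close> in \<open>L2 M\<close> represents the functional \<open>f \<mapsto> (A f, v)\<close> on \<open>D\<close>. That \<open>g\<close> is
  unique up to null sets, and the adjoint maps \<open>v\<close> to it.\<close>

definition adj_rel ::
  "'a measure \<Rightarrow> 'b measure \<Rightarrow> ('a \<Rightarrow> real) set \<Rightarrow> (('a \<Rightarrow> real) \<Rightarrow> 'b \<Rightarrow> real) \<Rightarrow>
   ('b \<Rightarrow> real) \<Rightarrow> ('a \<Rightarrow> real) \<Rightarrow> bool" where
  "adj_rel M N D A v g \<longleftrightarrow>
     v \<in> L2 N \<and> g \<in> L2 M \<and> (\<forall>f\<in>D. L2_inner N (A f) v = L2_inner M f g)"

definition adj_dom ::
  "'a measure \<Rightarrow> 'b measure \<Rightarrow> ('a \<Rightarrow> real) set \<Rightarrow> (('a \<Rightarrow> real) \<Rightarrow> 'b \<Rightarrow> real) \<Rightarrow> ('b \<Rightarrow> real) set" where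
  "adj_dom M N D A = {v. \<exists>g. adj_rel M N D A v g}"

definition adj_op ::
  "'a measure \<Rightarrow> 'b measure \<Rightarrow> ('a \<Rightarrow> real) set \<Rightarrow> (('a \<Rightarrow> real) \<Rightarrow> 'b \<Rightarrow> real) \<Rightarrow>
   ('b \<Rightarrow> real) \<Rightarrow> 'a \<Rightarrow> real" where
  "adj_op M N D A v = (SOME g. adj_rel M N D A v g)"


section \<open>The spaces \<open>\<F>\<^sup>T\<close>, \<open>\<H>\<^sup>T\<close> and the operators of the dynamical system\<close>

definition F_meas :: "real \<Rightarrow> real measure" where
  "F_meas T = restrict_space lborel {0<..<T}"

definition H_meas :: "(real \<Rightarrow> real) \<Rightarrow> real \<Rightarrow> real measure" where
  "H_meas \<rho> T = density (restrict_space lborel {0<..<xinv \<rho> T}) (\<lambda>x. ennreal (\<rho> x))"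

definition W_op ::
  "(real \<Rightarrow> real) \<Rightarrow> (real \<Rightarrow> real \<Rightarrow> real) \<Rightarrow> real \<Rightarrow> (real \<Rightarrow> real) \<Rightarrow> real \<Rightarrow> real" where
  "W_op \<rho> w T f = (\<lambda>x. u_sol \<rho> w f x T)"

definition C_op ::
  "(real \<Rightarrow> real) \<Rightarrow> (real \<Rightarrow> real \<Rightarrow> real) \<Rightarrow> real \<Rightarrow> (real \<Rightarrow> real) \<Rightarrow> real \<Rightarrow> real" where
  "C_op \<rho> w T f =
     adj_op (F_meas T) (H_meas \<rho> T) (L2 (F_meas T)) (W_op \<rho> w T) (W_op \<rho> w T f)"

text \<open>Elements of \<open>H\<^sup>1[0,T]\<close> are represented by their absolutely continuous representatives
  on \<open>[0,T]\<close>, so that \<open>f(0)\<close> makes sense and \<open>u\<^sup>f\<^sub>x(0,t)\<close> exists for almost all \<open>t\<close>.\<close>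

definition R_dom :: "real \<Rightarrow> (real \<Rightarrow> real) set" where
  "R_dom T = {f. f 0 = 0 \<and>
     (\<exists>g\<in>L2 (F_meas T). \<forall>t\<in>{0..T}. f t = f 0 + (LBINT s:{0<..<t}. g s))}"

definition R_op ::
  "(real \<Rightarrow> real) \<Rightarrow> (real \<Rightarrow> real \<Rightarrow> real) \<Rightarrow> (real \<Rightarrow> real) \<Rightarrow> real \<Rightarrow> real" where
  "R_op \<rho> w f = (\<lambda>t. vector_derivative (\<lambda>x. u_sol \<rho> w f x t) (at 0 within {0..}))"

definition kappa :: "real \<Rightarrow> real \<Rightarrow> real" where
  "kappa T t = T - t"

definition stationary_solution ::
  "(real \<Rightarrow> real) \<Rightarrow> real \<Rightarrow> (real \<Rightarrow> real) \<Rightarrow> bool" where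
  "stationary_solution q X y \<longleftrightarrow>
     (\<forall>x\<in>{0<..<X}. y differentiable (at x) \<and> deriv y differentiable (at x) \<and>
        - deriv (deriv y) x + q x * y x = 0)"

end

theory Submission
  imports Defs
begin

text \<open>
  Write \<open>W\<close> for the control operator and \<open>\<kappa>\<close> for \<open>t \<mapsto> T - t\<close>. Suppose that \<open>W f = y\<close> and that
  \<open>b\<close> represents \<open>h \<mapsto> (W h, y)\<close>. Then \<open>C g - b\<close> represents \<open>h \<mapsto> (W h, W g - y)\<close>. If \<open>C g = b\<close>, the
  choice \<open>h = g - f\<close> gives \<open>\<parallel>W g - y\<parallel>\<^sup>2 = 0\<close>, and \<open>g = f\<close> because \<open>W\<close> is injective; if \<open>g = f\<close>,
  the choice \<open>h = C g - b\<close> gives \<open>C g = b\<close>. This is \<open>connecting_equation\<close>, and the theorem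
  reduces to showing that \<open>W\<close> is injective with everywhere defined adjoint, that \<open>y\<close> is in its
  range, and that \<open>b = y'(0) \<kappa> - y(0) R\<^sup>* \<kappa>\<close>.

  The formula for \<open>b\<close> is Green's formula. Let \<open>f\<close> be smooth and vanish near \<open>t = 0\<close>, and let
  \<open>u\<close> be the wave that it generates. As \<open>y'' = q y\<close>, the wave equation says that \<open>u\<^sub>x y - u y'\<close> has
  \<open>x\<close>-derivative \<open>\<rho> u\<^sub>t\<^sub>t y\<close>. Up to time \<open>T\<close> the wave vanishes near \<open>x(T)\<close>, so integration over
  \<open>[0, x(T)]\<close> gives \<open>\<integral> \<rho> u\<^sub>t\<^sub>t y dx = y'(0) f(t) - y(0) (R f)(t)\<close>. Multiplying by \<open>T - t\<close> and
  integrating over \<open>[0, T]\<close> removes both time derivatives, since \<open>u\<close> and \<open>u\<^sub>t\<close> start from zero: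
  \<open>(W f, y) = y'(0) (f, \<kappa>) - y(0) (R f, \<kappa>)\<close>. This is \<open>smooth_control_duality\<close>. By
  \<open>smooth_controls_total\<close> such controls are total in \<open>L\<^sub>2(0,T)\<close>, so the identity determines \<open>b\<close>.

  The properties of \<open>W\<close> follow from the representation of \<open>u\<^sup>f\<close>. In the variable \<open>r = T - \<tau>(x)\<close>,
  and after multiplication by \<open>\<rho>\<^sup>1\<^sup>/\<^sup>4\<close>, which makes the passage isometric, \<open>W\<close> becomes a Volterra
  operator of the second kind whose diagonal part is the constant \<open>\<rho>(0)\<^sup>1\<^sup>/\<^sup>4\<close> (\<open>hat_W\<close>). Such
  operators have an adjoint by Fubini's theorem, are injective by Gronwall's inequality, and can be
  solved for continuous data by a contraction argument. The last point suffices for \<open>y\<close>, because an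
  energy estimate shows that \<open>y\<close> and \<open>y'\<close> extend continuously to \<open>[0, x(T)]\<close>
  (\<open>stationary_solution_extends\<close>).

  That \<open>\<kappa>\<close> is in the domain of \<open>R\<^sup>*\<close> requires \<open>R f\<close> for every \<open>f\<close> in the domain of \<open>R\<close>. The
  \<open>x\<close>-derivative of \<open>u\<^sup>f\<close> at \<open>x = 0\<close> exists at every \<open>t\<close> where \<open>f\<close> has a left derivative, hence for
  almost all \<open>t\<close> by Lebesgue's theorem (\<open>AE_left_derivative_of_integral\<close>); elsewhere \<open>R_op\<close> takes
  an arbitrary but fixed value. As the integrals are taken with respect to a Borel measure that is
  not complete, \<open>R f\<close> has to be shown Borel measurable including these exceptional points, which
  is done by \<open>measurable_right_limit\<close>.
\<close>

section \<open>Left derivatives of indefinite integrals\<close>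

text \<open>By Henstock's lemma the errors \<open>(t - s) f(t) - \<integral>\<^sub>s\<^sup>t f\<close> have a small sum over every sufficiently fine
  family of disjoint intervals \<open>[s, t]\<close>. Vitali's theorem covers the bad set, up to a null set, by such
  a family on which each error exceeds \<open>c (t - s)\<close>; so the total length of the family is small.\<close>

lemma negligible_bad_left_averages:
  fixes f :: "real \<Rightarrow> real"
  assumes f: "f integrable_on {a..b}" and c: "c > 0"
  shows "negligible {t \<in> {a<..b}. \<forall>d>0. \<exists>s\<in>{a..<t}. t - s < d \<and>
           c * (t - s) < \<bar>(t - s) * f t - integral {s..t} f\<bar>}" (is "negligible ?E")
  unfolding negligible_outer_le
proof (intro allI impI)
  fix e :: real assume e: "e > 0"
  have "c * e > 0" using c e by simp
  then obtain \<gamma> where "gauge \<gamma>" and \<gamma>: "\<And>p. p tagged_partial_division_of (cbox a b) \<Longrightarrow> \<gamma> fine p \<Longrightarrow>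
       (\<Sum>(x,k)\<in>p. norm (measure lborel k *\<^sub>R f x - integral k f)) < c * e"
    using Henstock_lemma[of f a b "c * e"] f by auto
  define K where "K = {(s,t). a \<le> s \<and> s < t \<and> t \<le> b \<and> {s..t} \<subseteq> \<gamma> t \<and>
       c * (t - s) < \<bar>(t - s) * f t - integral {s..t} f\<bar>}"
  define z r where "z = (\<lambda>(s::real,t). (s + t) / 2)" and "r = (\<lambda>(s::real,t). (t - s) / 2)"
  have ball: "cball (z i) (r i) = {fst i..snd i}" for i
    by (auto simp: z_def r_def cball_eq_atLeastAtMost split: prod.splits) (auto simp: field_simps)
  have r: "0 < r i" if "i \<in> K" for i using that by (auto simp: K_def r_def)
  \<comment> \<open>The pairs in \<open>K\<close> stand for the intervals \<open>[s, t]\<close>, with centre \<open>z\<close> and radius \<open>r\<close>.\<close>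
  have cov: "\<exists>i. i \<in> K \<and> x \<in> cball (z i) (r i) \<and> r i < d" if x: "x \<in> ?E" and d: "0 < d" for x d
  proof -
    have "open (\<gamma> x)" "x \<in> \<gamma> x" using \<open>gauge \<gamma>\<close> by (auto simp: gauge_def)
    then obtain d' where d': "d' > 0" "ball x d' \<subseteq> \<gamma> x" by (meson openE)
    obtain s where s: "s \<in> {a..<x}" "x - s < min d d'" "c * (x - s) < \<bar>(x - s) * f x - integral {s..x} f\<bar>"
      using x d d'(1) by (auto dest!: spec[of _ "min d d'"])
    have "{s..x} \<subseteq> ball x d'" using s by (auto simp: dist_real_def)
    then have "(s, x) \<in> K" using s x d' by (auto simp: K_def)
    moreover have "r (s,x) < d" using s by (auto simp: r_def)
    ultimately show ?thesis using s unfolding ball by (intro exI[of _ "(s,x)"]) auto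
  qed
  obtain C where C: "countable C" "C \<subseteq> K"
     "pairwise (\<lambda>i j. disjnt (cball (z i) (r i)) (cball (z j) (r j))) C"
     "negligible (?E - (\<Union>i \<in> C. cball (z i) (r i)))"
    using Vitali_covering_theorem_cballs[of K r ?E z] r cov by blast
  have bound: "measure lebesgue (\<Union>i\<in>I. cball (z i) (r i)) \<le> e" if I: "I \<subseteq> C" "finite I" for I
  proof -
    let ?t = "\<lambda>i. (snd i, {fst i..snd i})"
    have inj: "inj_on ?t I"
      using I(1) C(2) by (auto simp: inj_on_def K_def)
    have disj: "{fst i..snd i} \<inter> {fst j..snd j} = {}" if "i \<in> I" "j \<in> I" "i \<noteq> j" for i j
      using C(3) that I(1) unfolding ball pairwise_def disjnt_def by blast
    have "?t ` I tagged_partial_division_of (cbox a b)"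
      unfolding tagged_partial_division_of_def
    proof (intro conjI allI impI)
      show "finite (?t ` I)" using I by simp
      fix x k assume xk: "(x, k) \<in> ?t ` I"
      then obtain i where i: "i \<in> K" "x = snd i" "k = {fst i..snd i}" using I C by auto
      show "x \<in> k" "k \<subseteq> cbox a b" using i by (auto simp: K_def)
      show "\<exists>a b. k = cbox a b" using i by (metis box_real(2))
    next
      fix x k x' k' assume "(x, k) \<in> ?t ` I \<and> (x', k') \<in> ?t ` I \<and> (x, k) \<noteq> (x', k')"
      then have xk: "(x, k) \<in> ?t ` I" and xk': "(x', k') \<in> ?t ` I" and ne: "(x, k) \<noteq> (x', k')"
        by auto
      from xk xk' ne obtain i' j' where ij: "i' \<in> I" "j' \<in> I" "i' \<noteq> j'" "(x, k) = ?t i'" "(x', k') = ?t j'"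
        by (metis (no_types, lifting) imageE)
      then have "k \<inter> k' = {}" using disj by simp
      then show "interior k \<inter> interior k' = {}" using interior_subset by blast
    qed
    moreover have "\<gamma> fine ?t ` I" 
    proof -
      have "{fst i..snd i} \<subseteq> \<gamma> (snd i)" if "i \<in> I" for i using that I C(2) by (auto 0 3 simp: K_def)
      then show ?thesis by (auto simp: fine_def)
    qed
    ultimately have "(\<Sum>(x,k)\<in>?t ` I. norm (measure lborel k *\<^sub>R f x - integral k f)) < c * e" by (rule \<gamma>)
    note sum_less = this
    then have sum_less': "(\<Sum>i\<in>I. \<bar>(snd i - fst i) * f (snd i) - integral {fst i..snd i} f\<bar>) < c * e"
    proof -
      have "(\<Sum>(x,k)\<in>?t ` I. norm (measure lborel k *\<^sub>R f x - integral k f)) =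
          (\<Sum>i\<in>I. \<bar>(snd i - fst i) * f (snd i) - integral {fst i..snd i} f\<bar>)"
        unfolding sum.reindex[OF inj] o_def case_prod_conv
      proof (rule sum.cong[OF refl])
        fix i assume "i \<in> I"
        then have "fst i \<le> snd i" using I C(2) by (auto simp: K_def)
        then show "norm (measure lborel {fst i..snd i} *\<^sub>R f (snd i) - integral {fst i..snd i} f) =
          \<bar>(snd i - fst i) * f (snd i) - integral {fst i..snd i} f\<bar>" by simp
      qed
      with sum_less show ?thesis by simp
    qed
    have "c * measure lebesgue (\<Union>i\<in>I. cball (z i) (r i)) \<le> c * (\<Sum>i\<in>I. measure lebesgue (cball (z i) (r i)))"
      using c I by (intro mult_left_mono measure_UNION_le) auto
    also have "\<dots> = (\<Sum>i\<in>I. c * (snd i - fst i))"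
      using I C(2) unfolding ball sum_distrib_left by (intro sum.cong) (auto simp: K_def)
    also have "\<dots> \<le> (\<Sum>i\<in>I. \<bar>(snd i - fst i) * f (snd i) - integral {fst i..snd i} f\<bar>)"
      using I C(2) by (intro sum_mono) (auto simp: K_def)
    finally have "c * measure lebesgue (\<Union>i\<in>I. cball (z i) (r i)) < c * e"
      using sum_less' by (rule order.strict_trans1)
    then show ?thesis using c by simp
  qed
  have U: "(\<Union>i\<in>C. cball (z i) (r i)) \<in> lmeasurable" "measure lebesgue (\<Union>i\<in>C. cball (z i) (r i)) \<le> e"
    by (simp_all add: fmeasurable_UN_bound[OF C(1) _ bound] measure_UN_bound[OF C(1) _ bound])
  let ?N = "?E - (\<Union>i \<in> C. cball (z i) (r i))"
  have N: "?N \<in> lmeasurable" "measure lebesgue ?N = 0"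
    using negligible_imp_measurable[OF C(4)] negligible_imp_measure0[OF C(4)] by simp_all
  show "\<exists>T. ?E \<subseteq> T \<and> T \<in> lmeasurable \<and> measure lebesgue T \<le> e"
  proof (intro exI conjI)
    let ?T = "(\<Union>i\<in>C. cball (z i) (r i)) \<union> ?N"
    show "?E \<subseteq> ?T" by blast
    show "?T \<in> lmeasurable" by (rule fmeasurable.Un[OF U(1) N(1)])
    show "measure lebesgue ?T \<le> e"
      using measure_Un_le[OF fmeasurableD[OF U(1)] fmeasurableD[OF N(1)]] U(2) N(2) by linarith
  qed
qed

text \<open>Only left derivatives are needed, because at time \<open>t\<close> the wave near \<open>x = 0\<close> depends on the control
  at the earlier times \<open>t - \<tau>(x)\<close>. They also make it possible to cover the bad set by intervals that
  have the bad point as an endpoint and therefore as an admissible tag.\<close>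

theorem AE_left_derivative_of_integral:
  fixes f :: "real \<Rightarrow> real"
  assumes f: "f integrable_on {a..b}"
  shows "AE t in lborel. t \<in> {a<..b} \<longrightarrow>
    ((\<lambda>s. integral {a..s} f) has_real_derivative f t) (at t within {a..t})"
proof -
  define E where "E n = {t \<in> {a<..b}. \<forall>d>0. \<exists>s\<in>{a..<t}. t - s < d \<and>
           inverse (Suc n) * (t - s) < \<bar>(t - s) * f t - integral {s..t} f\<bar>}" for n
  have "negligible (\<Union>n. E n)"
    unfolding E_def by (rule negligible_Union_nat) (intro negligible_bad_left_averages f, simp)
  then have "AE t in lborel. t \<notin> (\<Union>n. E n)"
    using AE_not_in[of "\<Union>n. E n" lebesgue] unfolding negligible_iff_null_sets AE_completion_iff by simp
  then show ?thesis
  proof (rule AE_mp, intro AE_I2 impI)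
    fix t assume t: "t \<notin> (\<Union>n. E n)" "t \<in> {a<..b}"
    have split: "integral {a..t} f - integral {a..s} f = integral {s..t} f" if "s \<in> {a..t}" for s
      using Henstock_Kurzweil_Integration.integral_combine[of a s t f] that t(2)
        integrable_on_subinterval[OF f, of a t] by auto
    show "((\<lambda>s. integral {a..s} f) has_real_derivative f t) (at t within {a..t})"
      unfolding has_field_derivative_def has_derivative_within_alt
    proof (intro conjI allI impI)
      show "bounded_linear ((*) (f t))" by (rule bounded_linear_mult_right)
      fix e :: real assume "e > 0"
      then obtain n where n: "inverse (Suc n) < e" using reals_Archimedean by auto
      from t have "t \<notin> E n" by blast
      then have "\<not> (\<forall>d>0. \<exists>s\<in>{a..<t}. t - s < d \<and>
           inverse (Suc n) * (t - s) < \<bar>(t - s) * f t - integral {s..t} f\<bar>)"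
        using t(2) unfolding E_def by simp
      then obtain d where d: "d > 0" "\<And>s. s \<in> {a..<t} \<Longrightarrow> t - s < d \<Longrightarrow>
          \<bar>(t - s) * f t - integral {s..t} f\<bar> \<le> inverse (Suc n) * (t - s)"
        by (metis not_less)
      show "\<exists>d>0. \<forall>s\<in>{a..t}. norm (s - t) < d \<longrightarrow>
         norm (integral {a..s} f - integral {a..t} f - f t * (s - t)) \<le> e * norm (s - t)"
      proof (intro exI[of _ d] conjI ballI impI d(1))
        fix s assume s: "s \<in> {a..t}" "norm (s - t) < d"
        show "norm (integral {a..s} f - integral {a..t} f - f t * (s - t)) \<le> e * norm (s - t)"
        proof (cases "s = t")
          case False
          then have "\<bar>(t - s) * f t - integral {s..t} f\<bar> \<le> inverse (Suc n) * (t - s)"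
            using d(2)[of s] s by auto
          also have "\<dots> \<le> e * (t - s)" using n s by (intro mult_right_mono) auto
          finally show ?thesis using split[OF s(1)] s by (auto simp: algebra_simps abs_if split: if_splits)
        qed simp
      qed
    qed
  qed
qed

section \<open>Square integrable functions on a bounded interval\<close>

lemma continuous_on_interval_bounded:
  fixes f :: "real \<Rightarrow> real"
  assumes "continuous_on {a..b} f" shows "\<exists>B. \<forall>x\<in>{a..b}. \<bar>f x\<bar> \<le> B"
  using compact_imp_bounded[OF compact_continuous_image[OF assms compact_Icc]]
  by (auto simp: bounded_iff)

lemma L2_mult_integrable:
  assumes "f \<in> L2 M" "g \<in> L2 M"
  shows "integrable M (\<lambda>x. f x * g x)"
proof (rule Bochner_Integration.integrable_bound)
  show "integrable M (\<lambda>x. (f x)\<^sup>2 + (g x)\<^sup>2)" "(\<lambda>x. f x * g x) \<in> borel_measurable M"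
    using assms by (auto simp: L2_def)
  have "\<bar>a * b\<bar> \<le> a\<^sup>2 + b\<^sup>2" for a b :: real
  proof -
    have "0 \<le> \<bar>a\<bar> * \<bar>b\<bar>" by simp
    moreover have "2 * (\<bar>a\<bar> * \<bar>b\<bar>) \<le> a\<^sup>2 + b\<^sup>2"
      using sum_squares_bound[of "\<bar>a\<bar>" "\<bar>b\<bar>"] by (simp add: mult.assoc)
    ultimately have "\<bar>a\<bar> * \<bar>b\<bar> \<le> a\<^sup>2 + b\<^sup>2" by linarith
    then show ?thesis by (simp add: abs_mult)
  qed
  then show "AE x in M. norm (f x * g x) \<le> norm ((f x)\<^sup>2 + (g x)\<^sup>2)" by auto
qed

lemma L2_add:
  assumes "f \<in> L2 M" "g \<in> L2 M" shows "(\<lambda>x. f x + g x) \<in> L2 M"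
proof -
  have "integrable M (\<lambda>x. (f x)\<^sup>2 + 2 * (f x * g x) + (g x)\<^sup>2)"
    using assms L2_mult_integrable[OF assms] by (auto simp: L2_def)
  then show ?thesis using assms by (auto simp: L2_def power2_sum algebra_simps)
qed

lemma L2_cmult: "f \<in> L2 M \<Longrightarrow> (\<lambda>x. c * f x) \<in> L2 M"
  by (auto simp: L2_def power_mult_distrib)

lemma L2_diff:
  assumes "f \<in> L2 M" "g \<in> L2 M" shows "(\<lambda>x. f x - g x) \<in> L2 M"
  using L2_add[OF assms(1) L2_cmult[OF assms(2), of "-1"]] by simp

lemma L2_inner_diff_left:
  assumes "f \<in> L2 M" "g \<in> L2 M" "h \<in> L2 M"
  shows "L2_inner M (\<lambda>x. f x - g x) h = L2_inner M f h - L2_inner M g h"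
  using L2_mult_integrable[OF assms(1,3)] L2_mult_integrable[OF assms(2,3)]
  by (simp add: L2_inner_def left_diff_distrib)

lemma L2_inner_commute: "L2_inner M f g = L2_inner M g f"
  by (simp add: L2_inner_def mult.commute)

lemma L2_inner_diff_right:
  assumes "f \<in> L2 M" "g \<in> L2 M" "h \<in> L2 M"
  shows "L2_inner M h (\<lambda>x. f x - g x) = L2_inner M h f - L2_inner M h g"
  using L2_inner_diff_left[OF assms] by (simp add: L2_inner_commute)

lemma L2_inner_cmult_right: "L2_inner M f (\<lambda>x. c * g x) = c * L2_inner M f g"
  by (simp add: L2_inner_def algebra_simps)

lemma L2_inner_self_zero:
  assumes "f \<in> L2 M" "L2_inner M f f = 0" shows "AE x in M. f x = 0"
  using assms integral_nonneg_eq_0_iff_AE[of M "\<lambda>x. (f x)\<^sup>2"]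
  by (simp add: L2_def L2_inner_def power2_eq_square)

text \<open>Measurability of \<open>g\<close> is a hypothesis, since on a measure space that is not complete it does not
  follow from the almost everywhere equality.\<close>

lemma L2_cong_AE:
  assumes "f \<in> L2 M" "g \<in> borel_measurable M" "AE x in M. f x = g x" shows "g \<in> L2 M"
proof -
  have "integrable M (\<lambda>x. (g x)\<^sup>2) \<longleftrightarrow> integrable M (\<lambda>x. (f x)\<^sup>2)"
    using assms by (intro integrable_cong_AE) (auto simp: L2_def)
  then show ?thesis using assms by (auto simp: L2_def)
qed

lemma L2_inner_cong_AE:
  assumes "f \<in> L2 M" "g \<in> L2 M" "h \<in> L2 M" "AE x in M. f x = g x"
  shows "L2_inner M f h = L2_inner M g h"
  unfolding L2_inner_def using assms by (intro integral_cong_AE) (auto simp: L2_def)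

lemma space_F [simp]: "space (F_meas T) = {0<..<T}"
  by (simp add: F_meas_def)

lemma AE_F: "(AE t in F_meas T. P t) \<longleftrightarrow> (AE t in lborel. t \<in> {0<..<T} \<longrightarrow> P t)"
  unfolding F_meas_def by (subst AE_restrict_space_iff) auto

lemma integrable_F: "integrable (F_meas T) f \<longleftrightarrow> set_integrable lborel {0<..<T} f"
  for f :: "real \<Rightarrow> real"
  unfolding F_meas_def set_integrable_def by (subst integrable_restrict_space) auto

lemma integral_F: "integral\<^sup>L (F_meas T) f = (LBINT t:{0<..<T}. f t)" for f :: "real \<Rightarrow> real"
  unfolding F_meas_def set_lebesgue_integral_def by (subst integral_restrict_space) auto

lemma measurable_F_borel: "f \<in> borel_measurable borel \<Longrightarrow> f \<in> borel_measurable (F_meas T)"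
  unfolding F_meas_def by (rule measurable_restrict_space1) simp

lemma measurable_F_iff:
  "f \<in> borel_measurable (F_meas T) \<longleftrightarrow> (\<lambda>t. indicator {0<..<T} t * f t) \<in> borel_measurable borel"
  for f :: "real \<Rightarrow> real"
  unfolding F_meas_def by (subst borel_measurable_restrict_space_iff) auto

lemma measurable_F_continuous:
  fixes f :: "real \<Rightarrow> real"
  assumes "continuous_on {0<..<T} f" shows "f \<in> borel_measurable (F_meas T)"
  using borel_measurable_continuous_on_indicator[OF _ assms] by (simp add: measurable_F_iff)

lemma finite_measure_F: "finite_measure (F_meas T)"
proof (rule finite_measureI)
  have "emeasure lborel {0<..<T} \<le> emeasure lborel {0..\<bar>T\<bar>}" by (intro emeasure_mono) auto
  also have "\<dots> < \<infinity>" by simp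
  finally show "emeasure (F_meas T) (space (F_meas T)) \<noteq> \<infinity>"
    by (simp add: F_meas_def emeasure_restrict_space)
qed

lemma bounded_L2_F:
  assumes "f \<in> borel_measurable (F_meas T)" "\<And>t. t \<in> {0<..<T} \<Longrightarrow> \<bar>f t\<bar> \<le> B"
  shows "f \<in> L2 (F_meas T)"
proof -
  interpret finite_measure "F_meas T" by (rule finite_measure_F)
  have le: "(f t)\<^sup>2 \<le> B\<^sup>2" if "t \<in> {0<..<T}" for t
    using power_mono[OF assms(2)[OF that], of 2] by simp
  have "integrable (F_meas T) (\<lambda>x. (f x)\<^sup>2)"
  proof (rule integrable_const_bound[of _ "B\<^sup>2"])
    show "AE x in F_meas T. norm ((f x)\<^sup>2) \<le> B\<^sup>2"
      unfolding AE_F by (rule AE_I2) (use le in simp)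
  qed (use assms in simp)
  then show ?thesis using assms(1) by (simp add: L2_def)
qed

lemma L2_F_integrable: assumes "f \<in> L2 (F_meas T)" shows "integrable (F_meas T) f"
proof -
  have "(\<lambda>t. 1) \<in> L2 (F_meas T)" by (rule bounded_L2_F[of _ _ 1]) auto
  from L2_mult_integrable[OF assms this] show ?thesis by simp
qed

lemma continuous_L2_F:
  fixes f :: "real \<Rightarrow> real"
  assumes "continuous_on {0..T} f" shows "f \<in> L2 (F_meas T)"
proof -
  obtain B where "\<forall>t\<in>{0..T}. \<bar>f t\<bar> \<le> B"
    using continuous_on_interval_bounded[OF assms] by blast
  moreover have "continuous_on {0<..<T} f" by (rule continuous_on_subset[OF assms]) auto
  ultimately show ?thesis by (intro bounded_L2_F[of _ _ B] measurable_F_continuous) auto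
qed

lemma set_integral_open_eq_integral:
  fixes f :: "real \<Rightarrow> real"
  assumes "set_integrable lborel {a<..<b} f"
  shows "f integrable_on {a..b}" "(LBINT t:{a<..<b}. f t) = integral {a..b} f"
proof -
  have "f integrable_on {a<..<b}" using set_borel_integral_eq_integral(1)[OF assms] .
  then show "f integrable_on {a..b}" by (simp add: integrable_on_Icc_iff_Ioo)
  show "(LBINT t:{a<..<b}. f t) = integral {a..b} f"
    using set_borel_integral_eq_integral(2)[OF assms] by (simp add: integral_open_interval_real)
qed

lemma continuous_integral_F:
  fixes f :: "real \<Rightarrow> real"
  assumes "continuous_on {a..b} f"
  shows "set_integrable lborel {a<..<b} f" "(LBINT t:{a<..<b}. f t) = integral {a..b} f"
proof -
  show *: "set_integrable lborel {a<..<b} f"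
    by (rule set_integrable_subset[OF borel_integrable_atLeastAtMost'[OF assms]]) auto
  show "(LBINT t:{a<..<b}. f t) = integral {a..b} f" by (rule set_integral_open_eq_integral[OF *])
qed

lemma integrable_F_indefinite:
  fixes g :: "real \<Rightarrow> real"
  assumes "integrable (F_meas T) g" "t \<le> T"
  shows "set_integrable lborel {0<..<t} g" "(LBINT s:{0<..<t}. g s) = integral {0..t} g"
proof -
  show *: "set_integrable lborel {0<..<t} g"
    using assms by (intro set_integrable_subset[OF assms(1)[unfolded integrable_F]]) auto
  show "(LBINT s:{0<..<t}. g s) = integral {0..t} g" by (rule set_integral_open_eq_integral[OF *])
qed

lemma AE_F_left_derivative:
  fixes g :: "real \<Rightarrow> real"
  assumes "integrable (F_meas T) g"
  shows "AE t in F_meas T. ((\<lambda>s. LBINT r:{0<..<s}. g r) has_real_derivative g t) (at t within {0..t})"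
proof -
  have "g integrable_on {0..T}"
    using set_integral_open_eq_integral(1) assms by (simp add: integrable_F)
  from AE_left_derivative_of_integral[OF this] show ?thesis
    unfolding AE_F
  proof (rule AE_mp, intro AE_I2 impI)
    fix t assume *: "t \<in> {0<..T} \<longrightarrow> ((\<lambda>s. integral {0..s} g) has_real_derivative g t) (at t within {0..t})"
      and t: "t \<in> {0<..<T}"
    then have "((\<lambda>s. integral {0..s} g) has_real_derivative g t) (at t within {0..t})" by auto
    then show "((\<lambda>s. LBINT r:{0<..<s}. g r) has_real_derivative g t) (at t within {0..t})"
      by (rule has_field_derivative_transform_within[OF _ zero_less_one])
        (use t in \<open>auto simp: integrable_F_indefinite(2)[OF assms]\<close>)
  qed
qed

text \<open>If all integrals over \<open>(0, t)\<close> vanish, the left derivatives of the zero function recover \<open>g\<close>.\<close>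

lemma integrable_F_zero:
  fixes g :: "real \<Rightarrow> real"
  assumes "integrable (F_meas T) g" "\<And>t. t \<in> {0<..<T} \<Longrightarrow> (LBINT s:{0<..<t}. g s) = 0"
  shows "AE t in F_meas T. g t = 0"
  using AE_F_left_derivative[OF assms(1)]
  unfolding AE_F
proof (rule AE_mp, intro AE_I2 impI)
  fix t assume *: "t \<in> {0<..<T} \<longrightarrow>
       ((\<lambda>s. LBINT r:{0<..<s}. g r) has_real_derivative g t) (at t within {0..t})" and t: "t \<in> {0<..<T}"
  have z: "(LBINT s:{0<..<r}. g s) = 0" if "r \<in> {0..t}" for r
    using assms(2)[of r] that t by (cases "r = 0") (auto simp: set_lebesgue_integral_def)
  have "((\<lambda>s. LBINT r:{0<..<s}. g r) has_real_derivative g t) (at t within {0..t})"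
    using * t by blast
  then have "((\<lambda>s. 0) has_real_derivative g t) (at t within {0..t})"
    by (rule has_field_derivative_transform_within[OF _ zero_less_one])
      (use t z in simp_all)
  moreover have "((\<lambda>s. 0) has_real_derivative 0) (at t within {0..t})" by simp
  moreover have "at t within {0..t} \<noteq> bot" using t by (simp add: at_within_Icc_at_left)
  ultimately show "g t = 0" by (meson has_field_derivative_unique)
qed

text \<open>Rescaling to a fixed interval turns continuous dependence of an integral on its upper limit into
  continuous dependence on a parameter.\<close>

lemma integral_rescale:
  fixes \<phi> :: "real \<Rightarrow> real"
  assumes r: "0 \<le> r" and \<phi>: "continuous_on {0..r} \<phi>"
  shows "integral {0..r} \<phi> = r * integral {0..1} (\<lambda>\<sigma>. \<phi> (r * \<sigma>))"
proof -
  have "((\<lambda>\<sigma>. r *\<^sub>R \<phi> (r * \<sigma>)) has_integral integral {r * 0..r * 1} \<phi>) {0..1}"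
  proof (rule has_integral_substitution[where c = 0 and d = r])
    have "0 \<le> r * \<sigma> \<and> r * \<sigma> \<le> r" if "0 \<le> \<sigma>" "\<sigma> \<le> 1" for \<sigma>
      using mult_left_mono[OF that(1), of r] mult_left_mono[OF that(2), of r] r by simp
    then show "(\<lambda>\<sigma>. r * \<sigma>) ` {0..1} \<subseteq> {0..r}" by auto
  qed (use r \<phi> in \<open>auto intro!: derivative_eq_intros\<close>)
  from integral_unique[OF this]
  have "integral {0..r} \<phi> = integral {0..1} (\<lambda>\<sigma>. r * \<phi> (r * \<sigma>))"
    by (simp only: real_scaleR_def mult_zero_right mult_1_right)
  then show ?thesis by simp
qed

section \<open>Smooth functions and their partial derivatives\<close>

lemma Ck_on_imp_continuous_on: "Ck_on k S f \<Longrightarrow> continuous_on S f"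
proof (cases k)
  case (Suc j)
  assume "Ck_on k S f"
  then obtain f' where "\<forall>x\<in>S. (f has_derivative f' x) (at x within S)" using Suc by auto
  then show ?thesis by (intro has_derivative_continuous_on) blast
qed simp

lemma smooth_on_imp_continuous_on: "smooth_on S f \<Longrightarrow> continuous_on S f"
  unfolding smooth_on_def by (metis Ck_on.simps(1))

lemma smooth_on_imp_differentiable:
  fixes f :: "real \<Rightarrow> real"
  assumes "smooth_on S f" "x \<in> S"
  obtains D where "(f has_real_derivative D) (at x within S)"
proof -
  have "Ck_on (Suc 0) S f" using assms(1) unfolding smooth_on_def by blast
  then obtain f' where "(f has_derivative f' x) (at x within S)" using assms(2) by auto
  then have "f differentiable (at x within S)" by (auto simp: differentiable_def)
  then show ?thesis using that by (auto simp: real_differentiable_def)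
qed

lemma Ck_on_add:
  "Ck_on k S f \<Longrightarrow> Ck_on k S g \<Longrightarrow> Ck_on k S (\<lambda>x. f x + g x)"
proof (induction k arbitrary: f g)
  case (Suc k)
  obtain f' g' where d: "\<forall>x\<in>S. (f has_derivative f' x) (at x within S)" "\<forall>v. Ck_on k S (\<lambda>x. f' x v)"
    "\<forall>x\<in>S. (g has_derivative g' x) (at x within S)" "\<forall>v. Ck_on k S (\<lambda>x. g' x v)"
    using Suc.prems by auto
  have "\<forall>x\<in>S. ((\<lambda>x. f x + g x) has_derivative (\<lambda>v. f' x v + g' x v)) (at x within S)"
    using d(1,3) has_derivative_add by blast
  moreover have "\<forall>v. Ck_on k S (\<lambda>x. f' x v + g' x v)" using Suc.IH d(2,4) by simp
  ultimately show ?case unfolding Ck_on.simps by (intro exI[of _ "\<lambda>x v. f' x v + g' x v"] conjI)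
qed (simp add: continuous_on_add)

lemma Ck_on_cmult:
  "Ck_on k S f \<Longrightarrow> Ck_on k S (\<lambda>x. c * f x)"
proof (induction k arbitrary: f)
  case (Suc k)
  obtain f' where d: "\<forall>x\<in>S. (f has_derivative f' x) (at x within S)" "\<forall>v. Ck_on k S (\<lambda>x. f' x v)"
    using Suc.prems by auto
  have "\<forall>x\<in>S. ((\<lambda>x. c * f x) has_derivative (\<lambda>v. c * f' x v)) (at x within S)"
    using d(1) has_derivative_mult_right by blast
  moreover have "\<forall>v. Ck_on k S (\<lambda>x. c * f' x v)" using Suc.IH d(2) by simp
  ultimately show ?case unfolding Ck_on.simps by (intro exI[of _ "\<lambda>x v. c * f' x v"] conjI)
qed (simp add: continuous_on_mult_left)

text \<open>The partial derivatives are taken within the sections of \<open>S\<close>, so that they are one-sided at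
  boundary points of \<open>S\<close> just as the total derivative is.\<close>

lemma Ck_on_partials:
  fixes f :: "real \<Rightarrow> real \<Rightarrow> real"
  assumes "Ck_on (Suc k) S (\<lambda>(x, t). f x t)"
  shows "\<exists>fx ft. Ck_on k S (\<lambda>(x, t). fx x t) \<and> Ck_on k S (\<lambda>(x, t). ft x t) \<and>
    (\<forall>x t. (x, t) \<in> S \<longrightarrow> ((\<lambda>z. f z t) has_real_derivative fx x t) (at x within {z. (z, t) \<in> S})) \<and>
    (\<forall>x t. (x, t) \<in> S \<longrightarrow> ((\<lambda>s. f x s) has_real_derivative ft x t) (at t within {s. (x, s) \<in> S}))"
proof -
  obtain D where D: "\<And>p. p \<in> S \<Longrightarrow> ((\<lambda>(x, t). f x t) has_derivative D p) (at p within S)"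
    and DC: "\<And>v. Ck_on k S (\<lambda>p. D p v)"
    using assms by auto
  have lin: "D p (h * a, h * b) = D p (a, b) * h" if "p \<in> S" for p h a b
    using linear_scale[OF has_derivative_linear[OF D[OF that]], of h "(a, b)"] by simp
  have "((\<lambda>z. f z t) has_real_derivative D (x, t) (1, 0)) (at x within {z. (z, t) \<in> S})" if p: "(x, t) \<in> S" for x t
  proof -
    have "((\<lambda>z. (z, t)) has_derivative (\<lambda>h. (h, 0))) (at x within {z. (z, t) \<in> S})"
      by (auto intro!: derivative_eq_intros)
    moreover have "((\<lambda>(x, t). f x t) has_derivative D (x, t)) (at (x, t) within (\<lambda>z. (z, t)) ` {z. (z, t) \<in> S})"
      by (rule has_derivative_subset[OF D[OF p]]) auto
    ultimately have "((\<lambda>z. case (z, t) of (x, t) \<Rightarrow> f x t) has_derivative (\<lambda>h. D (x, t) (h, 0))) (at x within {z. (z, t) \<in> S})"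
      by (rule has_derivative_in_compose)
    moreover have "(\<lambda>h. D (x, t) (h, 0)) = (*) (D (x, t) (1, 0))"
    proof
      fix h show "D (x, t) (h, 0) = D (x, t) (1, 0) * h"
        using lin[OF p, of h 1 0] by (simp only: mult_1_right mult_zero_right)
    qed
    ultimately show ?thesis by (simp add: has_field_derivative_def)
  qed
  moreover have "((\<lambda>s. f x s) has_real_derivative D (x, t) (0, 1)) (at t within {s. (x, s) \<in> S})" if p: "(x, t) \<in> S" for x t
  proof -
    have "((\<lambda>s. (x, s)) has_derivative (\<lambda>h. (0, h))) (at t within {s. (x, s) \<in> S})"
      by (auto intro!: derivative_eq_intros)
    moreover have "((\<lambda>(x, t). f x t) has_derivative D (x, t)) (at (x, t) within (\<lambda>s. (x, s)) ` {s. (x, s) \<in> S})"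
      by (rule has_derivative_subset[OF D[OF p]]) auto
    ultimately have "((\<lambda>s. case (x, s) of (x, t) \<Rightarrow> f x t) has_derivative (\<lambda>h. D (x, t) (0, h))) (at t within {s. (x, s) \<in> S})"
      by (rule has_derivative_in_compose)
    moreover have "(\<lambda>h. D (x, t) (0, h)) = (*) (D (x, t) (0, 1))"
    proof
      fix h show "D (x, t) (0, h) = D (x, t) (0, 1) * h"
        using lin[OF p, of h 0 1] by (simp only: mult_1_right mult_zero_right)
    qed
    ultimately show ?thesis by (simp add: has_field_derivative_def)
  qed
  ultimately show ?thesis
    using DC
    by (intro exI[of _ "\<lambda>x t. D (x, t) (1, 0)"] exI[of _ "\<lambda>x t. D (x, t) (0, 1)"])
      (simp add: case_prod_unfold)
qed

section \<open>Totality of smooth controls vanishing near zero\<close>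

text \<open>For \<open>s > 0\<close> this is \<open>s\<^sup>m\<^sup>-\<^sup>n e\<^sup>-\<^sup>1\<^sup>/\<^sup>s\<close>. The family is closed under differentiation up to linear
  combinations; keeping positive and negative powers apart lets both exponents be natural numbers.\<close>

definition flat :: "nat \<Rightarrow> nat \<Rightarrow> real \<Rightarrow> real" where
  "flat m n s = (if s > 0 then s ^ m * inverse s ^ n * exp (- inverse s) else 0)"

lemma flat_tendsto_0: "(flat m n \<longlongrightarrow> 0) (at 0)"
proof -
  have "((\<lambda>s. inverse s ^ n / exp (inverse s)) \<longlongrightarrow> 0) (at_right (0::real))"
    using filterlim_compose[OF tendsto_power_div_exp_0 filterlim_inverse_at_top_right] .
  then have "((\<lambda>s. s ^ m * (inverse s ^ n / exp (inverse s))) \<longlongrightarrow> 0 ^ m * 0) (at_right (0::real))"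
    by (intro tendsto_intros)
  then have "((\<lambda>s. s ^ m * (inverse s ^ n / exp (inverse s))) \<longlongrightarrow> 0) (at_right (0::real))" by simp
  moreover have "\<forall>\<^sub>F s in at_right 0. s ^ m * (inverse s ^ n / exp (inverse s)) = flat m n s"
    by (auto simp: eventually_at_filter flat_def exp_minus divide_inverse)
  ultimately have r: "(flat m n \<longlongrightarrow> 0) (at_right 0)" by (rule Lim_transform_eventually)
  have l: "(flat m n \<longlongrightarrow> 0) (at_left 0)"
    by (rule tendsto_eventually) (auto simp: eventually_at_filter flat_def)
  show ?thesis using l r by (simp add: filterlim_split_at)
qed

lemma flat_has_derivative:
  "(flat m n has_real_derivative
     real m * flat (m - 1) n s - real n * flat m (n + 1) s + flat m (n + 2) s) (at s)"
proof -
  consider "s > 0" | "s < 0" | "s = 0" by linarith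
  then show ?thesis
  proof cases
    case 1
    have d: "((\<lambda>s. s ^ m * inverse s ^ n * exp (- inverse s)) has_real_derivative
       real m * flat (m - 1) n s - real n * flat m (n + 1) s + flat m (n + 2) s) (at s)"
      using 1
      apply (auto intro!: derivative_eq_intros simp: flat_def)
      apply (cases n; simp add: field_simps power2_eq_square)
      done
    show ?thesis
      by (rule has_field_derivative_transform_within_open[OF d, of "{0<..}"]) (use 1 in \<open>auto simp: flat_def\<close>)
  next
    case 2
    have d: "((\<lambda>s. 0) has_real_derivative
       real m * flat (m - 1) n s - real n * flat m (n + 1) s + flat m (n + 2) s) (at s)"
      using 2 by (auto simp: flat_def)
    show ?thesis
      by (rule has_field_derivative_transform_within_open[OF d, of "{..<0}"]) (use 2 in \<open>auto simp: flat_def\<close>)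
  next
    case 3
    have "((\<lambda>h. (flat m n h - flat m n 0) / (h - 0)) \<longlongrightarrow> 0) (at 0)"
      by (rule Lim_transform_eventually[OF flat_tendsto_0[of m "Suc n"]])
        (auto simp: eventually_at_filter flat_def field_simps)
    then show ?thesis using 3 by (simp add: has_field_derivative_iff flat_def)
  qed
qed

lemma Ck_on_flat: "Ck_on k S (\<lambda>t. flat m n (t - a))"
proof (induction k arbitrary: m n)
  case 0
  have "isCont (flat m n) s" for s using flat_has_derivative by (rule DERIV_isCont)
  then have "continuous_on UNIV (flat m n)" by (simp add: continuous_at_imp_continuous_on)
  then have "continuous_on S (\<lambda>t. flat m n (t - a))"
    by (rule continuous_on_compose2) (auto intro!: continuous_intros)
  then show ?case by simp
next
  case (Suc k)
  let ?d = "\<lambda>t. real m * flat (m - 1) n (t - a) + (- real n) * flat m (n + 1) (t - a) + flat m (n + 2) (t - a)"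
  have "((\<lambda>t. flat m n (t - a)) has_real_derivative ?d t) (at t within S)" for t
  proof -
    have "((\<lambda>t. t - a) has_real_derivative 1) (at t)" by (auto intro!: derivative_eq_intros)
    from DERIV_chain2[OF flat_has_derivative this, of m n]
    have "((\<lambda>t. flat m n (t - a)) has_real_derivative ?d t) (at t)" by simp
    then show ?thesis by (rule has_field_derivative_at_within)
  qed
  then have "\<forall>t\<in>S. ((\<lambda>t. flat m n (t - a)) has_derivative (\<lambda>v. ?d t * v)) (at t within S)"
    by (simp add: has_field_derivative_def)
  moreover have "Ck_on k S (\<lambda>t. ?d t * v)" for v
  proof -
    have "Ck_on k S (\<lambda>t. v * ?d t)" by (intro Ck_on_add Ck_on_cmult Suc.IH)
    then show ?thesis by (simp add: mult.commute)
  qed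
  ultimately show ?case unfolding Ck_on.simps by (intro exI[of _ "\<lambda>t v. ?d t * v"] conjI allI)
qed

lemma smooth_on_flat: "smooth_on S (\<lambda>t. flat m n (t - a))"
  by (simp add: smooth_on_def Ck_on_flat)

lemma continuous_flat: "continuous_on S (\<lambda>t. flat m n (t - a))"
  using Ck_on_flat[of 0 S m n a] by simp

text \<open>By Weierstrass' theorem \<open>H\<close> is orthogonal to all continuous functions. Continuous approximations
  of the indicator function of \<open>(0, t)\<close> then show that the integral of \<open>H\<close> over \<open>(0, t)\<close> vanishes
  for every \<open>t\<close>.\<close>

lemma zero_moments_imp_zero_AE:
  assumes H: "integrable (F_meas T) H" and moments: "\<And>m. (\<integral>t. H t * (t - a) ^ m \<partial>F_meas T) = 0"
  shows "AE t in F_meas T. H t = 0"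
proof -
  have Hm [measurable]: "H \<in> borel_measurable (F_meas T)" by (rule borel_measurable_integrable[OF H])
  have bounded_int: "integrable (F_meas T) (\<lambda>t. H t * \<phi> t)"
    if \<phi>c: "continuous_on {0..T} \<phi>" for \<phi> :: "real \<Rightarrow> real"
  proof -
    obtain B where B: "\<forall>t\<in>{0..T}. \<bar>\<phi> t\<bar> \<le> B"
      using continuous_on_interval_bounded[OF \<phi>c] by blast
    have \<phi>m: "\<phi> \<in> borel_measurable (F_meas T)"
      by (rule measurable_F_continuous, rule continuous_on_subset[OF \<phi>c]) auto
    show ?thesis
    proof (rule Bochner_Integration.integrable_bound)
      show "integrable (F_meas T) (\<lambda>t. B * H t)" using H by simp
      show "AE t in F_meas T. norm (H t * \<phi> t) \<le> norm (B * H t)"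
        unfolding AE_F
      proof (rule AE_I2, rule impI)
        fix t assume "t \<in> {0<..<T}"
        then have "t \<in> {0..T}" by simp
        then have "\<bar>\<phi> t\<bar> \<le> \<bar>B\<bar>" using B abs_ge_self[of B] order_trans by blast
        then have "\<bar>H t\<bar> * \<bar>\<phi> t\<bar> \<le> \<bar>H t\<bar> * \<bar>B\<bar>" by (rule mult_left_mono) simp
        then show "norm (H t * \<phi> t) \<le> norm (B * H t)"
          by (simp only: real_norm_def abs_mult mult.commute[of B])
      qed
    qed (intro borel_measurable_times Hm \<phi>m)
  qed
  have poly: "(\<integral>t. H t * (\<Sum>i\<le>n. c i * (t - a) ^ i) \<partial>F_meas T) = 0" for c and n :: nat
  proof -
    have "(\<integral>t. H t * (\<Sum>i\<le>n. c i * (t - a) ^ i) \<partial>F_meas T) = (\<integral>t. (\<Sum>i\<le>n. c i * (H t * (t - a) ^ i)) \<partial>F_meas T)"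
      by (simp add: sum_distrib_left algebra_simps)
    also have "\<dots> = (\<Sum>i\<le>n. c i * (\<integral>t. H t * (t - a) ^ i \<partial>F_meas T))"
      by (subst Bochner_Integration.integral_sum) (auto intro!: bounded_int continuous_intros integrable_mult_right)
    also have "\<dots> = 0" using moments by simp
    finally show ?thesis .
  qed
  have cont: "(\<integral>t. H t * \<phi> t \<partial>F_meas T) = 0"
    if \<phi>: "continuous_on UNIV \<phi>" for \<phi> :: "real \<Rightarrow> real"
  proof -
    let ?L = "\<integral>t. \<bar>H t\<bar> \<partial>F_meas T"
    have L: "?L \<ge> 0" by simp
    have "\<bar>\<integral>t. H t * \<phi> t \<partial>F_meas T\<bar> \<le> 0 + e" if e: "e > 0" for e
    proof -
      define \<delta> where "\<delta> = e / (1 + ?L)"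
      have \<delta>: "\<delta> > 0" "\<delta> * ?L \<le> e"
        using e L by (auto simp: \<delta>_def field_simps add_pos_nonneg)
      have "continuous_on {-a..T-a} (\<lambda>s. \<phi> (s + a))"
        by (rule continuous_on_compose2[OF \<phi>]) (auto intro!: continuous_intros)
      then obtain g where g: "real_polynomial_function g" "\<And>s. s \<in> {-a..T-a} \<Longrightarrow> \<bar>\<phi> (s + a) - g s\<bar> < \<delta>"
        using Stone_Weierstrass_real_polynomial_function[OF compact_Icc _ \<delta>(1)] by blast
      then obtain c n where gc: "g = (\<lambda>x. \<Sum>i\<le>n. c i * x ^ i)" unfolding real_polynomial_function_iff_sum by blast
      have i1: "integrable (F_meas T) (\<lambda>t. H t * \<phi> t)"
        by (rule bounded_int, rule continuous_on_subset[OF \<phi>]) auto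
      have i2: "integrable (F_meas T) (\<lambda>t. H t * g (t - a))"
        unfolding gc by (intro bounded_int continuous_intros)
      have gpoly: "(\<integral>t. H t * g (t - a) \<partial>F_meas T) = 0" unfolding gc by (rule poly)
      have "(\<integral>t. H t * \<phi> t \<partial>F_meas T) = (\<integral>t. H t * \<phi> t - H t * g (t - a) \<partial>F_meas T)"
        using gpoly i1 i2 by simp
      also have "\<bar>\<dots>\<bar> \<le> (\<integral>t. \<delta> * \<bar>H t\<bar> \<partial>F_meas T)"
      proof (rule integral_abs_bound_integral)
        show "integrable (F_meas T) (\<lambda>t. H t * \<phi> t - H t * g (t - a))" using i1 i2 by simp
        show "integrable (F_meas T) (\<lambda>t. \<delta> * \<bar>H t\<bar>)" using H by simp
        fix t assume "t \<in> space (F_meas T)"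
        then have "\<bar>\<phi> t - g (t - a)\<bar> \<le> \<delta>" using g(2)[of "t - a"] by simp
        then have "\<bar>H t\<bar> * \<bar>\<phi> t - g (t - a)\<bar> \<le> \<bar>H t\<bar> * \<delta>" by (intro mult_left_mono) auto
        then show "\<bar>H t * \<phi> t - H t * g (t - a)\<bar> \<le> \<delta> * \<bar>H t\<bar>"
          by (simp add: abs_mult[symmetric] right_diff_distrib mult.commute)
      qed
      also have "\<dots> = \<delta> * ?L" by simp
      finally show ?thesis using \<delta>(2) by linarith
    qed
    then have "\<bar>\<integral>t. H t * \<phi> t \<partial>F_meas T\<bar> \<le> 0" by (rule field_le_epsilon)
    then show ?thesis by simp
  qed
  show ?thesis
  proof (rule integrable_F_zero[OF H])
    fix t assume t: "t \<in> {0<..<T}"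
    \<comment> \<open>Equal to \<open>1\<close> up to \<open>t - 1/n\<close>, to \<open>0\<close> from \<open>t\<close> on, and linear in between.\<close>
    define \<phi> where "\<phi> n s = max 0 (min 1 (real n * (t - s)))" for n :: nat and s :: real
    have c: "continuous_on S (\<phi> n)" for n S unfolding \<phi>_def by (intro continuous_intros)
    have "(\<lambda>n. \<integral>s. H s * \<phi> n s \<partial>F_meas T) \<longlonglongrightarrow> (\<integral>s. indicator {0<..<t} s * H s \<partial>F_meas T)"
    proof (rule integral_dominated_convergence[where w = "\<lambda>s. \<bar>H s\<bar>"])
      show "integrable (F_meas T) (\<lambda>s. \<bar>H s\<bar>)" using H by simp
      show "(\<lambda>s. indicator {0<..<t} s * H s) \<in> borel_measurable (F_meas T)"
        by (intro borel_measurable_times Hm measurable_F_borel) simp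
      show "(\<lambda>s. H s * \<phi> n s) \<in> borel_measurable (F_meas T)" for n
        using bounded_int[OF c] by (rule borel_measurable_integrable)
      show "AE s in F_meas T. norm (H s * \<phi> n s) \<le> \<bar>H s\<bar>" for n
        by (rule AE_I2) (simp add: abs_mult mult_left_le \<phi>_def)
      show "AE s in F_meas T. (\<lambda>n. H s * \<phi> n s) \<longlonglongrightarrow> indicator {0<..<t} s * H s"
        unfolding AE_F
      proof (rule AE_I2, rule impI)
        fix s assume s: "s \<in> {0<..<T}"
        have "(\<lambda>n. \<phi> n s) \<longlonglongrightarrow> indicator {0<..<t} s"
        proof (cases "s < t")
          case True
          obtain N :: nat where N: "1 / (t - s) < real N" using reals_Archimedean2 by blast
          have "\<phi> n s = 1" if "n \<ge> N" for n
          proof -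
            have "1 / (t - s) \<le> real n" using N that by linarith
            then have "1 \<le> real n * (t - s)" using True by (simp add: field_simps)
            then show ?thesis by (simp add: \<phi>_def)
          qed
          then have "\<forall>\<^sub>F n in sequentially. \<phi> n s = indicator {0<..<t} s"
            using True s by (auto simp: eventually_sequentially)
          then show ?thesis by (rule tendsto_eventually)
        next
          case False
          then have "real n * (t - s) \<le> 0" for n by (intro mult_nonneg_nonpos) auto
          then have "\<phi> n s = 0" for n unfolding \<phi>_def by (intro max_absorb1) (auto intro: min.coboundedI2)
          then show ?thesis using False by simp
        qed
        from tendsto_mult[OF tendsto_const this, of "H s"]
        show "(\<lambda>n. H s * \<phi> n s) \<longlonglongrightarrow> indicator {0<..<t} s * H s" by (simp add: mult.commute)
      qed
    qed
    moreover have "(\<integral>s. H s * \<phi> n s \<partial>F_meas T) = 0" for n by (rule cont[OF c])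
    ultimately have "(\<integral>s. indicator {0<..<t} s * H s \<partial>F_meas T) = 0"
      by (simp add: LIMSEQ_const_iff)
    then show "(LBINT s:{0<..<t}. H s) = 0"
      unfolding integral_F set_lebesgue_integral_def
      by (elim trans[rotated], intro Bochner_Integration.integral_cong) (use t in \<open>auto simp: indicator_def\<close>)
  qed
qed

text \<open>The product of a monomial in \<open>t - \<epsilon>\<close> with the flat function \<open>e\<^sup>-\<^sup>1\<^sup>/\<^sup>(\<^sup>t\<^sup>-\<^sup>\<epsilon>\<^sup>)\<close> is a smooth control that
  vanishes up to time \<open>\<epsilon>\<close>. So the function \<open>h(t) e\<^sup>-\<^sup>1\<^sup>/\<^sup>(\<^sup>t\<^sup>-\<^sup>\<epsilon>\<^sup>)\<close> has vanishing moments, and \<open>h = 0\<close> almost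
  everywhere on \<open>(\<epsilon>, T)\<close>.\<close>

theorem smooth_controls_total:
  assumes h: "h \<in> L2 (F_meas T)"
    and orth: "\<And>f. smooth_on {0..} f \<Longrightarrow> (\<exists>\<epsilon>>0. \<forall>t\<in>{0..<\<epsilon>}. f t = 0) \<Longrightarrow> L2_inner (F_meas T) f h = 0"
  shows "AE t in F_meas T. h t = 0"
proof -
  have *: "AE t in F_meas T. t > \<epsilon> \<longrightarrow> h t = 0" if \<epsilon>: "\<epsilon> > 0" for \<epsilon>
  proof -
    have c: "continuous_on {0..T} (\<lambda>t. flat 0 0 (t - \<epsilon>))" by (rule continuous_flat)
    have "AE t in F_meas T. h t * flat 0 0 (t - \<epsilon>) = 0"
    proof (rule zero_moments_imp_zero_AE)
      show "integrable (F_meas T) (\<lambda>t. h t * flat 0 0 (t - \<epsilon>))"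
        by (rule L2_mult_integrable[OF h continuous_L2_F[OF c]])
      fix m
      have "(\<lambda>t. h t * flat 0 0 (t - \<epsilon>) * (t - \<epsilon>) ^ m) = (\<lambda>t. flat m 0 (t - \<epsilon>) * h t)"
        by (auto simp: flat_def)
      moreover have "L2_inner (F_meas T) (\<lambda>t. flat m 0 (t - \<epsilon>)) h = 0"
        by (rule orth[OF smooth_on_flat]) (use \<epsilon> in \<open>auto intro!: exI[of _ \<epsilon>] simp: flat_def\<close>)
      ultimately show "(\<integral>t. h t * flat 0 0 (t - \<epsilon>) * (t - \<epsilon>) ^ m \<partial>F_meas T) = 0"
        by (simp add: L2_inner_def)
    qed
    then show ?thesis by eventually_elim (auto simp: flat_def)
  qed
  have "AE t in F_meas T. \<forall>n. t > inverse (real (Suc n)) \<longrightarrow> h t = 0"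
    unfolding AE_all_countable by (intro allI *) simp
  then show ?thesis
    unfolding AE_F
  proof (rule AE_mp, intro AE_I2 impI)
    fix t assume t: "t \<in> {0<..<T} \<longrightarrow> (\<forall>n. t > inverse (real (Suc n)) \<longrightarrow> h t = 0)" "t \<in> {0<..<T}"
    then show "h t = 0" using reals_Archimedean[of t] by auto
  qed
qed

section \<open>Volterra operators of the second kind\<close>

text \<open>Continuity and a bound are required on the whole plane, which avoids side conditions; a kernel
  given on \<open>0 \<le> s \<le> r \<le> T\<close> can be extended by clamping the arguments.\<close>

locale volterra =
  fixes T a :: real and K :: "real \<Rightarrow> real \<Rightarrow> real" and M :: real
  assumes T: "T > 0" and a: "a > 0"
    and K_cont: "continuous_on UNIV (\<lambda>(r, s). K r s)" and K_le: "\<And>r s. \<bar>K r s\<bar> \<le> M"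
begin

definition V :: "(real \<Rightarrow> real) \<Rightarrow> real \<Rightarrow> real" where
  "V f r = a * f r + (LBINT s:{0<..<r}. K r s * f s)"

definition V_adj :: "(real \<Rightarrow> real) \<Rightarrow> real \<Rightarrow> real" where
  "V_adj g s = a * g s + (LBINT r:{s<..<T}. K r s * g r)"

lemma M_nonneg: "0 \<le> M"
  using K_le[of 0 0] by linarith

text \<open>Cutting off the kernel above the diagonal and extending functions by zero turns the integrals over
  \<open>(0, r)\<close> and \<open>(s, T)\<close> into integrals over the whole line, to which Fubini's theorem applies.\<close>

definition k where "k r s = (if s < r then K r s else 0)"

definition zext :: "(real \<Rightarrow> real) \<Rightarrow> real \<Rightarrow> real" where "zext f s = indicator {0<..<T} s * f s"

lemma k_le: "\<bar>k r s\<bar> \<le> M"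
  using K_le M_nonneg by (simp add: k_def)

lemma K_measurable [measurable]: "(\<lambda>p. K (fst p) (snd p)) \<in> borel_measurable (borel \<Otimes>\<^sub>M borel)"
  using K_cont by (simp add: borel_prod case_prod_unfold borel_measurable_continuous_onI)

lemma k_measurable [measurable]: "(\<lambda>p. k (fst p) (snd p)) \<in> borel_measurable (borel \<Otimes>\<^sub>M borel)"
  unfolding k_def by measurable

lemma ext_integrable: "f \<in> L2 (F_meas T) \<Longrightarrow> integrable lborel (zext f)"
  using L2_F_integrable[of f T] by (simp add: integrable_F set_integrable_def zext_def[abs_def])

lemma k_integrable:
  assumes "integrable lborel h"
  shows "integrable lborel (\<lambda>s. k r s * h s)" "integrable lborel (\<lambda>r. k r s * h r)"
    "\<bar>\<integral>s. k r s * h s \<partial>lborel\<bar> \<le> M * (\<integral>s. \<bar>h s\<bar> \<partial>lborel)"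
    "\<bar>\<integral>r. k r s * h r \<partial>lborel\<bar> \<le> M * (\<integral>s. \<bar>h s\<bar> \<partial>lborel)"
proof -
  have [measurable]: "h \<in> borel_measurable borel" using borel_measurable_integrable[OF assms] by simp
  have [measurable]: "(\<lambda>s. k r s) \<in> borel_measurable borel" "(\<lambda>r. k r s) \<in> borel_measurable borel" for r s
    using measurable_compose[OF _ k_measurable, of "\<lambda>s. (r, s)" borel]
      measurable_compose[OF _ k_measurable, of "\<lambda>r. (r, s)" borel] by simp_all
  have le: "norm (c * h s) \<le> norm (M * h s)" if "\<bar>c\<bar> \<le> M" for c s
    using mult_right_mono[OF that, of "\<bar>h s\<bar>"] M_nonneg by (simp add: abs_mult)
  have Mh: "integrable lborel (\<lambda>s. M * h s)" using assms by simp
  show 1: "integrable lborel (\<lambda>s. k r s * h s)"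
    by (rule Bochner_Integration.integrable_bound[OF Mh]) (auto intro!: AE_I2 le k_le simp del: real_norm_def)
  show 2: "integrable lborel (\<lambda>r. k r s * h r)"
    by (rule Bochner_Integration.integrable_bound[OF Mh]) (auto intro!: AE_I2 le k_le simp del: real_norm_def)
  have le': "\<bar>c * h s\<bar> \<le> M * \<bar>h s\<bar>" if "\<bar>c\<bar> \<le> M" for c s
    using mult_right_mono[OF that, of "\<bar>h s\<bar>"] by (simp add: abs_mult)
  have "\<bar>\<integral>s. k r s * h s \<partial>lborel\<bar> \<le> (\<integral>s. M * \<bar>h s\<bar> \<partial>lborel)"
    by (rule integral_abs_bound_integral[OF 1]) (use assms le' k_le in auto)
  then show "\<bar>\<integral>s. k r s * h s \<partial>lborel\<bar> \<le> M * (\<integral>s. \<bar>h s\<bar> \<partial>lborel)" by simp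
  have "\<bar>\<integral>r. k r s * h r \<partial>lborel\<bar> \<le> (\<integral>s. M * \<bar>h s\<bar> \<partial>lborel)"
    by (rule integral_abs_bound_integral[OF 2]) (use assms le' k_le in auto)
  then show "\<bar>\<integral>r. k r s * h r \<partial>lborel\<bar> \<le> M * (\<integral>s. \<bar>h s\<bar> \<partial>lborel)" by simp
qed

lemma V_ext: "r \<in> {0<..<T} \<Longrightarrow> V f r = a * f r + (\<integral>s. k r s * zext f s \<partial>lborel)"
  unfolding V_def set_lebesgue_integral_def
  by (auto intro!: Bochner_Integration.integral_cong simp: k_def zext_def indicator_def)

lemma V_adj_ext: "s \<in> {0<..<T} \<Longrightarrow> V_adj g s = a * g s + (\<integral>r. k r s * zext g r \<partial>lborel)"
  unfolding V_adj_def set_lebesgue_integral_def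
  by (auto intro!: Bochner_Integration.integral_cong simp: k_def zext_def indicator_def)

lemma V_L2: assumes f: "f \<in> L2 (F_meas T)" shows "V f \<in> L2 (F_meas T)"
proof -
  note e = ext_integrable[OF f]
  have [measurable]: "zext f \<in> borel_measurable borel" using borel_measurable_integrable[OF e] by simp
  have "(\<lambda>r. \<integral>s. k r s * zext f s \<partial>lborel) \<in> borel_measurable borel"
    using lborel.borel_measurable_lebesgue_integral[of "\<lambda>r s. k r s * zext f s" borel]
    by (simp add: case_prod_unfold)
  then have "(\<lambda>r. \<integral>s. k r s * zext f s \<partial>lborel) \<in> L2 (F_meas T)"
    using k_integrable(3)[OF e] by (intro bounded_L2_F measurable_F_borel)
  from L2_add[OF L2_cmult[OF f] this]
  have *: "(\<lambda>r. a * f r + (\<integral>s. k r s * zext f s \<partial>lborel)) \<in> L2 (F_meas T)" .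
  have "V f \<in> borel_measurable (F_meas T)"
    using * by (subst measurable_cong[where g = "\<lambda>r. a * f r + (\<integral>s. k r s * zext f s \<partial>lborel)"])
      (auto simp: V_ext L2_def)
  then show ?thesis by (rule L2_cong_AE[OF *]) (auto simp: AE_F V_ext)
qed

lemma V_adj_L2: assumes g: "g \<in> L2 (F_meas T)" shows "V_adj g \<in> L2 (F_meas T)"
proof -
  note e = ext_integrable[OF g]
  have [measurable]: "zext g \<in> borel_measurable borel" using borel_measurable_integrable[OF e] by simp
  have "(\<lambda>s. \<integral>r. k r s * zext g r \<partial>lborel) \<in> borel_measurable borel"
    using lborel.borel_measurable_lebesgue_integral[of "\<lambda>s r. k r s * zext g r" borel]
      measurable_compose[OF _ k_measurable, of "\<lambda>p. (snd p, fst p)" "borel \<Otimes>\<^sub>M borel"]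
    by (simp add: case_prod_unfold)
  then have "(\<lambda>s. \<integral>r. k r s * zext g r \<partial>lborel) \<in> L2 (F_meas T)"
    using k_integrable(4)[OF e] by (intro bounded_L2_F measurable_F_borel)
  from L2_add[OF L2_cmult[OF g] this]
  have *: "(\<lambda>s. a * g s + (\<integral>r. k r s * zext g r \<partial>lborel)) \<in> L2 (F_meas T)" .
  have "V_adj g \<in> borel_measurable (F_meas T)"
    using * by (subst measurable_cong[where g = "\<lambda>s. a * g s + (\<integral>r. k r s * zext g r \<partial>lborel)"])
      (auto simp: V_adj_ext L2_def)
  then show ?thesis by (rule L2_cong_AE[OF *]) (auto simp: AE_F V_adj_ext)
qed

lemma V_adjoint:
  assumes f: "f \<in> L2 (F_meas T)" and g: "g \<in> L2 (F_meas T)"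
  shows "L2_inner (F_meas T) (V f) g = L2_inner (F_meas T) f (V_adj g)"
proof -
  note ef = ext_integrable[OF f] and eg = ext_integrable[OF g]
  have [measurable]: "zext f \<in> borel_measurable borel" "zext g \<in> borel_measurable borel"
    using borel_measurable_integrable[OF ef] borel_measurable_integrable[OF eg] by simp_all
  let ?\<phi> = "\<lambda>r s. k r s * zext f s * zext g r"
  have I: "integrable (lborel \<Otimes>\<^sub>M lborel) (case_prod ?\<phi>)"
  proof (rule lborel_pair.Fubini_integrable)
    show m: "case_prod ?\<phi> \<in> borel_measurable (lborel \<Otimes>\<^sub>M lborel)"
      by (simp add: case_prod_unfold)
    have i: "integrable lborel (\<lambda>s. ?\<phi> r s)" for r
      using integrable_mult_left[OF k_integrable(1)[OF ef]] by blast
    show "AE r in lborel. integrable lborel (\<lambda>s. case_prod ?\<phi> (r, s))"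
      using i by simp
    have gL: "integrable lborel (\<lambda>r. M * (\<integral>s. \<bar>zext f s\<bar> \<partial>lborel) * zext g r)" using eg by simp
    have 1: "(\<integral>s. norm (case_prod ?\<phi> (r, s)) \<partial>lborel) \<le> M * (\<integral>s. \<bar>zext f s\<bar> \<partial>lborel) * \<bar>zext g r\<bar>" for r
    proof -
      have "(\<integral>s. norm (case_prod ?\<phi> (r, s)) \<partial>lborel) \<le> (\<integral>s. M * \<bar>zext f s\<bar> * \<bar>zext g r\<bar> \<partial>lborel)"
      proof (rule integral_mono)
        show "integrable lborel (\<lambda>s. norm (case_prod ?\<phi> (r, s)))" using i[of r] by simp
        show "integrable lborel (\<lambda>s. M * \<bar>zext f s\<bar> * \<bar>zext g r\<bar>)" using ef by simp
        show "norm (case_prod ?\<phi> (r, s)) \<le> M * \<bar>zext f s\<bar> * \<bar>zext g r\<bar>" for s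
          unfolding prod.case real_norm_def abs_mult by (intro mult_right_mono k_le abs_ge_zero)
      qed
      also have "\<dots> = M * (\<integral>s. \<bar>zext f s\<bar> \<partial>lborel) * \<bar>zext g r\<bar>" by simp
      finally show ?thesis .
    qed
    have m': "(\<lambda>r. \<integral>s. norm (case_prod ?\<phi> (r, s)) \<partial>lborel) \<in> borel_measurable lborel"
      using lborel.borel_measurable_lebesgue_integral[of "\<lambda>r s. norm (case_prod ?\<phi> (r, s))" lborel] m
      by (simp add: case_prod_unfold)
    show "integrable lborel (\<lambda>r. \<integral>s. norm (case_prod ?\<phi> (r, s)) \<partial>lborel)"
    proof (rule Bochner_Integration.integrable_bound[OF gL m'], rule AE_I2)
      fix r
      have "0 \<le> M * (\<integral>s. \<bar>zext f s\<bar> \<partial>lborel)" using M_nonneg by simp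
      then show "norm (\<integral>s. norm (case_prod ?\<phi> (r, s)) \<partial>lborel) \<le> norm (M * (\<integral>s. \<bar>zext f s\<bar> \<partial>lborel) * zext g r)"
        using 1[of r] by (simp only: real_norm_def abs_mult[of "M * _"] abs_of_nonneg)
          (simp add: abs_mult)
    qed
  qed
  have swap: "(\<integral>r. (\<integral>s. k r s * zext f s \<partial>lborel) * zext g r \<partial>lborel)
      = (\<integral>s. zext f s * (\<integral>r. k r s * zext g r \<partial>lborel) \<partial>lborel)"
  proof -
    have "(\<integral>r. (\<integral>s. k r s * zext f s \<partial>lborel) * zext g r \<partial>lborel) = (\<integral>r. (\<integral>s. ?\<phi> r s \<partial>lborel) \<partial>lborel)"
      by simp
    also have "\<dots> = (\<integral>s. (\<integral>r. ?\<phi> r s \<partial>lborel) \<partial>lborel)"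
      using lborel_pair.Fubini_integral[OF I] by simp
    also have "\<dots> = (\<integral>s. (\<integral>r. zext f s * (k r s * zext g r) \<partial>lborel) \<partial>lborel)"
      by (simp add: mult.commute mult.left_commute)
    finally show ?thesis by simp
  qed
  note [simp] = integral_F set_lebesgue_integral_def
  have Af: "integrable lborel (\<lambda>r. a * zext f r * zext g r)"
  proof -
    have "zext f r * zext g r = indicator {0<..<T} r * (f r * g r)" for r
      by (auto simp: zext_def indicator_def)
    then show ?thesis
      using L2_mult_integrable[OF f g] by (simp add: integrable_F set_integrable_def mult.assoc)
  qed
  have kf: "integrable lborel (\<lambda>r. (\<integral>s. k r s * zext f s \<partial>lborel) * zext g r)"
    using lborel_pair.integrable_fst'[OF I] by simp
  have kg: "integrable lborel (\<lambda>s. zext f s * (\<integral>r. k r s * zext g r \<partial>lborel))"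
  proof -
    have "?\<phi> r s = zext f s * (k r s * zext g r)" for r s by (simp add: ac_simps)
    then have "(\<integral>r. ?\<phi> r s \<partial>lborel) = zext f s * (\<integral>r. k r s * zext g r \<partial>lborel)" for s
      by (simp only: integral_mult_right_zero)
    then show ?thesis using lborel_pair.integrable_snd[OF I] by (simp only: prod.case)
  qed
  have "L2_inner (F_meas T) (V f) g = (\<integral>r. a * zext f r * zext g r + (\<integral>s. k r s * zext f s \<partial>lborel) * zext g r \<partial>lborel)"
    unfolding L2_inner_def integral_F set_lebesgue_integral_def
    by (intro Bochner_Integration.integral_cong) (auto simp: zext_def V_ext indicator_def algebra_simps)
  also have "\<dots> = (\<integral>r. a * zext f r * zext g r \<partial>lborel) + (\<integral>s. zext f s * (\<integral>r. k r s * zext g r \<partial>lborel) \<partial>lborel)"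
    using Af kf swap by (subst Bochner_Integration.integral_add) auto
  also have "\<dots> = (\<integral>s. a * zext f s * zext g s + zext f s * (\<integral>r. k r s * zext g r \<partial>lborel) \<partial>lborel)"
    using Af kg by (subst Bochner_Integration.integral_add) auto
  also have "\<dots> = L2_inner (F_meas T) f (V_adj g)"
    unfolding L2_inner_def integral_F set_lebesgue_integral_def
    by (intro Bochner_Integration.integral_cong) (auto simp: zext_def V_adj_ext indicator_def algebra_simps)
  finally show ?thesis .
qed

lemma V_diff:
  assumes f: "f \<in> L2 (F_meas T)" and g: "g \<in> L2 (F_meas T)" and r: "r \<in> {0<..<T}"
  shows "V (\<lambda>s. f s - g s) r = V f r - V g r"
proof -
  have "zext (\<lambda>s. f s - g s) s = zext f s - zext g s" for s by (simp add: zext_def right_diff_distrib)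
  then have "(\<integral>s. k r s * zext (\<lambda>s. f s - g s) s \<partial>lborel) = (\<integral>s. k r s * zext f s - k r s * zext g s \<partial>lborel)"
    by (simp only: right_diff_distrib)
  also have "\<dots> = (\<integral>s. k r s * zext f s \<partial>lborel) - (\<integral>s. k r s * zext g s \<partial>lborel)"
    by (rule Bochner_Integration.integral_diff) (intro k_integrable(1) ext_integrable f g)+
  finally show ?thesis by (simp add: V_ext[OF r] right_diff_distrib)
qed

text \<open>A null function of \<open>V\<close> satisfies \<open>|f(r)| \<le> C \<integral>\<^sub>0\<^sup>r |f|\<close> almost everywhere. As \<open>|f|\<close> need not be
  continuous, Gronwall's argument is applied to its second primitive \<open>\<Phi>\<close>, which satisfies
  \<open>\<Phi>' \<le> C \<Phi>\<close> and \<open>\<Phi>(0) = 0\<close>.\<close>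

lemma V_injective:
  assumes f: "f \<in> L2 (F_meas T)" and V0: "AE r in F_meas T. V f r = 0"
  shows "AE r in F_meas T. f r = 0"
proof -
  define C where "C = M / a"
  have C: "C \<ge> 0" using M_nonneg a by (simp add: C_def)
  have absf: "integrable (F_meas T) (\<lambda>r. \<bar>f r\<bar>)" using L2_F_integrable[OF f] by simp
  define G where "G r = integral {0..r} (\<lambda>s. \<bar>f s\<bar>)" for r
  note int = integrable_F_indefinite[OF absf]
  have GI: "(LBINT s:{0<..<r}. \<bar>f s\<bar>) = G r" if "r \<le> T" for r
    using int(2)[OF that] by (simp add: G_def)
  have "(\<lambda>s. \<bar>f s\<bar>) integrable_on {0..T}"
    by (rule set_integral_open_eq_integral(1)[OF int(1)]) simp
  then have G_cont: "continuous_on {0..T} G"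
    unfolding G_def by (rule indefinite_integral_continuous_1)
  have ae: "AE r in F_meas T. \<bar>f r\<bar> \<le> C * G r"
    using V0 unfolding AE_F
  proof (rule AE_mp, intro AE_I2 impI)
    fix r assume r: "r \<in> {0<..<T}" and "r \<in> {0<..<T} \<longrightarrow> V f r = 0"
    then have "a * f r + (LBINT s:{0<..<r}. K r s * f s) = 0" unfolding V_def by blast
    then have "a * f r = - (LBINT s:{0<..<r}. K r s * f s)" by (simp only: add_eq_0_iff2)
    then have "a * \<bar>f r\<bar> = \<bar>LBINT s:{0<..<r}. K r s * f s\<bar>"
      using a by (metis abs_minus_cancel abs_mult abs_of_pos)
    also have "\<dots> = \<bar>\<integral>s. indicator {0<..<r} s * (K r s * f s) \<partial>lborel\<bar>"
      by (simp add: set_lebesgue_integral_def)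
    also have "\<dots> \<le> (\<integral>s. \<bar>indicator {0<..<r} s * (K r s * f s)\<bar> \<partial>lborel)" by simp
    also have "\<dots> \<le> (\<integral>s. M * (indicator {0<..<r} s * \<bar>f s\<bar>) \<partial>lborel)"
    proof (rule integral_mono')
      show "integrable lborel (\<lambda>s. M * (indicator {0<..<r} s * \<bar>f s\<bar>))"
        using int(1)[of r] r by (simp add: set_integrable_def)
      show "\<bar>indicator {0<..<r} s * (K r s * f s)\<bar> \<le> M * (indicator {0<..<r} s * \<bar>f s\<bar>)" for s
        using mult_right_mono[OF K_le, of "\<bar>f s\<bar>" r s] by (simp add: abs_mult indicator_def)
    qed (simp add: M_nonneg)
    also have "\<dots> = M * G r" using GI[of r] r by (simp add: set_lebesgue_integral_def)
    finally have "a * \<bar>f r\<bar> \<le> M * G r" .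
    then show "\<bar>f r\<bar> \<le> C * G r" using a by (simp add: C_def field_simps)
  qed
  \<comment> \<open>\<open>G\<close> is the primitive of \<open>|f|\<close> and \<open>\<Phi>\<close> the primitive of \<open>G\<close>.\<close>
  define \<Phi> where "\<Phi> r = integral {0..r} G" for r
  have G_le: "G r \<le> C * \<Phi> r" if r: "r \<in> {0..T}" for r
  proof -
    have Gi: "continuous_on {0..r} (\<lambda>s. C * G s)"
      using G_cont r by (intro continuous_intros) (auto intro: continuous_on_subset)
    have "G r = (LBINT s:{0<..<r}. \<bar>f s\<bar>)" using GI r by simp
    also have "\<dots> \<le> (LBINT s:{0<..<r}. C * G s)"
      unfolding set_lebesgue_integral_def
    proof (rule integral_mono_AE)
      show "integrable lborel (\<lambda>s. indicator {0<..<r} s *\<^sub>R \<bar>f s\<bar>)"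
        using int(1)[of r] r by (simp add: set_integrable_def)
      show "integrable lborel (\<lambda>s. indicator {0<..<r} s *\<^sub>R (C * G s))"
        using continuous_integral_F(1)[OF Gi] by (simp add: set_integrable_def)
      show "AE s in lborel. indicator {0<..<r} s *\<^sub>R \<bar>f s\<bar> \<le> indicator {0<..<r} s *\<^sub>R (C * G s)"
        by (rule AE_mp[OF ae[unfolded AE_F]], rule AE_I2) (use r in \<open>auto simp: indicator_def\<close>)
    qed
    also have "\<dots> = C * \<Phi> r" using continuous_integral_F(2)[OF Gi] by (simp add: \<Phi>_def)
    finally show ?thesis .
  qed
  have \<Phi>_der: "(\<Phi> has_real_derivative G r) (at r within {0..T})" if "r \<in> {0..T}" for r
    using integral_has_real_derivative[OF G_cont that] by (simp add: \<Phi>_def[abs_def])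
  have "exp (- C * T) * \<Phi> T \<le> exp (- C * 0) * \<Phi> 0"
  proof (rule DERIV_nonpos_imp_decreasing_open[of 0 T "\<lambda>r. exp (- C * r) * \<Phi> r"])
    show "0 \<le> T" using T by simp
    fix r assume r: "0 < r" "r < T"
    have "(\<Phi> has_real_derivative G r) (at r)"
      using \<Phi>_der[of r] r by (simp add: at_within_Icc_at)
    then have "((\<lambda>r. exp (- C * r) * \<Phi> r) has_real_derivative exp (- C * r) * (G r - C * \<Phi> r)) (at r)"
      by (auto intro!: derivative_eq_intros simp: algebra_simps)
    moreover have "exp (- C * r) * (G r - C * \<Phi> r) \<le> 0"
      using G_le[of r] r by (simp add: mult_nonneg_nonpos)
    ultimately show "\<exists>y. ((\<lambda>r. exp (- C * r) * \<Phi> r) has_real_derivative y) (at r) \<and> y \<le> 0" by blast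
  next
    have "continuous_on {0..T} \<Phi>"
      using \<Phi>_der by (meson DERIV_continuous continuous_on_eq_continuous_within)
    then show "continuous_on {0..T} (\<lambda>r. exp (- C * r) * \<Phi> r)" by (intro continuous_intros)
  qed
  then have "\<Phi> T \<le> 0" by (simp add: \<Phi>_def mult_le_0_iff)
  then have "C * \<Phi> T \<le> 0" using C by (simp add: mult_nonneg_nonpos)
  then have "G T \<le> 0" using G_le[of T] T by simp
  moreover have "(\<integral>r. \<bar>f r\<bar> \<partial>F_meas T) = G T" using GI[of T] by (simp add: integral_F)
  moreover have "0 \<le> (\<integral>r. \<bar>f r\<bar> \<partial>F_meas T)" by simp
  ultimately have "(\<integral>r. \<bar>f r\<bar> \<partial>F_meas T) = 0" by linarith
  then show ?thesis using integral_nonneg_eq_0_iff_AE[OF absf] by simp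
qed

text \<open>In terms of \<open>h(r) = e\<^sup>-\<^sup>L\<^sup>r f(r)\<close> the equation reads \<open>h = \<Psi> h\<close>, and for large \<open>L\<close> the map \<open>\<Psi>\<close> is a
  contraction for the supremum norm, because \<open>\<integral>\<^sub>0\<^sup>r e\<^sup>-\<^sup>L\<^sup>(\<^sup>r\<^sup>-\<^sup>s\<^sup>) ds \<le> 1/L\<close>. Clamping the argument to
  \<open>[0, T]\<close> places \<open>h\<close> in the complete space of bounded continuous functions on the line.\<close>

lemma V_solvable:
  assumes b: "continuous_on {0..T} b"
  shows "\<exists>f. continuous_on {0..T} f \<and> (\<forall>r\<in>{0..T}. V f r = b r)"
proof -
  \<comment> \<open>The map \<open>\<Psi>\<close> will have contraction constant \<open>M / (a L) \<le> 1/2\<close>; the summand \<open>1\<close> keeps \<open>L\<close> positive if \<open>M = 0\<close>.\<close>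
  define L where "L = 2 * M / a + 1"
  have L: "L > 0" "M / a / L \<le> 1 / 2" using M_nonneg a by (auto simp: L_def field_simps add_nonneg_pos)
  define cl where "cl r = max 0 (min T r)" for r :: real
  have cl: "cl r \<in> {0..T}" for r using T by (auto simp: cl_def)
  have cl_id: "cl r = r" if "r \<in> {0..T}" for r using that by (auto simp: cl_def)
  have cl_cont: "continuous_on S cl" for S unfolding cl_def by (intro continuous_intros)
  define J where "J h r = integral {0..1} (\<lambda>\<sigma>. K r (r * \<sigma>) * exp (- (L * r * (1 - \<sigma>))) * h (r * \<sigma>))"
    for h :: "real \<Rightarrow> real" and r
  define \<Psi> where "\<Psi> h r = (exp (- (L * cl r)) * b (cl r) - cl r * J h (cl r)) / a"
    for h :: "real \<Rightarrow> real" and r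
  have integrand: "continuous_on UNIV (\<lambda>(r, \<sigma>). K r (r * \<sigma>) * exp (- (L * r * (1 - \<sigma>))) * h (r * \<sigma>))"
    if h: "continuous_on UNIV h" for h
  proof -
    have "continuous_on UNIV (\<lambda>p. K (fst p) (fst p * snd p))"
      using continuous_on_compose2[OF K_cont, of UNIV "\<lambda>p. (fst p, fst p * snd p)"]
      by (simp add: continuous_on_Pair continuous_on_mult continuous_on_fst continuous_on_snd)
    moreover have "continuous_on UNIV (\<lambda>p :: real \<times> real. h (fst p * snd p))"
      by (rule continuous_on_compose2[OF h]) (auto intro!: continuous_intros)
    ultimately show ?thesis unfolding case_prod_unfold by (intro continuous_intros)
  qed
  have integrand_r: "continuous_on {0..1} (\<lambda>\<sigma>. K r (r * \<sigma>) * exp (- (L * r * (1 - \<sigma>))) * h (r * \<sigma>))"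
    if h: "continuous_on UNIV h" for h r
    using continuous_on_compose2[OF integrand[OF h], of "{0..1}" "\<lambda>\<sigma>. (r, \<sigma>)"]
    by (simp add: continuous_on_Pair)
  have J_cont: "continuous_on UNIV (J h)" if h: "continuous_on UNIV h" for h
    unfolding J_def
    using integral_continuous_on_param[of UNIV "0::real" 1
        "\<lambda>r \<sigma>. K r (r * \<sigma>) * exp (- (L * r * (1 - \<sigma>))) * h (r * \<sigma>)"]
      continuous_on_subset[OF integrand[OF h], of "UNIV \<times> cbox 0 1"] by (simp only: subset_UNIV box_real simp_thms)
  have J_diff: "r * \<bar>J h r - J h' r\<bar> \<le> M / L * d"
    if h: "continuous_on UNIV h" "continuous_on UNIV h'" and d: "\<And>s. \<bar>h s - h' s\<bar> \<le> d" and r: "r \<ge> 0" for h h' r d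
  proof -
    have d0: "d \<ge> 0" using d[of 0] by linarith
    have exp_int: "((\<lambda>\<sigma>. L * r * exp (- (L * r * (1 - \<sigma>)))) has_integral
        exp (- (L * r * (1 - 1))) - exp (- (L * r * (1 - 0)))) {0..1}"
      by (rule fundamental_theorem_of_calculus)
        (auto intro!: derivative_eq_intros simp: has_real_derivative_iff_has_vector_derivative[symmetric])
    have e1: "((\<lambda>\<sigma>. r * exp (- (L * r * (1 - \<sigma>)))) has_integral (1 - exp (- (L * r))) / L) {0..1}"
      using has_integral_mult_right[OF exp_int, of "1 / L"] L(1) by (simp add: mult.assoc)
    define p where "p \<sigma> = r * (K r (r * \<sigma>) * exp (- (L * r * (1 - \<sigma>))) * h (r * \<sigma>)
        - K r (r * \<sigma>) * exp (- (L * r * (1 - \<sigma>))) * h' (r * \<sigma>))" for \<sigma>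
    define q where "q \<sigma> = M * d * (r * exp (- (L * r * (1 - \<sigma>))))" for \<sigma>
    have "r * (J h r - J h' r) = integral {0..1} p"
      unfolding J_def p_def
      by (subst Henstock_Kurzweil_Integration.integral_diff[symmetric])
        (simp_all add: integrable_continuous_interval integrand_r h)
    also have "\<bar>\<dots>\<bar> \<le> integral {0..1} q"
    proof -
      have p: "p integrable_on {0..1}" unfolding p_def
        by (intro integrable_continuous_interval continuous_on_mult_left continuous_on_diff integrand_r h)
      have q: "q integrable_on {0..1}" unfolding q_def
        by (intro integrable_continuous_interval continuous_intros)
      have "\<bar>p \<sigma>\<bar> \<le> q \<sigma>" for \<sigma>
      proof -
        have "\<bar>K r (r * \<sigma>)\<bar> * \<bar>h (r * \<sigma>) - h' (r * \<sigma>)\<bar> \<le> M * d"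
          by (rule mult_mono[OF K_le d M_nonneg]) simp
        then have "(r * exp (- (L * r * (1 - \<sigma>)))) * (\<bar>K r (r * \<sigma>)\<bar> * \<bar>h (r * \<sigma>) - h' (r * \<sigma>)\<bar>)
            \<le> (r * exp (- (L * r * (1 - \<sigma>)))) * (M * d)"
          using r by (intro mult_left_mono) auto
        moreover have "p \<sigma> = (r * exp (- (L * r * (1 - \<sigma>)))) * (K r (r * \<sigma>) * (h (r * \<sigma>) - h' (r * \<sigma>)))"
          by (simp add: p_def algebra_simps)
        ultimately show ?thesis using r by (simp add: abs_mult q_def ac_simps)
      qed
      then show ?thesis using integral_norm_bound_integral[OF p q] by simp
    qed
    also have "\<dots> = M * d * ((1 - exp (- (L * r))) / L)"
      unfolding q_def using has_integral_mult_right[OF e1, of "M * d"] by (rule integral_unique)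
    also have "\<dots> \<le> M * d * (1 / L)"
      using M_nonneg d0 L(1) by (intro mult_left_mono divide_right_mono) auto
    finally show ?thesis using r by (simp add: abs_mult)
  qed
  have \<Psi>_bcont: "\<Psi> h \<in> bcontfun" if h: "continuous_on UNIV h" for h
  proof -
    have "continuous_on {0..T} (\<lambda>r. (exp (- (L * r)) * b r - r * J h r) / a)"
      by (intro continuous_on_divide continuous_on_diff continuous_on_mult continuous_on_exp continuous_on_minus
          continuous_on_id continuous_on_const b continuous_on_subset[OF J_cont[OF h]]) (use a in simp_all)
    moreover then obtain B where "\<forall>r\<in>{0..T}. \<bar>(exp (- (L * r)) * b r - r * J h r) / a\<bar> \<le> B"
      using continuous_on_interval_bounded by blast
    ultimately have *: "continuous_on UNIV (\<Psi> h)" "\<And>r. norm (\<Psi> h r) \<le> B"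
      using continuous_on_compose2[OF _ cl_cont, of "{0..T}" "\<lambda>r. (exp (- (L * r)) * b r - r * J h r) / a" UNIV] cl
      unfolding \<Psi>_def real_norm_def by blast+
    show ?thesis by (rule bcontfun_normI[OF *])
  qed
  have "\<exists>!h. Bcontfun (\<Psi> (apply_bcontfun h)) = h"
  proof (rule banach_fix_type[of "1/2"], goal_cases)
    case 3
    show ?case
    proof (intro allI dist_bound)
      fix h h' :: "real \<Rightarrow>\<^sub>C real" and r
      let ?r = "cl r"
      have "\<bar>\<Psi> h r - \<Psi> h' r\<bar> = ?r * \<bar>J h ?r - J h' ?r\<bar> / a"
        using cl[of r] a by (simp add: \<Psi>_def diff_divide_distrib[symmetric] right_diff_distrib[symmetric] abs_mult abs_minus_commute)
      also have "\<dots> \<le> (M / L * dist h h') / a"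
      proof (rule frac_le)
        show "?r * \<bar>J h ?r - J h' ?r\<bar> \<le> M / L * dist h h'"
          using cl[of r] by (intro J_diff) (auto simp: dist_real_def[symmetric] dist_bounded)
        show "0 \<le> M / L * dist h h'" using M_nonneg L(1) by simp
      qed (use a in simp_all)
      also have "\<dots> = (M / a / L) * dist h h'" by (simp add: field_simps)
      also have "\<dots> \<le> 1 / 2 * dist h h'" using L(2) by (intro mult_right_mono) auto
      finally show "dist (Bcontfun (\<Psi> h) r) (Bcontfun (\<Psi> h') r) \<le> 1 / 2 * dist h h'"
        by (simp add: Bcontfun_inverse \<Psi>_bcont dist_real_def)
    qed
  qed auto
  then obtain h where "Bcontfun (\<Psi> (apply_bcontfun h)) = h" by blast
  then have h: "\<Psi> h r = h r" for r
    using Bcontfun_inverse[OF \<Psi>_bcont, of h] by simp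
  define f where "f r = exp (L * r) * h r" for r
  have f_cont: "continuous_on S f" for S unfolding f_def by (intro continuous_intros) simp
  have "V f r = b r" if r: "r \<in> {0..T}" for r
  proof -
    have Kr: "continuous_on S (\<lambda>s. K r s)" for S
      using continuous_on_compose2[OF K_cont, of S "\<lambda>s. (r, s)"] by (simp add: continuous_on_Pair)
    have Kf: "continuous_on {0..r} (\<lambda>s. K r s * f s)" by (intro continuous_intros Kr f_cont)
    have "integral {0..r} (\<lambda>s. K r s * f s) = integral {0..1} (\<lambda>\<sigma>. r * (K r (r * \<sigma>) * f (r * \<sigma>)))"
      using integral_rescale[OF _ Kf] r by simp
    also have "\<dots> = integral {0..1} (\<lambda>\<sigma>. (exp (L * r) * r) * (K r (r * \<sigma>) * exp (- (L * r * (1 - \<sigma>))) * h (r * \<sigma>)))"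
    proof (rule integral_cong)
      fix \<sigma> :: real
      have "exp (L * (r * \<sigma>)) = exp (L * r) * exp (- (L * r * (1 - \<sigma>)))"
        by (simp add: exp_add[symmetric] algebra_simps)
      then show "r * (K r (r * \<sigma>) * f (r * \<sigma>)) =
          (exp (L * r) * r) * (K r (r * \<sigma>) * exp (- (L * r * (1 - \<sigma>))) * h (r * \<sigma>))"
        by (simp only: f_def mult_ac)
    qed
    also have "\<dots> = exp (L * r) * r * J h r" unfolding J_def by (rule integral_mult_right)
    finally have "(LBINT s:{0<..<r}. K r s * f s) = exp (L * r) * r * J h r"
      using continuous_integral_F(2)[OF Kf] by simp
    moreover have "a * h r = exp (- (L * r)) * b r - r * J h r"
      using h[of r] cl_id[OF r] a by (simp add: \<Psi>_def field_simps)
    then have "a * f r = b r - exp (L * r) * r * J h r"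
      by (simp add: f_def exp_minus field_simps)
    ultimately show ?thesis by (simp add: V_def)
  qed
  then show ?thesis using f_cont by blast
qed

end

section \<open>Travel time and passage to the time variable\<close>

locale string_system =
  fixes \<rho> q :: "real \<Rightarrow> real"
  assumes coeffs: "admissible_coeffs \<rho> q"
begin

abbreviation "\<tau> \<equiv> tau \<rho>"

lemma rho_cont: "continuous_on {0..} \<rho>" and q_cont: "continuous_on {0..} q"
  using coeffs by (auto simp: admissible_coeffs_def intro: smooth_on_imp_continuous_on)

lemma rho_pos: "x \<ge> 0 \<Longrightarrow> \<rho> x > 0"
  using coeffs by (auto simp: admissible_coeffs_def)

lemma sqrt_rho_cont: "S \<subseteq> {0..} \<Longrightarrow> continuous_on S (\<lambda>x. sqrt (\<rho> x))"
  by (intro continuous_intros continuous_on_subset[OF rho_cont])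

lemma tau_integral: "\<tau> x = integral {0..x} (\<lambda>s. sqrt (\<rho> s))"
  unfolding tau_def
  by (rule set_borel_integral_eq_integral(2)[OF borel_integrable_atLeastAtMost']) (rule sqrt_rho_cont, auto)

lemma tau_0 [simp]: "\<tau> 0 = 0"
  by (simp add: tau_integral)

lemma tau_deriv:
  assumes "x \<ge> 0" shows "(\<tau> has_real_derivative sqrt (\<rho> x)) (at x within {0..})"
proof -
  have "((\<lambda>x. integral {0..x} (\<lambda>s. sqrt (\<rho> s))) has_real_derivative sqrt (\<rho> x)) (at x within {0..x+1})"
    by (rule integral_has_real_derivative[OF sqrt_rho_cont]) (use assms in auto)
  moreover have "at x within {0..x+1} = at x within {0..}"
    by (rule at_within_nhd[of x "{..<x+1}"]) (use assms in auto)
  ultimately show ?thesis by (simp add: tau_integral[abs_def])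
qed

lemma tau_deriv_at: "x > 0 \<Longrightarrow> (\<tau> has_real_derivative sqrt (\<rho> x)) (at x)"
  using tau_deriv[of x] at_within_interior[of x "{0..}"] by simp

lemma tau_cont: "continuous_on {0..} (\<tau>)"
  using tau_deriv by (auto simp: continuous_on_eq_continuous_within intro: DERIV_continuous)

lemma tau_less: assumes "0 \<le> x" "x < y" shows "\<tau> x < \<tau> y"
proof (rule DERIV_pos_imp_increasing_open[OF assms(2)])
  fix z assume "x < z" "z < y"
  then have "z > 0" "sqrt (\<rho> z) > 0" using assms(1) rho_pos[of z] by auto
  then show "\<exists>y. (\<tau> has_real_derivative y) (at z) \<and> 0 < y" using tau_deriv_at by blast
qed (rule continuous_on_subset[OF tau_cont], use assms in auto)

lemma tau_less_iff: "0 \<le> x \<Longrightarrow> 0 \<le> y \<Longrightarrow> \<tau> x < \<tau> y \<longleftrightarrow> x < y"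
  using tau_less[of x y] tau_less[of y x] by (metis less_asym' linorder_neqE_linordered_idom)

lemma tau_le_iff: "0 \<le> x \<Longrightarrow> 0 \<le> y \<Longrightarrow> \<tau> x \<le> \<tau> y \<longleftrightarrow> x \<le> y"
  using tau_less_iff[of y x] by (simp add: not_less[symmetric])

lemma tau_nonneg: "0 \<le> x \<Longrightarrow> 0 \<le> \<tau> x"
  using tau_le_iff[of 0 x] by simp

text \<open>By monotone convergence a bound for \<open>\<tau>\<close> would bound the integral of \<open>\<rho>\<^sup>1\<^sup>/\<^sup>2\<close> over the half-line.\<close>

lemma tau_unbounded: "\<exists>x\<ge>0. t < \<tau> x"
proof (rule ccontr)
  assume "\<not> ?thesis"
  then have le: "\<tau> x \<le> t" if "x \<ge> 0" for x using that by (auto simp: not_less)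
  let ?f = "\<lambda>n x. ennreal (indicator {0..real n} x * sqrt (\<rho> x))"
  have int: "set_integrable lborel {0..b} (\<lambda>x. sqrt (\<rho> x))" for b
    by (rule borel_integrable_atLeastAtMost'[OF sqrt_rho_cont]) auto
  have nn: "(\<integral>\<^sup>+x. ?f n x \<partial>lborel) \<le> ennreal t" for n
  proof -
    have "(\<integral>\<^sup>+x. ?f n x \<partial>lborel) = ennreal (\<tau> (real n))"
      using int[of "real n"] rho_pos
      by (subst nn_integral_eq_integral)
        (auto simp: set_integrable_def tau_def set_lebesgue_integral_def indicator_def less_imp_le)
    then show ?thesis using le by (simp add: ennreal_leI)
  qed
  have "(\<integral>\<^sup>+x\<in>{0..}. ennreal (sqrt (\<rho> x)) \<partial>lborel) = (\<integral>\<^sup>+x. (SUP n. ?f n x) \<partial>lborel)"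
  proof (rule nn_integral_cong)
    fix x :: real
    show "ennreal (sqrt (\<rho> x)) * indicator {0..} x = (SUP n. ?f n x)"
    proof (cases "x \<ge> 0")
      case True
      obtain N :: nat where "x \<le> real N" using real_arch_simple by blast
      then have "?f N x = ennreal (sqrt (\<rho> x))" using True by simp
      moreover have "?f n x \<le> ennreal (sqrt (\<rho> x))" for n
        using rho_pos[OF True] by (intro ennreal_leI) (simp add: indicator_def less_imp_le)
      ultimately have "(SUP n. ?f n x) = ennreal (sqrt (\<rho> x))"
        by (intro antisym SUP_least SUP_upper2[of N]) auto
      then show ?thesis using True by simp
    qed (simp add: indicator_def)
  qed
  also have "\<dots> = (SUP n. \<integral>\<^sup>+x. ?f n x \<partial>lborel)"
  proof (rule nn_integral_monotone_convergence_SUP)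
    show "incseq ?f"
      using rho_pos by (intro incseq_SucI le_funI ennreal_leI) (auto simp: indicator_def less_imp_le)
    show "?f n \<in> borel_measurable lborel" for n
      using borel_measurable_integrable[OF int[of "real n", unfolded set_integrable_def]] by simp
  qed
  also have "\<dots> \<le> ennreal t" by (rule SUP_least) (rule nn)
  finally show False using coeffs by (simp add: admissible_coeffs_def top_unique)
qed

lemma tau_bij: "bij_betw (\<tau>) {0..} {0..}"
proof -
  have "inj_on (\<tau>) {0..}"
    by (rule inj_onI) (metis atLeast_iff antisym order_refl tau_le_iff)
  moreover have "\<tau> ` {0..} = {0..}"
  proof (intro equalityI subsetI)
    fix t :: real assume t: "t \<in> {0..}"
    obtain b where b: "b \<ge> 0" "t < \<tau> b" using tau_unbounded by blast
    have "\<exists>x. 0 \<le> x \<and> x \<le> b \<and> \<tau> x = t"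
      by (rule IVT') (use b t continuous_on_subset[OF tau_cont] in auto)
    then show "t \<in> \<tau> ` {0..}" by auto
  qed (use tau_nonneg in auto)
  ultimately show ?thesis by (simp add: bij_betw_def)
qed

lemma xinv_tau: "x \<ge> 0 \<Longrightarrow> xinv \<rho> (\<tau> x) = x"
  unfolding xinv_def using tau_bij by (intro the_inv_into_f_f) (auto simp: bij_betw_def)

lemma tau_xinv: "t \<ge> 0 \<Longrightarrow> \<tau> (xinv \<rho> t) = t"
  unfolding xinv_def using tau_bij by (intro f_the_inv_into_f) (auto simp: bij_betw_def)

lemma xinv_nonneg: "t \<ge> 0 \<Longrightarrow> xinv \<rho> t \<ge> 0"
  unfolding xinv_def using tau_bij the_inv_into_into[of "\<tau>" "{0..}" t "{0..}"] by (auto simp: bij_betw_def)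

lemma xinv_0 [simp]: "xinv \<rho> 0 = 0"
  using xinv_tau[of 0] by simp

lemma xinv_less_iff: "0 \<le> s \<Longrightarrow> 0 \<le> t \<Longrightarrow> xinv \<rho> s < xinv \<rho> t \<longleftrightarrow> s < t"
  using tau_less_iff[of "xinv \<rho> s" "xinv \<rho> t"] by (simp add: xinv_nonneg tau_xinv)

lemma xinv_le_iff: "0 \<le> s \<Longrightarrow> 0 \<le> t \<Longrightarrow> xinv \<rho> s \<le> xinv \<rho> t \<longleftrightarrow> s \<le> t"
  using xinv_less_iff[of t s] by (simp add: not_less[symmetric])

lemma xinv_cont: "continuous_on {0..T} (xinv \<rho>)"
proof (cases "T \<ge> 0")
  case True
  have "\<tau> ` {0..xinv \<rho> T} = {0..T}"
  proof (intro equalityI subsetI)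
    fix t assume "t \<in> {0..T}"
    then show "t \<in> \<tau> ` {0..xinv \<rho> T}"
      by (intro image_eqI[of _ _ "xinv \<rho> t"]) (auto simp: tau_xinv xinv_nonneg xinv_le_iff)
  next
    fix t assume "t \<in> \<tau> ` {0..xinv \<rho> T}"
    then obtain x where "0 \<le> x" "x \<le> xinv \<rho> T" "t = \<tau> x" by auto
    then show "t \<in> {0..T}"
      using tau_le_iff[of x "xinv \<rho> T"] True by (simp add: tau_xinv xinv_nonneg tau_nonneg)
  qed
  moreover have "continuous_on (\<tau> ` {0..xinv \<rho> T}) (xinv \<rho>)"
    by (rule continuous_on_inv) (auto intro: continuous_on_subset[OF tau_cont] xinv_tau)
  ultimately show ?thesis by simp
qed simp

end

locale string_control = string_system +
  fixes T :: real
  assumes T: "T > 0"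
begin

abbreviation "X \<equiv> xinv \<rho> T"
abbreviation "F \<equiv> F_meas T"
abbreviation "H \<equiv> H_meas \<rho> T"

definition xh :: "real \<Rightarrow> real" where "xh r = xinv \<rho> (T - r)"

text \<open>Here \<open>xh r\<close> is the point reached at time \<open>T\<close> by the front of a wave sent at time \<open>r\<close>. As
  \<open>\<rho> dx = \<rho>\<^sup>1\<^sup>/\<^sup>2 dr\<close> in absolute value under \<open>r = T - \<tau>(x)\<close>, the factor \<open>\<rho>\<^sup>1\<^sup>/\<^sup>4\<close> makes \<open>hat\<close> an isometry
  from \<open>L2 H\<close> onto \<open>L2 F\<close>.\<close>

definition hat :: "(real \<Rightarrow> real) \<Rightarrow> real \<Rightarrow> real" where
  "hat \<phi> r = \<rho> (xh r) powr (1/4) * \<phi> (xh r)"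

lemma X_pos: "X > 0"
  using xinv_less_iff[of 0 T] T by simp

lemma xh_cont: "continuous_on {0..T} xh"
  unfolding xh_def by (rule continuous_on_compose2[OF xinv_cont[of T]]) (auto intro!: continuous_intros)

lemma xh_range: "r \<in> {0..T} \<Longrightarrow> xh r \<in> {0..X}" "r \<in> {0<..<T} \<Longrightarrow> xh r \<in> {0<..<X}"
  using xinv_less_iff[of 0 "T - r"] xinv_less_iff[of "T - r" T]  xinv_le_iff[of "T - r" T]
  by (auto simp: xh_def xinv_nonneg)

lemma tau_xh: "r \<le> T \<Longrightarrow> \<tau> (xh r) = T - r"
  by (simp add: xh_def tau_xinv)

lemma xh_tau: "x \<ge> 0 \<Longrightarrow> xh (T - \<tau> x) = x"
  by (simp add: xh_def xinv_tau)

lemma tau_image: "(\<lambda>x. T - \<tau> x) ` {0<..<X} = {0<..<T}"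
proof (intro equalityI subsetI)
  fix r assume "r \<in> {0<..<T}"
  then show "r \<in> (\<lambda>x. T - \<tau> x) ` {0<..<X}"
    using xh_range(2)[of r] tau_xh[of r] by (intro image_eqI[of _ _ "xh r"]) auto
next
  fix r assume "r \<in> (\<lambda>x. T - \<tau> x) ` {0<..<X}"
  then obtain x where x: "0 < x" "x < X" "r = T - \<tau> x" by auto
  then show "r \<in> {0<..<T}"
    using tau_less_iff[of 0 x] tau_less_iff[of x X] T X_pos by (simp add: tau_xinv)
qed

lemma T_minus_tau_mem: "x \<in> {0<..<X} \<Longrightarrow> T - \<tau> x \<in> {0<..<T}"
  using tau_image by blast

lemma rho_xh_pos: "r \<in> {0..T} \<Longrightarrow> \<rho> (xh r) > 0"
  using xh_range(1) rho_pos by auto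

lemma space_H: "space H = {0<..<X}" and sets_H: "sets H = sets (restrict_space borel {0<..<X})"
  by (auto simp: H_meas_def sets_restrict_space)

lemma measurable_H: "f \<in> borel_measurable H \<longleftrightarrow> f \<in> borel_measurable (restrict_space borel {0<..<X})"
  by (rule measurable_cong_sets[THEN eqset_imp_iff]) (simp_all add: sets_H)

lemma measurable_F: "f \<in> borel_measurable F \<longleftrightarrow> f \<in> borel_measurable (restrict_space borel {0<..<T})"
  unfolding F_meas_def
  by (rule measurable_cong_sets[THEN eqset_imp_iff]) (simp_all add: sets_restrict_space)

lemma xh_measurable: "xh \<in> measurable (restrict_space borel {0<..<T}) (restrict_space borel {0<..<X})"
  by (rule measurable_restrict_space2[OF _ borel_measurable_continuous_on_restrict])
    (use xh_range in \<open>auto intro: continuous_on_subset[OF xh_cont]\<close>)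

lemma tau_measurable:
  "(\<lambda>x. T - \<tau> x) \<in> measurable (restrict_space borel {0<..<X}) (restrict_space borel {0<..<T})"
  by (rule measurable_restrict_space2[OF _ borel_measurable_continuous_on_restrict])
    (use T_minus_tau_mem in \<open>auto intro!: continuous_intros continuous_on_subset[OF tau_cont]\<close>)

lemma measurable_F_xh: "\<phi> \<in> borel_measurable H \<Longrightarrow> (\<lambda>r. \<phi> (xh r)) \<in> borel_measurable F"
  unfolding measurable_F measurable_H by (rule measurable_compose[OF xh_measurable])

lemma measurable_H_tau: "f \<in> borel_measurable F \<Longrightarrow> (\<lambda>x. f (T - \<tau> x)) \<in> borel_measurable H"
  unfolding measurable_F measurable_H by (rule measurable_compose[OF tau_measurable])

lemma rho_xh_cont:
  "continuous_on {0..T} (\<lambda>r. \<rho> (xh r))"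
  by (rule continuous_on_compose2[OF rho_cont xh_cont]) (use xh_range in auto)

lemma rho_xh_powr_cont: "continuous_on {0..T} (\<lambda>r. \<rho> (xh r) powr c)"
  by (intro continuous_on_powr rho_xh_cont continuous_on_const) (use rho_xh_pos in force)

lemma hat_measurable:
  assumes "\<phi> \<in> borel_measurable H" shows "hat \<phi> \<in> borel_measurable F"
  unfolding hat_def
  by (intro borel_measurable_times measurable_F_xh assms measurable_F_continuous
      continuous_on_subset[OF rho_xh_powr_cont]) auto

lemma H_integral_eq:
  assumes \<phi>: "\<phi> \<in> borel_measurable H"
  shows "integrable H \<phi> \<longleftrightarrow> set_integrable lborel {0<..<X} (\<lambda>x. \<rho> x * \<phi> x)"
    "integral\<^sup>L H \<phi> = (LBINT x:{0<..<X}. \<rho> x * \<phi> x)"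
proof -
  let ?M = "restrict_space lborel {0<..<X}"
  have m: "\<phi> \<in> borel_measurable ?M" "\<rho> \<in> borel_measurable ?M"
  proof -
    show "\<phi> \<in> borel_measurable ?M"
      using \<phi> unfolding measurable_H by (subst measurable_cong_sets[OF _ refl]) (auto simp: sets_restrict_space)
    have "\<rho> \<in> borel_measurable (restrict_space borel {0<..<X})"
      by (intro borel_measurable_continuous_on_restrict continuous_on_subset[OF rho_cont]) auto
    then show "\<rho> \<in> borel_measurable ?M"
      by (subst measurable_cong_sets[OF _ refl]) (auto simp: sets_restrict_space)
  qed
  have nn: "AE x in ?M. 0 \<le> \<rho> x" using rho_pos by (intro AE_I2) (auto simp: less_imp_le)
  show "integrable H \<phi> \<longleftrightarrow> set_integrable lborel {0<..<X} (\<lambda>x. \<rho> x * \<phi> x)"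
    unfolding H_meas_def set_integrable_def
    using integrable_density[OF m nn] integrable_restrict_space[of "{0<..<X}" lborel "\<lambda>x. \<rho> x * \<phi> x"] by simp
  show "integral\<^sup>L H \<phi> = (LBINT x:{0<..<X}. \<rho> x * \<phi> x)"
    unfolding H_meas_def set_lebesgue_integral_def
    using integral_density[OF m nn] integral_restrict_space[of "{0<..<X}" lborel "\<lambda>x. \<rho> x * \<phi> x"] by simp
qed

lemma set_integrable_lebesgue_iff:
  fixes f :: "real \<Rightarrow> real"
  assumes "(\<lambda>x. indicator S x * f x) \<in> borel_measurable borel"
  shows "f absolutely_integrable_on S \<longleftrightarrow> set_integrable lborel S f"
  using assms integrable_completion[of "\<lambda>x. indicator S x *\<^sub>R f x" lborel] by (simp add: set_integrable_def)

text \<open>The change of variables \<open>r = T - \<tau>(x)\<close>. The theorem for the Lebesgue measure gives an equivalence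
  of integrability, which is transferred to Borel functions.\<close>

lemma hat_integral:
  assumes \<phi>: "\<phi> \<in> borel_measurable H"
  shows "integrable H \<phi> \<longleftrightarrow> integrable F (\<lambda>r. sqrt (\<rho> (xh r)) * \<phi> (xh r))"
    and "integral\<^sup>L H \<phi> = integral\<^sup>L F (\<lambda>r. sqrt (\<rho> (xh r)) * \<phi> (xh r))"
proof -
  let ?f = "\<lambda>r. sqrt (\<rho> (xh r)) * \<phi> (xh r)" and ?h = "\<lambda>x. \<rho> x * \<phi> x"
  have fm: "?f \<in> borel_measurable F"
    by (intro borel_measurable_times measurable_F_xh \<phi> measurable_F_continuous continuous_intros
      continuous_on_subset[OF rho_xh_cont]) auto
  have "\<rho> \<in> borel_measurable (restrict_space borel {0<..<X})"
    by (intro borel_measurable_continuous_on_restrict continuous_on_subset[OF rho_cont]) auto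
  then have hm: "?h \<in> borel_measurable (restrict_space borel {0<..<X})"
    using \<phi> unfolding measurable_H by (intro borel_measurable_times)
  have fb: "(\<lambda>r. indicator {0<..<T} r * ?f r) \<in> borel_measurable borel"
    using fm by (simp add: measurable_F_iff)
  have hb: "(\<lambda>x. indicator {0<..<X} x * ?h x) \<in> borel_measurable borel"
    using hm borel_measurable_restrict_space_iff[of "{0<..<X}" borel ?h] by simp
  have eq: "\<bar>- sqrt (\<rho> x)\<bar> * ?f (T - \<tau> x) = ?h x" if "x \<in> {0<..<X}" for x
    using that rho_pos[of x] by (simp add: xh_tau mult.assoc[symmetric] less_imp_le)
  have "(\<lambda>x. \<bar>- sqrt (\<rho> x)\<bar> * ?f (T - \<tau> x)) absolutely_integrable_on {0<..<X} \<and>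
      integral {0<..<X} (\<lambda>x. \<bar>- sqrt (\<rho> x)\<bar> * ?f (T - \<tau> x)) = b \<longleftrightarrow>
      ?f absolutely_integrable_on ((\<lambda>x. T - \<tau> x) ` {0<..<X}) \<and>
      integral ((\<lambda>x. T - \<tau> x) ` {0<..<X}) ?f = b" for b
  proof (rule has_absolute_integral_change_of_variables_1')
    show "{0<..<X} \<in> sets lebesgue" by simp
    show "((\<lambda>x. T - \<tau> x) has_real_derivative - sqrt (\<rho> x)) (at x within {0<..<X})" if "x \<in> {0<..<X}" for x
    proof -
      have "((\<lambda>x. T - \<tau> x) has_real_derivative 0 - sqrt (\<rho> x)) (at x)"
        by (rule DERIV_diff[OF DERIV_const tau_deriv_at]) (use that in simp)
      from has_field_derivative_at_within[OF this, of "{0<..<X}"] show ?thesis by simp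
    qed
    show "inj_on (\<lambda>x. T - \<tau> x) {0<..<X}"
      using tau_bij by (auto simp: bij_betw_def inj_on_def)
  qed
  moreover have "(\<lambda>x. \<bar>- sqrt (\<rho> x)\<bar> * ?f (T - \<tau> x)) absolutely_integrable_on {0<..<X} \<longleftrightarrow>
      ?h absolutely_integrable_on {0<..<X}"
    by (rule set_integrable_cong) (use eq in auto)
  moreover have "integral {0<..<X} (\<lambda>x. \<bar>- sqrt (\<rho> x)\<bar> * ?f (T - \<tau> x)) = integral {0<..<X} ?h"
    by (rule integral_cong) (use eq in auto)
  ultimately have *: "?h absolutely_integrable_on {0<..<X} \<and> integral {0<..<X} ?h = b \<longleftrightarrow>
      ?f absolutely_integrable_on {0<..<T} \<and> integral {0<..<T} ?f = b" for b
    by (simp only: tau_image)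
  then have iff: "?h absolutely_integrable_on {0<..<X} \<longleftrightarrow> ?f absolutely_integrable_on {0<..<T}" by blast
  show int: "integrable H \<phi> \<longleftrightarrow> integrable F ?f"
    unfolding H_integral_eq(1)[OF \<phi>] integrable_F
    using iff unfolding set_integrable_lebesgue_iff[OF fb] set_integrable_lebesgue_iff[OF hb] .
  show "integral\<^sup>L H \<phi> = integral\<^sup>L F ?f"
  proof (cases "integrable H \<phi>")
    case True
    then have i: "set_integrable lborel {0<..<X} ?h" "set_integrable lborel {0<..<T} ?f"
      using int H_integral_eq(1)[OF \<phi>] integrable_F by auto
    then have "integral {0<..<X} ?h = integral {0<..<T} ?f"
      using * set_integrable_lebesgue_iff[OF fb] by metis
    then show ?thesis
      unfolding H_integral_eq(2)[OF \<phi>] integral_F set_borel_integral_eq_integral(2)[OF i(1)]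
        set_borel_integral_eq_integral(2)[OF i(2)] .
  next
    case False
    then show ?thesis using int by (simp add: not_integrable_integral_eq)
  qed
qed

lemma hat_mult: "r \<in> {0<..<T} \<Longrightarrow> hat \<phi> r * hat \<psi> r = sqrt (\<rho> (xh r)) * (\<phi> (xh r) * \<psi> (xh r))"
  using rho_xh_pos[of r]
  by (simp add: hat_def powr_half_sqrt[symmetric] mult.assoc mult.left_commute[of _ "\<phi> _"] powr_add[symmetric])

lemma L2_inner_hat:
  assumes "\<phi> \<in> borel_measurable H" "\<psi> \<in> borel_measurable H"
  shows "L2_inner H \<phi> \<psi> = L2_inner F (hat \<phi>) (hat \<psi>)"
proof -
  have "(\<lambda>x. \<phi> x * \<psi> x) \<in> borel_measurable H" using assms by simp
  from hat_integral(2)[OF this] show ?thesis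
    unfolding L2_inner_def by (simp only:) (rule Bochner_Integration.integral_cong, auto simp: hat_mult)
qed

lemma L2_hat_iff:
  assumes "\<phi> \<in> borel_measurable H" shows "\<phi> \<in> L2 H \<longleftrightarrow> hat \<phi> \<in> L2 F"
proof -
  have "(\<lambda>x. \<phi> x * \<phi> x) \<in> borel_measurable H" using assms by simp
  from hat_integral(1)[OF this]
  have "integrable H (\<lambda>x. \<phi> x * \<phi> x) \<longleftrightarrow> integrable F (\<lambda>r. hat \<phi> r * hat \<phi> r)"
    by (simp only:) (rule Bochner_Integration.integrable_cong, auto simp: hat_mult)
  then show ?thesis using assms hat_measurable[OF assms] by (simp add: L2_def power2_eq_square)
qed

lemma L2_hat: "\<phi> \<in> L2 H \<Longrightarrow> hat \<phi> \<in> L2 F"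
  using L2_hat_iff by (auto simp: L2_def)

text \<open>Almost everywhere equality is a statement about norms in \<open>L2\<close>, so it is carried over by the isometry
  and null sets need not be mapped.\<close>

lemma AE_hat_iff:
  assumes "\<phi> \<in> L2 H" "\<psi> \<in> L2 H"
  shows "(AE x in H. \<phi> x = \<psi> x) \<longleftrightarrow> (AE r in F. hat \<phi> r = hat \<psi> r)"
proof -
  let ?d = "\<lambda>x. \<phi> x - \<psi> x"
  have d: "?d \<in> L2 H" by (rule L2_diff[OF assms])
  have zero_iff: "(AE x in M. f x = 0) \<longleftrightarrow> L2_inner M f f = 0" if "f \<in> L2 M" for f and M :: "real measure"
    using that integral_nonneg_eq_0_iff_AE[of M "\<lambda>x. (f x)\<^sup>2"]
    by (simp add: L2_def L2_inner_def power2_eq_square)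
  have "(AE x in H. \<phi> x = \<psi> x) \<longleftrightarrow> (AE x in H. ?d x = 0)" by simp
  also have "\<dots> \<longleftrightarrow> L2_inner F (hat ?d) (hat ?d) = 0"
    using zero_iff[OF d] L2_inner_hat[of ?d ?d] d by (simp add: L2_def)
  also have "\<dots> \<longleftrightarrow> (AE r in F. hat ?d r = 0)"
    using zero_iff[OF L2_hat[OF d]] by simp
  also have "\<dots> \<longleftrightarrow> (AE r in F. hat \<phi> r = hat \<psi> r)"
  proof -
    have "hat ?d r = hat \<phi> r - hat \<psi> r" for r by (simp add: hat_def right_diff_distrib)
    then show ?thesis by simp
  qed
  finally show ?thesis .
qed

end

section \<open>The control operator\<close>

locale string_fundamental = string_control +
  fixes w :: "real \<Rightarrow> real \<Rightarrow> real"
  assumes w: "regular_part \<rho> q w"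
begin

abbreviation "W \<equiv> W_op \<rho> w T"
abbreviation "wedge \<equiv> {(x, t). 0 \<le> x \<and> \<tau> x \<le> t}"

lemma w_cont: "continuous_on wedge (\<lambda>(x, t). w x t)"
  using w by (auto simp: regular_part_def intro: smooth_on_imp_continuous_on)

definition cl :: "real \<Rightarrow> real \<Rightarrow> real" where "cl b r = max 0 (min b r)"

definition A0 :: real where "A0 = \<rho> 0 powr (1/4)"

text \<open>The integral kernel of \<open>W\<close> in the variable \<open>r\<close>. It has this meaning for \<open>0 \<le> s \<le> r \<le> T\<close>, where
  \<open>(xh r, T - s)\<close> lies in the wedge on which \<open>w\<close> is continuous; the clamps extend it to the plane.\<close>

definition K :: "real \<Rightarrow> real \<Rightarrow> real" where
  "K r s = \<rho> (xh (cl T r)) powr (1/4) * w (xh (cl T r)) (T - cl (cl T r) s)"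

lemma cl_range: "0 \<le> b \<Longrightarrow> cl b r \<in> {0..b}"
  by (auto simp: cl_def)

lemma cl_id: "r \<in> {0..b} \<Longrightarrow> cl b r = r"
  by (auto simp: cl_def)

lemma K_cont: "continuous_on UNIV (\<lambda>(r, s). K r s)"
proof -
  have c1: "continuous_on UNIV (\<lambda>p :: real \<times> real. cl T (fst p))"
    unfolding cl_def by (intro continuous_intros)
  have c2: "continuous_on UNIV (\<lambda>p :: real \<times> real. T - cl (cl T (fst p)) (snd p))"
    unfolding cl_def by (intro continuous_intros)
  have r: "cl T r \<in> {0..T}" for r using T by (intro cl_range) simp
  have xc: "continuous_on UNIV (\<lambda>p :: real \<times> real. xh (cl T (fst p)))"
    by (rule continuous_on_compose2[OF xh_cont c1]) (use r in auto)
  have rc: "continuous_on UNIV (\<lambda>p :: real \<times> real. \<rho> (xh (cl T (fst p))) powr (1/4))"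
    by (rule continuous_on_compose2[OF rho_xh_powr_cont c1]) (use r in auto)
  have mem: "(xh (cl T r), T - cl (cl T r) s) \<in> wedge" for r s
    using xh_range(1)[OF r] tau_xh[of "cl T r"] r[of r] cl_range[of "cl T r" s] by auto
  have "continuous_on UNIV (\<lambda>p :: real \<times> real. case (xh (cl T (fst p)), T - cl (cl T (fst p)) (snd p)) of (x, t) \<Rightarrow> w x t)"
    by (rule continuous_on_compose2[OF w_cont continuous_on_Pair[OF xc c2]]) (use mem in blast)
  then show ?thesis unfolding K_def case_prod_unfold fst_conv snd_conv by (rule continuous_on_mult[OF rc])
qed

lemma K_bounded: "\<exists>M. \<forall>r s. \<bar>K r s\<bar> \<le> M"
proof -
  have "compact ((\<lambda>(r, s). K r s) ` ({0..T} \<times> {0..T}))"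
    by (intro compact_continuous_image continuous_on_subset[OF K_cont] compact_Times) auto
  then obtain M where M: "\<And>r s. r \<in> {0..T} \<Longrightarrow> s \<in> {0..T} \<Longrightarrow> \<bar>K r s\<bar> \<le> M"
    using compact_imp_bounded by (fastforce simp: bounded_iff)
  have "K r s = K (cl T r) (cl (cl T r) s)" for r s
    using T cl_id[OF cl_range[of T r]] cl_id[OF cl_range[of "cl T r" s]] cl_range[of T r] by (simp add: K_def)
  moreover have "cl T r \<in> {0..T}" "cl (cl T r) s \<in> {0..T}" for r s
    using T cl_range[of T r] cl_range[of "cl T r" s] by auto
  ultimately show ?thesis using M by metis
qed

lemma A0_pos: "A0 > 0"
  using rho_pos[of 0] by (simp add: A0_def)

definition K_max :: real where "K_max = (SOME M. \<forall>r s. \<bar>K r s\<bar> \<le> M)"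

sublocale control: volterra T A0 K K_max
proof
  show "\<bar>K r s\<bar> \<le> K_max" for r s unfolding K_max_def using someI_ex[OF K_bounded] by blast
qed (use T A0_pos K_cont in auto)

abbreviation "V \<equiv> control.V"

text \<open>The factor \<open>\<rho>\<^sup>1\<^sup>/\<^sup>4\<close> of the isometry cancels the amplitude \<open>(\<rho>/\<rho>(0))\<^sup>-\<^sup>1\<^sup>/\<^sup>4\<close> of the wave front up to
  the constant \<open>A0\<close>.\<close>

lemma hat_W:
  assumes r: "r \<in> {0<..<T}" shows "hat (W f) r = V f r"
proof -
  let ?x = "xh r"
  have x: "\<tau> ?x = T - r" "\<rho> ?x > 0" "\<rho> 0 > 0" using r tau_xh rho_xh_pos rho_pos by auto
  have "\<rho> ?x powr (1/4) * (\<rho> ?x / \<rho> 0) powr (- 1 / 4) = A0"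
    using x by (simp add: A0_def powr_divide powr_minus field_simps)
  moreover have "\<rho> ?x powr (1/4) * (LBINT s:{0<..<r}. w ?x (T - s) * f s) = (LBINT s:{0<..<r}. K r s * f s)"
  proof -
    have "K r s = \<rho> ?x powr (1/4) * w ?x (T - s)" if "s \<in> {0<..<r}" for s
      using that r by (simp add: K_def cl_id)
    then have "(LBINT s:{0<..<r}. K r s * f s) = (LBINT s:{0<..<r}. \<rho> ?x powr (1/4) * (w ?x (T - s) * f s))"
      by (intro set_lebesgue_integral_cong) (auto simp: mult.assoc)
    then show ?thesis by simp
  qed
  moreover have "ext0 f r = f r" using r by (simp add: ext0_def)
  ultimately show ?thesis
    unfolding hat_def W_op_def u_sol_def control.V_def x(1)
    by (simp add: distrib_left mult.assoc[symmetric])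
qed

lemma W_tau: assumes "x \<in> {0<..<X}" shows "W f x = \<rho> x powr (- 1/4) * V f (T - \<tau> x)"
proof -
  have "hat (W f) (T - \<tau> x) = \<rho> x powr (1/4) * W f x"
    using assms by (simp add: hat_def xh_tau)
  moreover have "\<rho> x powr (1/4) > 0" using rho_pos[of x] assms by simp
  ultimately show ?thesis
    using hat_W[OF T_minus_tau_mem[OF assms], of f] by (simp add: powr_minus field_simps)
qed

lemma W_L2: assumes f: "f \<in> L2 F" shows "W f \<in> L2 H"
proof -
  have Vf: "V f \<in> L2 F" by (rule control.V_L2[OF f])
  have rm: "(\<lambda>x. \<rho> x powr (- 1/4)) \<in> borel_measurable H"
  proof -
    have "\<rho> x \<noteq> 0" if "x \<in> {0<..<X}" for x using rho_pos[of x] that by simp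
    then show ?thesis
      unfolding measurable_H
      by (intro borel_measurable_continuous_on_restrict continuous_on_powr continuous_on_subset[OF rho_cont]
          continuous_on_const) auto
  qed
  have "(\<lambda>x. \<rho> x powr (- 1/4) * V f (T - \<tau> x)) \<in> borel_measurable H"
    using Vf by (intro borel_measurable_times rm measurable_H_tau) (simp add: L2_def)
  then have m: "W f \<in> borel_measurable H"
    by (subst measurable_cong[of _ _ "\<lambda>x. \<rho> x powr (- 1/4) * V f (T - \<tau> x)"]) (simp_all add: space_H W_tau)
  have "hat (W f) \<in> L2 F"
    by (rule L2_cong_AE[OF Vf hat_measurable[OF m]]) (auto simp: AE_F hat_W)
  then show ?thesis using L2_hat_iff[OF m] by simp
qed

lemma W_diff:
  assumes "f \<in> L2 F" "g \<in> L2 F" "x \<in> {0<..<X}" shows "W (\<lambda>s. f s - g s) x = W f x - W g x"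
proof -
  show ?thesis using control.V_diff[OF assms(1,2) T_minus_tau_mem[OF assms(3)]] assms(3)
    by (simp add: W_tau right_diff_distrib)
qed

lemma W_adjoint_exists:
  assumes v: "v \<in> L2 H"
  shows "\<exists>b\<in>L2 F. \<forall>f\<in>L2 F. L2_inner H (W f) v = L2_inner F f b"
proof -
  have "L2_inner H (W f) v = L2_inner F f (control.V_adj (hat v))" if f: "f \<in> L2 F" for f
  proof -
    have "L2_inner H (W f) v = L2_inner F (hat (W f)) (hat v)"
      using W_L2[OF f] v by (intro L2_inner_hat) (simp_all add: L2_def)
    also have "\<dots> = L2_inner F (V f) (hat v)"
      unfolding L2_inner_def by (rule Bochner_Integration.integral_cong) (simp_all add: hat_W)
    also have "\<dots> = L2_inner F f (control.V_adj (hat v))" by (rule control.V_adjoint[OF f L2_hat[OF v]])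
    finally show ?thesis .
  qed
  then show ?thesis using control.V_adj_L2[OF L2_hat[OF v]] by blast
qed

lemma W_injective:
  assumes f: "f \<in> L2 F" and 0: "AE x in H. W f x = 0"
  shows "AE t in F. f t = 0"
proof -
  have z: "(\<lambda>x. 0) \<in> L2 H" by (simp add: L2_def)
  have "AE r in F. hat (W f) r = hat (\<lambda>x. 0) r" using 0 AE_hat_iff[OF W_L2[OF f] z] by simp
  then have "AE r in F. V f r = 0"
    unfolding AE_F by (rule AE_mp, intro AE_I2) (auto simp: hat_W, simp add: hat_def)
  then show ?thesis by (rule control.V_injective[OF f])
qed

text \<open>Existence of the adjoint already shows that \<open>W\<close> maps null functions to null functions: if \<open>d = 0\<close>
  almost everywhere, then \<open>(W d, W d)\<close> is an inner product with \<open>d\<close>.\<close>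

lemma W_cong_AE:
  assumes f: "f \<in> L2 F" and g: "g \<in> L2 F" and eq: "AE t in F. f t = g t"
  shows "AE x in H. W f x = W g x"
proof -
  let ?d = "\<lambda>t. f t - g t"
  have d: "?d \<in> L2 F" by (rule L2_diff[OF f g])
  have Wd: "W ?d \<in> L2 H" by (rule W_L2[OF d])
  obtain b where b: "b \<in> L2 F" "\<forall>f\<in>L2 F. L2_inner H (W f) (W ?d) = L2_inner F f b"
    using W_adjoint_exists[OF Wd] by blast
  have "L2_inner F ?d b = 0"
    unfolding L2_inner_def
  proof (rule integral_eq_zero_AE)
    show "AE x in F. (f x - g x) * b x = 0" using eq by eventually_elim simp
  qed
  then have "L2_inner H (W ?d) (W ?d) = 0" using b d by simp
  from L2_inner_self_zero[OF Wd this] have "AE x in H. W ?d x = 0" .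
  moreover have "AE x in H. W ?d x = W f x - W g x"
    by (rule AE_I2) (simp add: space_H W_diff[OF f g])
  ultimately show ?thesis by eventually_elim simp
qed

lemma W_onto_continuous:
  assumes y: "continuous_on {0..X} y"
  shows "\<exists>f\<in>L2 F. \<forall>x\<in>{0<..<X}. W f x = y x"
proof -
  have "continuous_on {0..T} (hat y)"
    unfolding hat_def
    by (intro continuous_on_mult rho_xh_powr_cont continuous_on_compose2[OF y xh_cont]) (use xh_range in auto)
  from control.V_solvable[OF this] obtain f where f: "continuous_on {0..T} f" "\<forall>r\<in>{0..T}. V f r = hat y r" by blast
  have "W f x = y x" if x: "x \<in> {0<..<X}" for x
  proof -
    have "V f (T - \<tau> x) = hat y (T - \<tau> x)" using f(2) T_minus_tau_mem[OF x] by auto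
    also have "\<dots> = \<rho> x powr (1/4) * y x" using x by (simp add: hat_def xh_tau)
    finally show ?thesis
      using W_tau[OF x, of f] rho_pos[of x] x by (simp add: powr_minus field_simps)
  qed
  then show ?thesis using continuous_L2_F[OF f(1)] by blast
qed

lemma C_op_adjoint:
  assumes g: "g \<in> L2 F"
  shows "C_op \<rho> w T g \<in> L2 F" "f \<in> L2 F \<Longrightarrow> L2_inner H (W f) (W g) = L2_inner F f (C_op \<rho> w T g)"
proof -
  obtain b where "b \<in> L2 F" "\<forall>f\<in>L2 F. L2_inner H (W f) (W g) = L2_inner F f b"
    using W_adjoint_exists[OF W_L2[OF g]] by blast
  then have "adj_rel F H (L2 F) W (W g) b" using W_L2[OF g] by (simp add: adj_rel_def)
  then have "adj_rel F H (L2 F) W (W g) (C_op \<rho> w T g)"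
    unfolding C_op_def adj_op_def by (rule someI[where P = "adj_rel F H (L2 F) W (W g)"])
  then show "C_op \<rho> w T g \<in> L2 F" "f \<in> L2 F \<Longrightarrow> L2_inner H (W f) (W g) = L2_inner F f (C_op \<rho> w T g)"
    by (simp_all add: adj_rel_def)
qed

text \<open>The first equivalence is injectivity of \<open>W\<close>. For the second, totality of smooth controls extends
  the duality relation to all controls, so that \<open>C g - b\<close> represents the functional
  \<open>h \<mapsto> (W h, W g - y)\<close>; it is evaluated at \<open>h = g - f\<close> and at \<open>h = C g - b\<close>.\<close>

lemma connecting_equation:
  assumes y: "y \<in> L2 H" and f: "f \<in> L2 F" and Wf: "\<forall>x\<in>{0<..<X}. W f x = y x" and b: "b \<in> L2 F"
    and dual: "\<And>h :: real \<Rightarrow> real. smooth_on {0..} h \<Longrightarrow> (\<exists>\<epsilon>>0. \<forall>t\<in>{0..<\<epsilon>}. h t = 0) \<Longrightarrow> L2_inner H (W h) y = L2_inner F h b"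
    and g: "g \<in> L2 F"
  shows "(AE x in H. W g x = y x) \<longleftrightarrow> (AE t in F. g t = f t)"
    and "(AE t in F. C_op \<rho> w T g t = b t) \<longleftrightarrow> (AE t in F. g t = f t)"
proof -
  let ?d = "\<lambda>t. g t - f t"
  have d: "?d \<in> L2 F" by (rule L2_diff[OF g f])
  have Wd: "W ?d x = W g x - y x" if "x \<in> {0<..<X}" for x
    using W_diff[OF g f that] Wf that by simp
  show W_iff: "(AE x in H. W g x = y x) \<longleftrightarrow> (AE t in F. g t = f t)"
  proof
    assume "AE x in H. W g x = y x"
    then have "AE x in H. W ?d x = 0"
      by (rule AE_mp, intro AE_I2 impI) (simp add: space_H Wd)
    from W_injective[OF d this] show "AE t in F. g t = f t" by simp
  next
    assume "AE t in F. g t = f t"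
    from W_cong_AE[OF g f this] show "AE x in H. W g x = y x"
      by (rule AE_mp, intro AE_I2 impI) (use Wf in \<open>simp add: space_H\<close>)
  qed
  obtain b0 where b0: "b0 \<in> L2 F" "\<forall>h\<in>L2 F. L2_inner H (W h) y = L2_inner F h b0"
    using W_adjoint_exists[OF y] by blast
  have "AE t in F. b0 t - b t = 0"
  proof (rule smooth_controls_total[OF L2_diff[OF b0(1) b]])
    fix h :: "real \<Rightarrow> real" assume h: "smooth_on {0..} h" "\<exists>\<epsilon>>0. \<forall>t\<in>{0..<\<epsilon>}. h t = (0 :: real)"
    have hL: "h \<in> L2 F"
      by (intro continuous_L2_F continuous_on_subset[OF smooth_on_imp_continuous_on[OF h(1)]]) auto
    then show "L2_inner F h (\<lambda>t. b0 t - b t) = 0"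
      using dual[OF h] b0(2) by (simp add: L2_inner_diff_right[OF b0(1) b])
  qed
  then have bb: "AE t in F. b0 t = b t" by simp
  have dual': "L2_inner H (W h) y = L2_inner F h b" if h: "h \<in> L2 F" for h
    using L2_inner_cong_AE[OF b0(1) b h bb] b0(2) h by (simp add: L2_inner_commute)
  let ?c = "C_op \<rho> w T g"
  note c = C_op_adjoint[OF g]
  have key: "L2_inner H (W h) (\<lambda>x. W g x - y x) = L2_inner F h (\<lambda>t. ?c t - b t)" if h: "h \<in> L2 F" for h
    using c(2)[OF h] dual'[OF h]
    by (simp add: L2_inner_diff_right[OF W_L2[OF g] y W_L2[OF h]] L2_inner_diff_right[OF c(1) b h])
  have Wgy: "(\<lambda>x. W g x - y x) \<in> L2 H" by (rule L2_diff[OF W_L2[OF g] y])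
  have cb: "(\<lambda>t. ?c t - b t) \<in> L2 F" by (rule L2_diff[OF c(1) b])
  have "(AE t in F. ?c t = b t) \<longleftrightarrow> (AE x in H. W g x = y x)"
  proof
    assume eq: "AE t in F. ?c t = b t"
    have "L2_inner F ?d (\<lambda>t. ?c t - b t) = 0"
      unfolding L2_inner_def
    proof (rule integral_eq_zero_AE)
      show "AE t in F. (g t - f t) * (?c t - b t) = 0" using eq by eventually_elim simp
    qed
    then have "L2_inner H (W ?d) (\<lambda>x. W g x - y x) = 0" using key[OF d] by simp
    moreover have "L2_inner H (W ?d) (\<lambda>x. W g x - y x) = L2_inner H (\<lambda>x. W g x - y x) (\<lambda>x. W g x - y x)"
      unfolding L2_inner_def by (rule Bochner_Integration.integral_cong) (simp_all add: space_H Wd)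
    ultimately have "AE x in H. W g x - y x = 0" using L2_inner_self_zero[OF Wgy] by simp
    then show "AE x in H. W g x = y x" by simp
  next
    assume eq: "AE x in H. W g x = y x"
    have "L2_inner H (W (\<lambda>t. ?c t - b t)) (\<lambda>x. W g x - y x) = 0"
      unfolding L2_inner_def
    proof (rule integral_eq_zero_AE)
      show "AE x in H. W (\<lambda>t. ?c t - b t) x * (W g x - y x) = 0" using eq by eventually_elim simp
    qed
    then have "L2_inner F (\<lambda>t. ?c t - b t) (\<lambda>t. ?c t - b t) = 0" using key[OF cb] by simp
    from L2_inner_self_zero[OF cb this] show "AE t in F. ?c t = b t" by simp
  qed
  then show "(AE t in F. ?c t = b t) \<longleftrightarrow> (AE t in F. g t = f t)" using W_iff by simp
qed

end

section \<open>The response operator and its adjoint\<close>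

text \<open>A pointwise limit over a continuous parameter, with a fixed value \<open>c\<close> where the limit does not
  exist. Since \<open>D\<close> is continuous in the parameter, Cauchy's criterion may be tested on rational
  parameters only, so convergence takes place on a measurable set; on it a sequence computes the limit.\<close>

lemma measurable_right_limit:
  fixes D :: "real \<Rightarrow> 'a \<Rightarrow> real"
  assumes meas: "\<And>x. x > 0 \<Longrightarrow> D x \<in> borel_measurable M"
    and cont: "\<And>\<omega>. \<omega> \<in> space M \<Longrightarrow> continuous_on {0<..} (\<lambda>x. D x \<omega>)"
    and lim: "\<And>\<omega> l. \<omega> \<in> space M \<Longrightarrow> ((\<lambda>x. D x \<omega>) \<longlongrightarrow> l) (at_right 0) \<Longrightarrow> R \<omega> = l"
    and no_lim: "\<And>\<omega>. \<omega> \<in> space M \<Longrightarrow> \<nexists>l. ((\<lambda>x. D x \<omega>) \<longlongrightarrow> l) (at_right 0) \<Longrightarrow> R \<omega> = c"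
  shows "R \<in> borel_measurable M"
proof -
  define P where "P \<omega> \<longleftrightarrow> (\<forall>n::nat. \<exists>m::nat. \<forall>p q::rat. 0 < p \<longrightarrow> p < inverse (of_nat (Suc m)) \<longrightarrow>
      0 < q \<longrightarrow> q < inverse (of_nat (Suc m)) \<longrightarrow>
      \<bar>D (of_rat p) \<omega> - D (of_rat q) \<omega>\<bar> \<le> inverse (real (Suc n)))" for \<omega>
  have inv_rat: "of_rat p < inverse (real (Suc m)) \<longleftrightarrow> p < inverse (of_nat (Suc m))" for p m
    using of_rat_less[of p "inverse (of_nat (Suc m))", where 'a = real] by (simp add: of_rat_inverse of_rat_add)
  have seq: "(\<lambda>k. inverse (real (Suc k))) \<longlonglongrightarrow> 0" by (rule LIMSEQ_inverse_real_of_nat)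
  have seq_right: "filterlim (\<lambda>k. inverse (real (Suc k))) (at_right 0) sequentially"
    using seq by (simp add: filterlim_at)
  have P_iff: "P \<omega> \<longleftrightarrow> (\<exists>l. ((\<lambda>x. D x \<omega>) \<longlongrightarrow> l) (at_right 0))" if \<omega>: "\<omega> \<in> space M" for \<omega>
  proof
    assume "\<exists>l. ((\<lambda>x. D x \<omega>) \<longlongrightarrow> l) (at_right 0)"
    then obtain l where l: "((\<lambda>x. D x \<omega>) \<longlongrightarrow> l) (at_right 0)" by blast
    show "P \<omega>" unfolding P_def
    proof
      fix n
      have "\<forall>\<^sub>F x in at_right 0. dist (D x \<omega>) l < inverse (real (Suc n)) / 2"
        using l by (rule tendstoD) simp
      then obtain b where b: "b > 0" "\<And>x. 0 < x \<Longrightarrow> x < b \<Longrightarrow> dist (D x \<omega>) l < inverse (real (Suc n)) / 2"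
        unfolding eventually_at_right_field by auto
      obtain m where m: "inverse (real (Suc m)) < b" using reals_Archimedean[OF b(1)] by blast
      show "\<exists>m::nat. \<forall>p q::rat. 0 < p \<longrightarrow> p < inverse (of_nat (Suc m)) \<longrightarrow> 0 < q \<longrightarrow> q < inverse (of_nat (Suc m)) \<longrightarrow>
          \<bar>D (of_rat p) \<omega> - D (of_rat q) \<omega>\<bar> \<le> inverse (real (Suc n))"
      proof (intro exI[of _ m] allI impI)
        fix p q :: rat
        assume "0 < p" "p < inverse (of_nat (Suc m))" "0 < q" "q < inverse (of_nat (Suc m))"
        then have "0 < real_of_rat p" "real_of_rat p < b" "0 < real_of_rat q" "real_of_rat q < b"
          using inv_rat[of p m] inv_rat[of q m] m by (auto simp del: of_nat_Suc)
        then have "dist (D (of_rat p) \<omega>) l < inverse (real (Suc n)) / 2" "dist (D (of_rat q) \<omega>) l < inverse (real (Suc n)) / 2"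
          using b(2) by blast+
        then show "\<bar>D (of_rat p) \<omega> - D (of_rat q) \<omega>\<bar> \<le> inverse (real (Suc n))"
          unfolding dist_real_def by linarith
      qed
    qed
  next
    assume P: "P \<omega>"
    let ?d = "\<lambda>k. D (inverse (real (Suc k))) \<omega>"
    have cauchy: "\<exists>m. \<forall>x k. 0 < x \<longrightarrow> x < inverse (real (Suc m)) \<longrightarrow> k \<ge> Suc m \<longrightarrow>
        \<bar>D x \<omega> - ?d k\<bar> \<le> inverse (real (Suc n))" for n
    proof -
      let ?e = "inverse (real (Suc n))"
      obtain m where m: "\<And>p q::rat. 0 < p \<Longrightarrow> p < inverse (of_nat (Suc m)) \<Longrightarrow> 0 < q \<Longrightarrow> q < inverse (of_nat (Suc m)) \<Longrightarrow>
          \<bar>D (of_rat p) \<omega> - D (of_rat q) \<omega>\<bar> \<le> ?e"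
        using P unfolding P_def by blast
      have "\<bar>D x \<omega> - ?d k\<bar> \<le> ?e" if x: "0 < x" "x < inverse (real (Suc m))" and k: "k \<ge> Suc m" for x k
      proof (rule ccontr)
        let ?q = "inverse (of_nat (Suc k)) :: rat"
        have q: "0 < ?q" "?q < inverse (of_nat (Suc m))" using k by simp_all
        have dq: "?d k = D (of_rat ?q) \<omega>" by (simp add: of_rat_inverse of_rat_add)
        assume "\<not> ?thesis"
        then have gt: "?e < \<bar>D x \<omega> - ?d k\<bar>" by simp
        have "((\<lambda>z. D z \<omega>) \<longlongrightarrow> D x \<omega>) (at_right x)"
        proof -
          have "isCont (\<lambda>z. D z \<omega>) x"
            using cont[OF \<omega>] x(1) by (simp add: continuous_on_eq_continuous_at)
          then show ?thesis by (simp add: isCont_def filterlim_at_split)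
        qed
        then have "((\<lambda>z. \<bar>D z \<omega> - ?d k\<bar>) \<longlongrightarrow> \<bar>D x \<omega> - ?d k\<bar>) (at_right x)"
          by (intro tendsto_intros)
        from order_tendstoD(1)[OF this gt]
        obtain b where b: "x < b" "\<And>z. x < z \<Longrightarrow> z < b \<Longrightarrow> ?e < \<bar>D z \<omega> - ?d k\<bar>"
          unfolding eventually_at_right_field by auto
        obtain p where p: "x < real_of_rat p" "real_of_rat p < min b (inverse (real (Suc m)))"
          using of_rat_dense[of x "min b (inverse (real (Suc m)))"] b(1) x(2) by auto
        have "0 < real_of_rat p" "p < inverse (of_nat (Suc m))"
          using p x(1) inv_rat[of p m] by (linarith, simp)
        then have "\<bar>D (of_rat p) \<omega> - ?d k\<bar> \<le> ?e"
          unfolding dq zero_less_of_rat_iff by (intro m q)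
        then show False using b(2)[of "real_of_rat p"] p by linarith
      qed
      then show ?thesis by blast
    qed
    have "Cauchy ?d"
    proof (rule metric_CauchyI)
      fix e :: real assume "e > 0"
      then obtain n where n: "inverse (real (Suc n)) < e" using reals_Archimedean by blast
      obtain m where m: "\<And>x k. 0 < x \<Longrightarrow> x < inverse (real (Suc m)) \<Longrightarrow> k \<ge> Suc m \<Longrightarrow>
        \<bar>D x \<omega> - ?d k\<bar> \<le> inverse (real (Suc n))" using cauchy[of n] by blast
      have "dist (?d i) (?d j) < e" if "i \<ge> Suc m" "j \<ge> Suc m" for i j
        using m[of "inverse (real (Suc i))" j] n that unfolding dist_real_def by simp
      then show "\<exists>M. \<forall>m\<ge>M. \<forall>n\<ge>M. dist (?d m) (?d n) < e" by blast
    qed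
    then obtain l where l: "?d \<longlonglongrightarrow> l"
      using Cauchy_convergent_iff convergent_def by blast
    have "((\<lambda>x. D x \<omega>) \<longlongrightarrow> l) (at_right 0)"
    proof (rule tendstoI)
      fix e :: real assume "e > 0"
      then obtain n where n: "inverse (real (Suc n)) < e" using reals_Archimedean by blast
      obtain m where m: "\<And>x k. 0 < x \<Longrightarrow> x < inverse (real (Suc m)) \<Longrightarrow> k \<ge> Suc m \<Longrightarrow>
        \<bar>D x \<omega> - ?d k\<bar> \<le> inverse (real (Suc n))" using cauchy[of n] by blast
      have "dist (D x \<omega>) l < e" if x: "0 < x" "x < inverse (real (Suc m))" for x
      proof -
        have "(\<lambda>k. \<bar>D x \<omega> - ?d k\<bar>) \<longlonglongrightarrow> \<bar>D x \<omega> - l\<bar>" by (intro tendsto_intros l)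
        then have "\<bar>D x \<omega> - l\<bar> \<le> inverse (real (Suc n))"
          by (rule LIMSEQ_le_const2) (use m[OF x] in blast)
        then show ?thesis using n by (simp add: dist_real_def)
      qed
      moreover have "0 < inverse (real (Suc m))" by simp
      ultimately show "\<forall>\<^sub>F x in at_right 0. dist (D x \<omega>) l < e"
        unfolding eventually_at_right_field by blast
    qed
    then show "\<exists>l. ((\<lambda>x. D x \<omega>) \<longlongrightarrow> l) (at_right 0)" by blast
  qed
  \<comment> \<open>Measurability of \<open>D x\<close> is known for positive \<open>x\<close> only, while the quantifiers range over all rationals.\<close>
  define D' where "D' x = (if x > 0 then D x else (\<lambda>_. 0))" for x
  have [measurable]: "D' x \<in> borel_measurable M" for x using meas by (auto simp: D'_def)
  have P': "P \<omega> \<longleftrightarrow> (\<forall>n::nat. \<exists>m::nat. \<forall>p q::rat. 0 < p \<longrightarrow> p < inverse (of_nat (Suc m)) \<longrightarrow>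
      0 < q \<longrightarrow> q < inverse (of_nat (Suc m)) \<longrightarrow>
      \<bar>D' (of_rat p) \<omega> - D' (of_rat q) \<omega>\<bar> \<le> inverse (real (Suc n)))" for \<omega>
    unfolding P_def D'_def by (simp cong: imp_cong)
  have [measurable]: "Measurable.pred M P" unfolding P' by measurable
  have "(\<lambda>\<omega>. if P \<omega> then lim (\<lambda>k. D' (inverse (real (Suc k))) \<omega>) else c) \<in> borel_measurable M" by measurable
  moreover have "R \<omega> = (if P \<omega> then lim (\<lambda>k. D' (inverse (real (Suc k))) \<omega>) else c)" if \<omega>: "\<omega> \<in> space M" for \<omega>
  proof (cases "P \<omega>")
    case True
    then obtain l where l: "((\<lambda>x. D x \<omega>) \<longlongrightarrow> l) (at_right 0)" using P_iff[OF \<omega>] by blast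
    have "(\<lambda>k. D' (inverse (real (Suc k))) \<omega>) \<longlonglongrightarrow> l"
      using filterlim_compose[OF l seq_right] by (simp add: D'_def)
    then show ?thesis using lim[OF \<omega> l] True by (simp add: limI)
  next
    case False
    then show ?thesis using no_lim[OF \<omega>] P_iff[OF \<omega>] by simp
  qed
  ultimately show ?thesis by (subst measurable_cong) auto
qed

context string_fundamental
begin

text \<open>Both terms are written with \<open>max 0 (t - \<tau>(x))\<close> and the integral is rescaled to \<open>[0, 1]\<close>, so that one
  formula, whose integrand evaluates \<open>w\<close> on the wedge only, holds before and after the arrival of the
  front. The hypothesis \<open>f(0) = 0\<close> makes the extension of \<open>f\<close> by zero continuous.\<close>

lemma u_sol_continuous:
  assumes f: "continuous_on {0..T} f" and f0: "f 0 = 0"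
  shows "continuous_on ({0..} \<times> {0..T}) (\<lambda>(x, t). u_sol \<rho> w f x t)"
proof -
  let ?Q = "{0..} \<times> {0..T} :: (real \<times> real) set"
  define fe where "fe s = f (cl T s)" for s
  have fe_cont: "continuous_on S fe" for S
  proof -
    have "continuous_on S (cl T)" unfolding cl_def by (intro continuous_intros)
    then show ?thesis unfolding fe_def
      by (rule continuous_on_compose2[OF f]) (use T cl_range in auto)
  qed
  have fe_eq: "ext0 f s = fe s" if "s \<le> T" for s
    using that T f0 by (auto simp: ext0_def fe_def cl_def)
  define d where "d p = max 0 (snd p - \<tau> (fst p))" for p :: "real \<times> real"
  have tau_c: "continuous_on (?Q \<times> S) (\<lambda>p. \<tau> (fst (fst p)))" for S :: "real set"
    by (rule continuous_on_compose2[OF tau_cont]) (auto intro!: continuous_intros)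
  have tau_c': "continuous_on ?Q (\<lambda>p. \<tau> (fst p))"
    by (rule continuous_on_compose2[OF tau_cont]) (auto intro!: continuous_intros)
  have d_c: "continuous_on ?Q d" unfolding d_def by (intro continuous_intros tau_c')
  define G where "G p \<sigma> = w (fst p) (\<tau> (fst p) + d p - d p * \<sigma>) * fe (d p * \<sigma>)" for p \<sigma>
  have G_c: "continuous_on (?Q \<times> cbox 0 1) (\<lambda>(p, \<sigma>). G p \<sigma>)"
  proof -
    have dd: "continuous_on (?Q \<times> cbox 0 (1::real)) (\<lambda>z. d (fst z))"
      by (rule continuous_on_compose2[OF d_c continuous_on_fst[OF continuous_on_id]]) auto
    have 1: "continuous_on (?Q \<times> cbox 0 1) (\<lambda>z. (fst (fst z), \<tau> (fst (fst z)) + d (fst z) - d (fst z) * snd z))"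
      by (intro continuous_intros tau_c dd)
    have "d p * \<sigma> \<le> d p" if "\<sigma> \<le> 1" for p \<sigma>
      using mult_left_mono[OF that, of "d p"] by (simp add: d_def)
    then have mem: "(fst (fst z), \<tau> (fst (fst z)) + d (fst z) - d (fst z) * snd z) \<in> wedge" if "z \<in> ?Q \<times> cbox 0 1" for z
      using that by (auto simp: mem_Times_iff)
    have "continuous_on (?Q \<times> cbox 0 1)
       (\<lambda>z. case (fst (fst z), \<tau> (fst (fst z)) + d (fst z) - d (fst z) * snd z) of (x, t) \<Rightarrow> w x t)"
      by (rule continuous_on_compose2[OF w_cont 1]) (use mem in blast)
    moreover have "continuous_on (?Q \<times> cbox 0 1) (\<lambda>z. fe (d (fst z) * snd z))"
      by (rule continuous_on_compose2[OF fe_cont[of UNIV]]) (auto intro!: continuous_intros dd[unfolded box_real])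
    ultimately show ?thesis unfolding G_def case_prod_unfold fst_conv snd_conv by (rule continuous_on_mult)
  qed
  have int: "(LBINT s:{0<..<t - \<tau> x}. w x (t - s) * f s) = d (x, t) * integral {0..1} (G (x, t))"
    if xt: "x \<ge> 0" "t \<in> {0..T}" for x t
  proof (cases "t \<le> \<tau> x")
    case True
    then show ?thesis by (simp add: d_def set_lebesgue_integral_def)
  next
    case False
    then have dx: "d (x, t) = t - \<tau> x" "0 \<le> t - \<tau> x" by (simp_all add: d_def)
    have le: "t - \<tau> x \<le> T" using xt tau_nonneg[of x] by auto
    have c: "continuous_on {0..t - \<tau> x} (\<lambda>s. w x (t - s) * f s)"
    proof (intro continuous_on_mult continuous_on_subset[OF f])
      have "continuous_on {0..t - \<tau> x} (\<lambda>s. case (x, t - s) of (x, t) \<Rightarrow> w x t)"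
        by (rule continuous_on_compose2[OF w_cont]) (use xt in \<open>auto intro!: continuous_intros\<close>)
      then show "continuous_on {0..t - \<tau> x} (\<lambda>s. w x (t - s))" by simp
    qed (use le in auto)
    have "(LBINT s:{0<..<t - \<tau> x}. w x (t - s) * f s)
        = (t - \<tau> x) * integral {0..1} (\<lambda>\<sigma>. w x (t - (t - \<tau> x) * \<sigma>) * f ((t - \<tau> x) * \<sigma>))"
      using continuous_integral_F(2)[OF c] integral_rescale[OF dx(2) c] by simp
    also have "integral {0..1} (\<lambda>\<sigma>. w x (t - (t - \<tau> x) * \<sigma>) * f ((t - \<tau> x) * \<sigma>)) = integral {0..1} (G (x, t))"
    proof (rule integral_cong)
      fix \<sigma> :: real assume \<sigma>: "\<sigma> \<in> {0..1}"
      have "(t - \<tau> x) * \<sigma> \<le> t - \<tau> x" "0 \<le> (t - \<tau> x) * \<sigma>"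
        using \<sigma> dx(2) mult_left_mono[of \<sigma> 1 "t - \<tau> x"] by auto
      then have "cl T ((t - \<tau> x) * \<sigma>) = (t - \<tau> x) * \<sigma>" using le by (intro cl_id) auto
      then show "w x (t - (t - \<tau> x) * \<sigma>) * f ((t - \<tau> x) * \<sigma>) = G (x, t) \<sigma>"
        by (simp add: G_def dx(1) fe_def)
    qed
    finally show ?thesis by (simp add: dx(1))
  qed
  have "continuous_on ?Q (\<lambda>p. (\<rho> (fst p) / \<rho> 0) powr (- 1 / 4) * fe (snd p - \<tau> (fst p))
      + d p * integral (cbox 0 1) (G p))"
  proof (intro continuous_on_add continuous_on_mult d_c integral_continuous_on_param[OF G_c])
    have rc: "continuous_on ?Q (\<lambda>p. \<rho> (fst p))"
      by (rule continuous_on_compose2[OF rho_cont]) (auto intro!: continuous_intros)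
    have nz: "\<rho> x \<noteq> 0" if "x \<ge> 0" for x using rho_pos[OF that] by simp
    show "continuous_on ?Q (\<lambda>p. (\<rho> (fst p) / \<rho> 0) powr (- 1 / 4))"
      by (intro continuous_on_powr continuous_on_divide rc continuous_on_const) (auto simp: nz)
    show "continuous_on ?Q (\<lambda>p. fe (snd p - \<tau> (fst p)))"
      by (rule continuous_on_compose2[OF fe_cont[of UNIV]]) (auto intro!: continuous_intros tau_c')
  qed
  then show ?thesis
  proof (rule continuous_on_eq)
    fix p assume p: "p \<in> ?Q"
    then have "snd p - \<tau> (fst p) \<le> T" using tau_nonneg[of "fst p"] by (auto simp: mem_Times_iff)
    then show "(\<rho> (fst p) / \<rho> 0) powr (- 1 / 4) * fe (snd p - \<tau> (fst p)) + d p * integral (cbox 0 1) (G p)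
        = (case p of (x, t) \<Rightarrow> u_sol \<rho> w f x t)"
      using p int[of "fst p" "snd p"] by (simp add: u_sol_def case_prod_unfold fe_eq mem_Times_iff)
  qed
qed

text \<open>Split \<open>w(x,\<cdot>) = w(0,\<cdot>) + (w(x,\<cdot>) - w(0,\<cdot>))\<close>. The first part depends on \<open>x\<close> only through the
  limit of integration and yields the boundary term. The difference quotients of the second part
  converge pointwise to \<open>w\<^sub>x(0,\<cdot>)\<close> and are dominated by a bound for \<open>w\<^sub>x\<close>.\<close>

lemma convolution_derivative:
  assumes wx_cont: "continuous_on wedge (\<lambda>(x, t). wx x t)"
    and wx: "\<And>x t. (x, t) \<in> wedge \<Longrightarrow> ((\<lambda>z. w z t) has_real_derivative wx x t) (at x within {z. (z, t) \<in> wedge})"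
    and t: "t \<in> {0<..<T}" and f: "continuous_on {0..T} f"
  shows "((\<lambda>x. LBINT s:{0<..<t - \<tau> x}. w x (t - s) * f s) has_real_derivative
      (LBINT s:{0<..<t}. wx 0 (t - s) * f s) - sqrt (\<rho> 0) * w 0 0 * f t) (at 0 within {0..})"
proof -
  define x1 where "x1 = xinv \<rho> t"
  have x1: "x1 > 0" "\<tau> x1 = t" using t xinv_less_iff[of 0 t] by (simp_all add: x1_def tau_xinv)
  have taux: "0 \<le> \<tau> x \<and> \<tau> x \<le> t" if "x \<in> {0..x1}" for x
    using that tau_le_iff[of x x1] x1 tau_nonneg[of x] by auto
  have fc: "continuous_on {0..b} f" if "b \<le> t" for b
    by (rule continuous_on_subset[OF f]) (use that t in auto)
  have wc: "continuous_on {0..t - \<tau> x} (\<lambda>s. w z (t - s))" if "0 \<le> z" "z \<le> x" for x z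
  proof -
    have "\<tau> z \<le> \<tau> x" using that tau_le_iff by simp
    then have "continuous_on {0..t - \<tau> x} (\<lambda>s. case (z, t - s) of (x, t) \<Rightarrow> w x t)"
      by (intro continuous_on_compose2[OF w_cont]) (use that in \<open>auto intro!: continuous_intros\<close>)
    then show ?thesis by simp
  qed
  define \<phi> where "\<phi> s = w 0 (t - s) * f s" for s
  define J1 where "J1 x = (LBINT s:{0<..<t - \<tau> x}. \<phi> s)" for x
  define J2 where "J2 x = (LBINT s:{0<..<t - \<tau> x}. (w x (t - s) - w 0 (t - s)) * f s)" for x
  have \<phi>_c: "continuous_on {0..t} \<phi>"
    unfolding \<phi>_def using wc[of 0 0] fc[of t] by (intro continuous_on_mult) simp_all
  have J12: "(LBINT s:{0<..<t - \<tau> x}. w x (t - s) * f s) = J1 x + J2 x" if x: "x \<in> {0..x1}" for x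
  proof -
    have c: "continuous_on {0..t - \<tau> x} \<phi>"
      by (rule continuous_on_subset[OF \<phi>_c]) (use taux[OF x] in auto)
    have c2: "continuous_on {0..t - \<tau> x} (\<lambda>s. (w x (t - s) - w 0 (t - s)) * f s)"
      using x taux[OF x] by (intro continuous_on_mult continuous_on_diff wc fc) auto
    have "J1 x + J2 x = (LBINT s:{0<..<t - \<tau> x}. \<phi> s + (w x (t - s) - w 0 (t - s)) * f s)"
      unfolding J1_def J2_def
      by (rule set_integral_add(2)[symmetric]) (intro continuous_integral_F(1) c c2)+
    also have "\<dots> = (LBINT s:{0<..<t - \<tau> x}. w x (t - s) * f s)"
      unfolding set_lebesgue_integral_def
      by (intro Bochner_Integration.integral_cong) (auto simp: \<phi>_def left_diff_distrib)
    finally show ?thesis by simp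
  qed
  have J1': "(J1 has_real_derivative - sqrt (\<rho> 0) * w 0 0 * f t) (at 0 within {0..x1})"
  proof -
    have "((\<lambda>y. integral {0..y} \<phi>) has_real_derivative \<phi> t) (at t within {0..t})"
      by (rule integral_has_real_derivative[OF \<phi>_c]) (use t in auto)
    then have "((\<lambda>y. integral {0..y} \<phi>) has_real_derivative \<phi> t)
        (at (t - \<tau> 0) within (\<lambda>x. t - \<tau> x) ` {0..x1})"
      using taux by (simp, elim DERIV_subset) auto
    moreover have "((\<lambda>x. t - \<tau> x) has_real_derivative 0 - sqrt (\<rho> 0)) (at 0 within {0..x1})"
      by (rule DERIV_diff[OF DERIV_const DERIV_subset[OF tau_deriv]]) auto
    ultimately have "((\<lambda>y. integral {0..y} \<phi>) \<circ> (\<lambda>x. t - \<tau> x) has_real_derivative \<phi> t * (0 - sqrt (\<rho> 0)))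
        (at 0 within {0..x1})"
      by (rule DERIV_image_chain)
    note chain = this
    have J1_eq: "((\<lambda>y. integral {0..y} \<phi>) \<circ> (\<lambda>x. t - \<tau> x)) x = J1 x" if "x \<in> {0..x1}" for x
      unfolding J1_def o_def
      by (rule continuous_integral_F(2)[symmetric], rule continuous_on_subset[OF \<phi>_c]) (use taux[OF that] in auto)
    have "(J1 has_real_derivative \<phi> t * (0 - sqrt (\<rho> 0))) (at 0 within {0..x1})"
      by (rule has_field_derivative_transform_within[OF chain zero_less_one _ J1_eq]) (use x1 in simp_all)
    then show ?thesis by (simp add: \<phi>_def mult.commute mult.left_commute)
  qed
  obtain M where M: "\<And>x s. x \<in> {0..x1} \<Longrightarrow> \<tau> x \<le> s \<Longrightarrow> s \<le> t \<Longrightarrow> \<bar>wx x s\<bar> \<le> M"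
  proof -
    let ?B = "{0..x1} \<times> {0..t}"
    have "continuous_on ?B (\<lambda>p. \<tau> (fst p))"
      by (rule continuous_on_compose2[OF tau_cont continuous_on_fst[OF continuous_on_id]]) auto
    then have c: "continuous_on ?B (\<lambda>p. (fst p, max (\<tau> (fst p)) (snd p)))"
      by (intro continuous_intros)
    have "continuous_on ?B (\<lambda>p. case (fst p, max (\<tau> (fst p)) (snd p)) of (x, t) \<Rightarrow> wx x t)"
      by (rule continuous_on_compose2[OF wx_cont c]) auto
    then have "bounded ((\<lambda>p. wx (fst p) (max (\<tau> (fst p)) (snd p))) ` ?B)"
      by (intro compact_imp_bounded compact_continuous_image compact_Times compact_Icc) simp
    then obtain M where M: "\<forall>p\<in>?B. \<bar>wx (fst p) (max (\<tau> (fst p)) (snd p))\<bar> \<le> M"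
      by (auto simp: bounded_iff)
    show ?thesis
    proof (rule that[of M])
      fix x s assume "x \<in> {0..x1}" "\<tau> x \<le> s" "s \<le> t"
      then show "\<bar>wx x s\<bar> \<le> M" using bspec[OF M, of "(x, s)"] taux[of x] by (simp add: max_absorb2)
    qed
  qed
  have increment: "\<bar>w x s - w 0 s\<bar> \<le> M * x" if x: "x \<in> {0..x1}" and s: "\<tau> x \<le> s" "s \<le> t" for x s
  proof -
    have "\<tau> z \<le> s" if "z \<in> {0..x}" for z
      using that s(1) tau_le_iff[of z x] by auto
    then have sub: "{0..x} \<subseteq> {z. (z, s) \<in> wedge}" by auto
    have "norm (w x s - w 0 s) \<le> M * norm (x - 0)"
    proof (rule field_differentiable_bound[of "{0..x}" "\<lambda>z. w z s" "\<lambda>z. wx z s"])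
      fix z assume z: "z \<in> {0..x}"
      show "((\<lambda>z. w z s) has_real_derivative wx z s) (at z within {0..x})"
        by (rule DERIV_subset[OF wx sub]) (use z sub in auto)
      have "\<tau> z \<le> s" using z sub by auto
      then show "norm (wx z s) \<le> M" using M[of z s] z x s by auto
    qed (use x in auto)
    then show ?thesis using x by simp
  qed
  have J2': "(J2 has_real_derivative (LBINT s:{0<..<t}. wx 0 (t - s) * f s)) (at 0 within {0..x1})"
    unfolding has_field_derivative_iff tendsto_at_iff_sequentially
  proof (intro allI impI)
    fix xs :: "nat \<Rightarrow> real" assume xs: "\<forall>i. xs i \<in> {0..x1} - {0}" and lim: "xs \<longlonglongrightarrow> 0"
    have xs': "xs n \<in> {0..x1}" "xs n > 0" for n using xs[rule_format, of n] by auto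
    have xs_nz: "xs n \<noteq> 0" for n using xs'(2)[of n] by simp
    have J20: "J2 0 = 0" by (simp add: J2_def set_lebesgue_integral_def)
    let ?h = "\<lambda>n s. indicator {0<..<t - \<tau> (xs n)} s * ((w (xs n) (t - s) - w 0 (t - s)) * f s) / xs n"
    have quot: "((\<lambda>y. (J2 y - J2 0) / (y - 0)) \<circ> xs) n = (\<integral>s. ?h n s \<partial>lborel)" for n
      by (simp add: J20 J2_def set_lebesgue_integral_def)
    have "(\<lambda>n. \<integral>s. ?h n s \<partial>lborel) \<longlonglongrightarrow> (\<integral>s. indicator {0<..<t} s * (wx 0 (t - s) * f s) \<partial>lborel)"
    proof (rule integral_dominated_convergence[where w = "\<lambda>s. indicator {0<..<t} s * (M * \<bar>f s\<bar>)"])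
      have "continuous_on {0..t} (\<lambda>s. M * \<bar>f s\<bar>)" by (intro continuous_intros fc) simp
      from continuous_integral_F(1)[OF this]
      show "integrable lborel (\<lambda>s. indicator {0<..<t} s * (M * \<bar>f s\<bar>))" by (simp add: set_integrable_def)
      have "continuous_on {0..t} (\<lambda>s. case (0, t - s) of (x, t) \<Rightarrow> wx x t)"
        by (rule continuous_on_compose2[OF wx_cont]) (auto intro!: continuous_intros)
      then have "continuous_on {0..t} (\<lambda>s. wx 0 (t - s) * f s)" by (intro continuous_on_mult fc) simp_all
      from continuous_integral_F(1)[OF this]
      show "(\<lambda>s. indicator {0<..<t} s * (wx 0 (t - s) * f s)) \<in> borel_measurable lborel"
        using borel_measurable_integrable by (force simp: set_integrable_def)
      fix n
      have "continuous_on {0..t - \<tau> (xs n)} (\<lambda>s. (w (xs n) (t - s) - w 0 (t - s)) * f s)"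
        using xs'[of n] taux[of "xs n"] by (intro continuous_on_mult continuous_on_diff wc fc) auto
      from continuous_integral_F(1)[OF this]
      have "(\<lambda>s. indicator {0<..<t - \<tau> (xs n)} s * ((w (xs n) (t - s) - w 0 (t - s)) * f s)) \<in> borel_measurable lborel"
        using borel_measurable_integrable by (force simp: set_integrable_def)
      then show "?h n \<in> borel_measurable lborel" by (intro borel_measurable_divide) simp_all
      show "AE s in lborel. norm (?h n s) \<le> indicator {0<..<t} s * (M * \<bar>f s\<bar>)"
      proof (rule AE_I2)
        fix s
        show "norm (?h n s) \<le> indicator {0<..<t} s * (M * \<bar>f s\<bar>)"
        proof (cases "s \<in> {0<..<t - \<tau> (xs n)}")
          case True
          then have "\<bar>w (xs n) (t - s) - w 0 (t - s)\<bar> \<le> M * xs n"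
            using taux[OF xs'(1)[of n]] by (intro increment xs'(1)) auto
          then have "\<bar>w (xs n) (t - s) - w 0 (t - s)\<bar> / xs n \<le> M"
            using xs'(2)[of n] by (simp add: field_simps)
          then have "\<bar>w (xs n) (t - s) - w 0 (t - s)\<bar> / xs n * \<bar>f s\<bar> \<le> M * \<bar>f s\<bar>"
            by (rule mult_right_mono) simp
          moreover have "s \<in> {0<..<t}" using True taux[OF xs'(1)[of n]] by auto
          ultimately show ?thesis using True xs'(2)[of n] by (simp add: abs_mult)
        next
          case False
          moreover have "0 \<le> M" using M[of 0 t] x1 t by (auto intro: order_trans[OF abs_ge_zero])
          ultimately show ?thesis by (simp add: indicator_def)
        qed
      qed
    next
      show "AE s in lborel. (\<lambda>n. ?h n s) \<longlonglongrightarrow> indicator {0<..<t} s * (wx 0 (t - s) * f s)"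
      proof (rule AE_I2)
        fix s
        have tau_lim: "(\<lambda>n. \<tau> (xs n)) \<longlonglongrightarrow> \<tau> 0"
          by (rule continuous_on_tendsto_compose[OF tau_cont lim]) (use xs' in \<open>auto simp: less_imp_le\<close>)
        show "(\<lambda>n. ?h n s) \<longlonglongrightarrow> indicator {0<..<t} s * (wx 0 (t - s) * f s)"
        proof (cases "s \<in> {0<..<t}")
          case True
          then have ev: "\<forall>\<^sub>F n in sequentially. \<tau> (xs n) < t - s"
            using order_tendstoD(2)[OF tau_lim, of "t - s"] by simp
          have wedge0: "(0, t - s) \<in> wedge" using True by simp
          have "filterlim xs (at 0 within {z. (z, t - s) \<in> wedge}) sequentially"
            unfolding filterlim_at using lim xs'
            by (auto intro!: eventually_mono[OF ev] simp: less_imp_le xs_nz)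
          from filterlim_compose[OF wx[OF wedge0, unfolded has_field_derivative_iff] this]
          have "(\<lambda>n. (w (xs n) (t - s) - w 0 (t - s)) / xs n * f s) \<longlonglongrightarrow> wx 0 (t - s) * f s"
            by (intro tendsto_mult tendsto_const) simp
          then have "(\<lambda>n. ?h n s) \<longlonglongrightarrow> wx 0 (t - s) * f s"
          proof (rule Lim_transform_eventually)
            show "\<forall>\<^sub>F n in sequentially. (w (xs n) (t - s) - w 0 (t - s)) / xs n * f s = ?h n s"
              using ev by eventually_elim (use True in simp)
          qed
          then show ?thesis using True by simp
        next
          case False
          then have "s \<notin> {0<..<t - \<tau> (xs n)}" for n using taux[OF xs'(1)[of n]] by auto
          then have "indicator {0<..<t - \<tau> (xs n)} s = (0::real)" for n by (rule indicator_simps(2))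
          then have z: "?h n s = 0" for n by (simp only: mult_zero_left div_0)
          have z': "indicator {0<..<t} s * (wx 0 (t - s) * f s) = 0" using False by (simp add: indicator_def)
          show ?thesis unfolding z z' by (rule tendsto_const)
        qed
      qed
    qed
    moreover have "((\<lambda>y. (J2 y - J2 0) / (y - 0)) \<circ> xs) = (\<lambda>n. \<integral>s. ?h n s \<partial>lborel)"
      using quot by (rule ext)
    ultimately show "((\<lambda>y. (J2 y - J2 0) / (y - 0)) \<circ> xs) \<longlonglongrightarrow> (LBINT s:{0<..<t}. wx 0 (t - s) * f s)"
      by (simp only: set_lebesgue_integral_def real_scaleR_def)
  qed
  have "((\<lambda>x. LBINT s:{0<..<t - \<tau> x}. w x (t - s) * f s) has_real_derivative
      - sqrt (\<rho> 0) * w 0 0 * f t + (LBINT s:{0<..<t}. wx 0 (t - s) * f s)) (at 0 within {0..x1})"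
    by (rule has_field_derivative_transform_within[OF DERIV_add[OF J1' J2'] zero_less_one]) (use x1 J12 in auto)
  moreover have "at 0 within {0..x1} = at (0::real) within {0..}"
    by (rule at_within_nhd[of _ "{..<x1}"]) (use x1 in auto)
  ultimately show ?thesis by (simp add: algebra_simps)
qed

text \<open>The explicit form of the response operator at a time \<open>t\<close> at which \<open>f\<close> has the left derivative \<open>D\<close>.\<close>

lemma u_sol_derivative_at_0:
  assumes wx_cont: "continuous_on wedge (\<lambda>(x, t). wx x t)"
    and wx: "\<And>x t. (x, t) \<in> wedge \<Longrightarrow> ((\<lambda>z. w z t) has_real_derivative wx x t) (at x within {z. (z, t) \<in> wedge})"
    and a': "((\<lambda>x. (\<rho> x / \<rho> 0) powr (- 1 / 4)) has_real_derivative a') (at 0 within {0..})"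
    and t: "t \<in> {0<..<T}" and f: "continuous_on {0..T} f"
    and D: "(f has_real_derivative D) (at t within {0..t})"
  shows "((\<lambda>x. u_sol \<rho> w f x t) has_real_derivative
      (a' - sqrt (\<rho> 0) * w 0 0) * f t - sqrt (\<rho> 0) * D + (LBINT s:{0<..<t}. wx 0 (t - s) * f s)) (at 0 within {0..})"
proof -
  define x1 where "x1 = xinv \<rho> t"
  have x1: "x1 > 0" "\<tau> x1 = t" using t xinv_less_iff[of 0 t] by (simp_all add: x1_def tau_xinv)
  have taux: "0 \<le> \<tau> x \<and> \<tau> x \<le> t" if "x \<in> {0..x1}" for x
    using that tau_le_iff[of x x1] x1 tau_nonneg[of x] by auto
  have nhd: "at 0 within {0..x1} = at (0::real) within {0..}"
    by (rule at_within_nhd[of _ "{..<x1}"]) (use x1 in auto)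
  have "(f has_real_derivative D) (at (t - \<tau> 0) within (\<lambda>x. t - \<tau> x) ` {0..x1})"
    using taux D by (simp, elim DERIV_subset) auto
  moreover have "((\<lambda>x. t - \<tau> x) has_real_derivative 0 - sqrt (\<rho> 0)) (at 0 within {0..x1})"
    by (rule DERIV_diff[OF DERIV_const DERIV_subset[OF tau_deriv]]) auto
  ultimately have "(f \<circ> (\<lambda>x. t - \<tau> x) has_real_derivative D * (0 - sqrt (\<rho> 0))) (at 0 within {0..x1})"
    by (rule DERIV_image_chain)
  note chain = this
  have ext_eq: "(f \<circ> (\<lambda>x. t - \<tau> x)) x = ext0 f (t - \<tau> x)" if "x \<in> {0..x1}" for x
    using taux[OF that] by (simp add: ext0_def)
  have "((\<lambda>x. ext0 f (t - \<tau> x)) has_real_derivative D * (0 - sqrt (\<rho> 0))) (at 0 within {0..x1})"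
    by (rule has_field_derivative_transform_within[OF chain zero_less_one _ ext_eq]) (use x1 in simp_all)
  then have e: "((\<lambda>x. ext0 f (t - \<tau> x)) has_real_derivative - (sqrt (\<rho> 0) * D)) (at 0 within {0..})"
    by (simp add: nhd mult.commute)
  have e0: "ext0 f (t - \<tau> 0) = f t" using t by (simp add: ext0_def)
  have a0: "(\<rho> 0 / \<rho> 0) powr (- 1 / 4) = 1" using rho_pos[of 0] by simp
  from DERIV_add[OF DERIV_mult[OF a' e] convolution_derivative[OF wx_cont wx t f]]
  show ?thesis unfolding u_sol_def e0 a0 by (simp add: algebra_simps)
qed

text \<open>Where the derivative does not exist, \<open>vector_derivative\<close> is the choice from an empty predicate,
  which is the same value at all such times.\<close>

lemma R_op_measurable:
  assumes f: "continuous_on {0..T} f" and f0: "f 0 = 0"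
  shows "R_op \<rho> w f \<in> borel_measurable F"
proof -
  define D where "D x t = (u_sol \<rho> w f x t - u_sol \<rho> w f 0 t) / x" for x t
  note uc = u_sol_continuous[OF f f0]
  have diff_iff: "((\<lambda>x. u_sol \<rho> w f x t) has_vector_derivative l) (at 0 within {0..}) \<longleftrightarrow>
      ((\<lambda>x. D x t) \<longlongrightarrow> l) (at_right 0)" for l t
    unfolding has_real_derivative_iff_has_vector_derivative[symmetric] has_field_derivative_iff D_def
    by (simp add: at_within_Ici_at_right)
  show ?thesis
  proof (rule measurable_right_limit[of D _ _ "SOME l::real. False"])
    fix x :: real assume x: "x > 0"
    have c: "continuous_on {0..T} (\<lambda>t. u_sol \<rho> w f z t)" if "z \<ge> 0" for z
    proof -
      have "continuous_on {0..T} (\<lambda>t. case (z, t) of (x, t) \<Rightarrow> u_sol \<rho> w f x t)"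
        by (rule continuous_on_compose2[OF uc]) (use that in \<open>auto intro!: continuous_intros\<close>)
      then show ?thesis by simp
    qed
    have "continuous_on {0..T} (D x)"
      unfolding D_def using x by (intro continuous_on_divide continuous_on_diff c continuous_on_const) auto
    then show "D x \<in> borel_measurable F"
      by (intro measurable_F_continuous) (auto elim: continuous_on_subset)
  next
    fix t assume t: "t \<in> space F"
    have "continuous_on {0<..} (\<lambda>x. case (x, t) of (x, t) \<Rightarrow> u_sol \<rho> w f x t)"
      by (rule continuous_on_compose2[OF uc]) (use t in \<open>auto intro!: continuous_intros\<close>)
    then show "continuous_on {0<..} (\<lambda>x. D x t)"
      unfolding D_def by (intro continuous_on_divide continuous_on_diff continuous_on_const continuous_on_id) auto
  next
    fix t l assume "((\<lambda>x. D x t) \<longlongrightarrow> l) (at_right 0)"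
    then have "((\<lambda>x. u_sol \<rho> w f x t) has_vector_derivative l) (at 0 within {0..})" unfolding diff_iff .
    then show "R_op \<rho> w f t = l"
      unfolding R_op_def by (intro vector_derivative_within) (simp add: at_within_Ici_at_right)
  next
    fix t assume "\<nexists>l. ((\<lambda>x. D x t) \<longlongrightarrow> l) (at_right 0)"
    then show "R_op \<rho> w f t = (SOME l. False)"
      unfolding R_op_def vector_derivative_def diff_iff by simp
  qed
qed

end

lemma R_domE:
  assumes "f \<in> R_dom T" and T: "T > 0"
  obtains g where "g \<in> L2 (F_meas T)" "f 0 = 0" "\<And>t. t \<in> {0..T} \<Longrightarrow> f t = (LBINT s:{0<..<t}. g s)"
    "continuous_on {0..T} f"
proof -
  have f0: "f 0 = 0" using assms unfolding R_dom_def by blast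
  obtain g where g: "g \<in> L2 (F_meas T)" "\<forall>t\<in>{0..T}. f t = f 0 + (LBINT s:{0<..<t}. g s)"
    using assms unfolding R_dom_def by blast
  have fg: "f t = (LBINT s:{0<..<t}. g s)" if "t \<in> {0..T}" for t
    using bspec[OF g(2) that] f0 by linarith
  note gi = integrable_F_indefinite[OF L2_F_integrable[OF g(1)]]
  have "g integrable_on {0..T}" by (rule set_integral_open_eq_integral(1)[OF gi(1)]) simp
  then have "continuous_on {0..T} (\<lambda>t. integral {0..t} g)" by (rule indefinite_integral_continuous_1)
  then have "continuous_on {0..T} f"
    by (rule continuous_on_eq) (simp add: fg gi(2))
  then show ?thesis using that[OF g(1) f0 fg] by blast
qed

lemma kappa_L2: "kappa T \<in> L2 (F_meas T)"
  unfolding kappa_def[abs_def] by (intro continuous_L2_F continuous_intros)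

text \<open>Integration by parts for the primitive \<open>f\<close> of \<open>g\<close>; the boundary terms vanish as \<open>f(0) = 0\<close> and
  \<open>\<kappa>(T) = 0\<close>. It is read off from the adjoint of the Volterra operator \<open>g \<mapsto> g + f\<close>, whose kernel is
  \<open>1\<close>, at the constant function \<open>1\<close>.\<close>

lemma L2_inner_derivative_kappa:
  assumes T: "T > 0" and g: "g \<in> L2 (F_meas T)" and f: "f \<in> L2 (F_meas T)"
    and fg: "\<And>t. t \<in> {0..T} \<Longrightarrow> f t = (LBINT s:{0<..<t}. g s)"
  shows "L2_inner (F_meas T) g (kappa T) = L2_inner (F_meas T) f (\<lambda>t. 1)"
proof -
  interpret v: volterra T 1 "\<lambda>r s. 1" 1
    using T by unfold_locales (simp_all add: case_prod_unfold)
  have one: "(\<lambda>t. 1) \<in> L2 (F_meas T)" by (intro continuous_L2_F continuous_intros)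
  have V: "v.V g t = g t + f t" if "t \<in> {0<..<T}" for t
    using fg[of t] that by (simp add: v.V_def)
  have V': "v.V_adj (\<lambda>t. 1) t = 1 + kappa T t" if "t \<in> {0<..<T}" for t
    using that by (simp add: v.V_adj_def kappa_def set_lebesgue_integral_def)
  note ints = L2_mult_integrable[OF g one] L2_mult_integrable[OF f one] L2_mult_integrable[OF g kappa_L2]
  have "L2_inner (F_meas T) g (\<lambda>t. 1) + L2_inner (F_meas T) f (\<lambda>t. 1) = L2_inner (F_meas T) (v.V g) (\<lambda>t. 1)"
  proof -
    have "L2_inner (F_meas T) (v.V g) (\<lambda>t. 1) = (\<integral>t. g t * 1 + f t * 1 \<partial>F_meas T)"
      unfolding L2_inner_def by (rule Bochner_Integration.integral_cong) (simp_all add: V)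
    then show ?thesis using ints by (simp add: L2_inner_def)
  qed
  also have "\<dots> = L2_inner (F_meas T) g (v.V_adj (\<lambda>t. 1))" by (rule v.V_adjoint[OF g one])
  also have "\<dots> = L2_inner (F_meas T) g (\<lambda>t. 1) + L2_inner (F_meas T) g (kappa T)"
  proof -
    have "L2_inner (F_meas T) g (v.V_adj (\<lambda>t. 1)) = (\<integral>t. g t * 1 + g t * kappa T t \<partial>F_meas T)"
      unfolding L2_inner_def by (rule Bochner_Integration.integral_cong) (simp_all add: V' distrib_left)
    then show ?thesis using ints by (simp add: L2_inner_def)
  qed
  finally show ?thesis by simp
qed

context string_fundamental
begin

text \<open>Almost everywhere, \<open>R f\<close> is the sum of a multiple of \<open>f\<close>, the term \<open>-\<rho>(0)\<^sup>1\<^sup>/\<^sup>2 f'\<close> and a convolution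
  of \<open>f\<close>. Paired with \<open>\<kappa>\<close>, the second becomes a pairing of \<open>f\<close> with a constant, and the third is
  moved to \<open>\<kappa>\<close> by the adjoint of a Volterra operator.\<close>

lemma kappa_in_adjoint_domain: "kappa T \<in> adj_dom F F (R_dom T) (R_op \<rho> w)"
proof -
  have "Ck_on (Suc 0) wedge (\<lambda>(x, t). w x t)"
    using w unfolding regular_part_def smooth_on_def by blast
  then obtain wx where wx: "Ck_on 0 wedge (\<lambda>(x, t). wx x t)"
    "\<forall>x t. (x, t) \<in> wedge \<longrightarrow> ((\<lambda>z. w z t) has_real_derivative wx x t) (at x within {z. (z, t) \<in> wedge})"
    using Ck_on_partials by blast
  have wx_cont: "continuous_on wedge (\<lambda>(x, t). wx x t)" using wx(1) by simp
  obtain D0 where "(\<rho> has_real_derivative D0) (at 0 within {0..})"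
    using smooth_on_imp_differentiable[of "{0..}" \<rho> 0] coeffs by (auto simp: admissible_coeffs_def)
  then have "((\<lambda>x. \<rho> x / \<rho> 0) has_real_derivative D0 / \<rho> 0) (at 0 within {0..})"
    by (rule DERIV_cdivide)
  from DERIV_chain2[OF has_real_derivative_powr this, of "- 1 / 4"]
  obtain a' where a': "((\<lambda>x. (\<rho> x / \<rho> 0) powr (- 1 / 4)) has_real_derivative a') (at 0 within {0..})"
    using rho_pos[of 0] by auto
  define c where "c = a' - sqrt (\<rho> 0) * w 0 0"
  define K2 where "K2 t s = wx 0 (cl T (t - s))" for t s :: real
  have r_cont: "continuous_on {0..T} (\<lambda>t. wx 0 t)"
  proof -
    have "continuous_on {0..T} (\<lambda>t. case (0, t) of (x, t) \<Rightarrow> wx x t)"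
      by (rule continuous_on_compose2[OF wx_cont]) (auto intro!: continuous_intros)
    then show ?thesis by simp
  qed
  obtain M where M: "\<forall>t\<in>{0..T}. \<bar>wx 0 t\<bar> \<le> M" using continuous_on_interval_bounded[OF r_cont] by blast
  have clT: "cl T r \<in> {0..T}" for r using T by (intro cl_range) simp
  interpret v: volterra T 1 K2 M
  proof unfold_locales
    have "continuous_on UNIV (\<lambda>p :: real \<times> real. cl T (fst p - snd p))"
      unfolding cl_def by (intro continuous_intros)
    then show "continuous_on UNIV (\<lambda>(r, s). K2 r s)"
      unfolding K2_def case_prod_unfold by (rule continuous_on_compose2[OF r_cont]) (use clT in auto)
    show "\<bar>K2 r s\<bar> \<le> M" for r s using M clT by (simp add: K2_def)
  qed (use T in auto)
  \<comment> \<open>The Volterra operator with kernel \<open>K2\<close> is \<open>f\<close> plus the convolution, hence \<open>c - 1\<close> instead of \<open>c\<close>.\<close>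
  define ks where "ks t = (c - 1) * kappa T t - sqrt (\<rho> 0) * 1 + v.V_adj (kappa T) t" for t
  have one: "(\<lambda>t. 1) \<in> L2 F" by (intro continuous_L2_F continuous_intros)
  note kL = kappa_L2[of T]
  have VL: "v.V_adj (kappa T) \<in> L2 F" by (rule v.V_adj_L2[OF kL])
  have ks: "ks \<in> L2 F"
    unfolding ks_def[abs_def] by (intro L2_add L2_diff L2_cmult kL one VL)
  have "L2_inner F (R_op \<rho> w f) (kappa T) = L2_inner F f ks" if fR: "f \<in> R_dom T" for f
  proof -
    obtain g where g: "g \<in> L2 F" "f 0 = 0" and fg: "\<And>t. t \<in> {0..T} \<Longrightarrow> f t = (LBINT s:{0<..<t}. g s)"
      and fc: "continuous_on {0..T} f"
      using R_domE[OF fR T] by metis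
    have fL: "f \<in> L2 F" by (rule continuous_L2_F[OF fc])
    define Rf where "Rf t = (c - 1) * f t - sqrt (\<rho> 0) * g t + v.V f t" for t
    have RfL: "Rf \<in> L2 F"
      unfolding Rf_def[abs_def] by (intro L2_add L2_diff L2_cmult fL g(1) v.V_L2)
    have ae: "AE t in F. Rf t = R_op \<rho> w f t"
      using AE_F_left_derivative[OF L2_F_integrable[OF g(1)]] unfolding AE_F
    proof (rule AE_mp, intro AE_I2 impI)
      fix t assume t: "t \<in> {0<..<T}" and "t \<in> {0<..<T} \<longrightarrow>
        ((\<lambda>s. LBINT r:{0<..<s}. g r) has_real_derivative g t) (at t within {0..t})"
      then have d: "((\<lambda>s. LBINT r:{0<..<s}. g r) has_real_derivative g t) (at t within {0..t})" by blast
      have fg': "(LBINT r:{0<..<s}. g r) = f s" if "s \<in> {0..t}" for s using fg[of s] that t by simp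
      have "(f has_real_derivative g t) (at t within {0..t})"
        by (rule has_field_derivative_transform_within[OF d zero_less_one _ fg']) (use t in simp_all)
      from u_sol_derivative_at_0[OF wx_cont wx(2)[rule_format] a' t fc this]
      have "((\<lambda>x. u_sol \<rho> w f x t) has_vector_derivative
        (c * f t - sqrt (\<rho> 0) * g t + (LBINT s:{0<..<t}. wx 0 (t - s) * f s))) (at 0 within {0..})"
        by (simp add: c_def has_real_derivative_iff_has_vector_derivative)
      then have "R_op \<rho> w f t = c * f t - sqrt (\<rho> 0) * g t + (LBINT s:{0<..<t}. wx 0 (t - s) * f s)"
        unfolding R_op_def by (intro vector_derivative_within) (simp add: at_within_Ici_at_right)
      moreover have "(LBINT s:{0<..<t}. wx 0 (t - s) * f s) = (LBINT s:{0<..<t}. K2 t s * f s)"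
        by (rule set_lebesgue_integral_cong) (use t in \<open>auto simp: K2_def cl_id\<close>)
      ultimately show "Rf t = R_op \<rho> w f t" by (simp add: Rf_def v.V_def algebra_simps)
    qed
    have RL: "R_op \<rho> w f \<in> L2 F" by (rule L2_cong_AE[OF RfL R_op_measurable[OF fc g(2)] ae])
    note i = L2_mult_integrable[OF fL kL] L2_mult_integrable[OF g(1) kL] L2_mult_integrable[OF v.V_L2[OF fL] kL]
      L2_mult_integrable[OF fL one] L2_mult_integrable[OF fL VL]
    have "L2_inner F (R_op \<rho> w f) (kappa T) = L2_inner F Rf (kappa T)"
      using L2_inner_cong_AE[OF RfL RL kL ae] by simp
    also have "\<dots> = (\<integral>t. (c - 1) * (f t * kappa T t) - sqrt (\<rho> 0) * (g t * kappa T t) + v.V f t * kappa T t \<partial>F)"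
      unfolding L2_inner_def Rf_def by (simp add: algebra_simps)
    also have "\<dots> = (c - 1) * L2_inner F f (kappa T) - sqrt (\<rho> 0) * L2_inner F g (kappa T) + L2_inner F (v.V f) (kappa T)"
      using i by (simp add: L2_inner_def)
    also have "\<dots> = (c - 1) * L2_inner F f (kappa T) - sqrt (\<rho> 0) * L2_inner F f (\<lambda>t. 1) + L2_inner F f (v.V_adj (kappa T))"
      using L2_inner_derivative_kappa[OF T g(1) fL fg] v.V_adjoint[OF fL kL] by simp
    also have "\<dots> = (\<integral>t. (c - 1) * (f t * kappa T t) - sqrt (\<rho> 0) * (f t * 1) + f t * v.V_adj (kappa T) t \<partial>F)"
      using i by (simp add: L2_inner_def)
    also have "\<dots> = L2_inner F f ks"
      unfolding L2_inner_def ks_def by (simp add: algebra_simps)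
    finally show ?thesis .
  qed
  then have "adj_rel F F (R_dom T) (R_op \<rho> w) (kappa T) ks" using kL ks by (simp add: adj_rel_def)
  then show ?thesis by (auto simp: adj_dom_def)
qed

end

section \<open>Stationary solutions up to the boundary\<close>

text \<open>The hypothesis makes \<open>e\<^sup>-\<^sup>c\<^sup>x E\<close> nonincreasing and \<open>e\<^sup>c\<^sup>x E\<close> nondecreasing.\<close>

lemma gronwall_two_sided:
  fixes E :: "real \<Rightarrow> real"
  assumes der: "\<And>x. x \<in> {a<..<b} \<Longrightarrow> (E has_real_derivative E' x) (at x)"
    and le: "\<And>x. x \<in> {a<..<b} \<Longrightarrow> \<bar>E' x\<bar> \<le> c * E x"
    and x: "x \<in> {a<..<b}" and x0: "x0 \<in> {a<..<b}"
  shows "E x \<le> E x0 * exp (c * \<bar>x - x0\<bar>)"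
proof (cases "x0 \<le> x")
  case True
  have "exp (- c * x) * E x \<le> exp (- c * x0) * E x0"
  proof (rule DERIV_nonpos_imp_nonincreasing[OF True, of "\<lambda>z. exp (- c * z) * E z"])
    fix z assume "x0 \<le> z" "z \<le> x"
    then have z: "z \<in> {a<..<b}" using x x0 by auto
    have "((\<lambda>z. exp (- c * z) * E z) has_real_derivative exp (- c * z) * (E' z - c * E z)) (at z)"
      using der[OF z] by (auto intro!: derivative_eq_intros simp: algebra_simps)
    moreover have "exp (- c * z) * (E' z - c * E z) \<le> 0"
      using le[OF z] by (intro mult_nonneg_nonpos) auto
    ultimately show "\<exists>y. ((\<lambda>z. exp (- c * z) * E z) has_real_derivative y) (at z) \<and> y \<le> 0" by blast
  qed
  then have "exp (c * x) * (exp (- c * x) * E x) \<le> exp (c * x) * (exp (- c * x0) * E x0)"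
    by (rule mult_left_mono) simp
  moreover have "exp (c * x) * (exp (- c * x) * E x) = E x"
    by (simp add: mult.assoc[symmetric] exp_add[symmetric])
  moreover have "exp (c * x) * (exp (- c * x0) * E x0) = E x0 * exp (c * \<bar>x - x0\<bar>)"
    using True by (simp add: mult.assoc[symmetric] exp_add[symmetric] right_diff_distrib)
  ultimately show ?thesis by linarith
next
  case False
  then have le': "x \<le> x0" by simp
  have "exp (c * x) * E x \<le> exp (c * x0) * E x0"
  proof (rule DERIV_nonneg_imp_nondecreasing[OF le', of "\<lambda>z. exp (c * z) * E z"])
    fix z assume "x \<le> z" "z \<le> x0"
    then have z: "z \<in> {a<..<b}" using x x0 by auto
    have "((\<lambda>z. exp (c * z) * E z) has_real_derivative exp (c * z) * (E' z + c * E z)) (at z)"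
      using der[OF z] by (auto intro!: derivative_eq_intros simp: algebra_simps)
    moreover have "exp (c * z) * (E' z + c * E z) \<ge> 0"
      using le[OF z] by (intro mult_nonneg_nonneg) auto
    ultimately show "\<exists>y. ((\<lambda>z. exp (c * z) * E z) has_real_derivative y) (at z) \<and> 0 \<le> y" by blast
  qed
  then have "exp (- c * x) * (exp (c * x) * E x) \<le> exp (- c * x) * (exp (c * x0) * E x0)"
    by (rule mult_left_mono) simp
  moreover have "exp (- c * x) * (exp (c * x) * E x) = E x"
    by (simp add: mult.assoc[symmetric] exp_add[symmetric])
  moreover have "exp (- c * x) * (exp (c * x0) * E x0) = E x0 * exp (c * \<bar>x - x0\<bar>)"
    using False by (simp add: mult.assoc[symmetric] exp_add[symmetric] right_diff_distrib)
  ultimately show ?thesis by linarith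
qed

lemma bounded_derivative_extends:
  fixes f :: "real \<Rightarrow> real"
  assumes ab: "a < b" and der: "\<And>x. x \<in> {a<..<b} \<Longrightarrow> (f has_real_derivative f' x) (at x)"
    and bound: "\<And>x. x \<in> {a<..<b} \<Longrightarrow> \<bar>f' x\<bar> \<le> B"
  obtains g where "continuous_on {a..b} g" "\<And>x. x \<in> {a<..<b} \<Longrightarrow> g x = f x" "g a = Lim (at_right a) f"
proof -
  have B: "B \<ge> 0" using bound[of "(a + b) / 2"] ab by simp
  have "B-lipschitz_on {a<..<b} f"
  proof (rule lipschitz_onI[OF _ B])
    fix x y assume xy: "x \<in> {a<..<b}" "y \<in> {a<..<b}"
    have "norm (f x - f y) \<le> B * norm (x - y)"
      by (rule field_differentiable_bound[of "{a<..<b}" f f'])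
        (use xy der bound in \<open>auto intro: has_field_derivative_at_within\<close>)
    then show "dist (f x) (f y) \<le> B * dist x y" by (simp add: dist_norm)
  qed
  then have "uniformly_continuous_on {a<..<b} f" by (rule lipschitz_on_uniformly_continuous)
  then obtain g where g: "uniformly_continuous_on (closure {a<..<b}) g" "\<And>x. x \<in> {a<..<b} \<Longrightarrow> f x = g x"
    using uniformly_continuous_on_extension_on_closure by metis
  have gc: "continuous_on {a..b} g" using uniformly_continuous_imp_continuous[OF g(1)] ab by simp
  have "(g \<longlongrightarrow> g a) (at a within {a..b})" using gc ab by (simp add: continuous_on_def)
  then have "(g \<longlongrightarrow> g a) (at_right a)" using ab by (simp add: at_within_Icc_at_right)
  moreover have "\<forall>\<^sub>F x in at_right a. g x = f x"
    using eventually_at_right_less[of a] eventually_at_right_field[of "\<lambda>x. x < b" a] ab g(2)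
    by (auto simp: eventually_at_right_field)
  ultimately have "(f \<longlongrightarrow> g a) (at_right a)" by (rule Lim_transform_eventually)
  then have "Lim (at_right a) f = g a" by (intro tendsto_Lim) auto
  then show ?thesis using that gc g(2) by metis
qed

text \<open>The equation is regular at both ends of the interval: as \<open>q\<close> is bounded, \<open>y\<^sup>2 + y'\<^sup>2\<close> stays bounded by
  Gronwall's inequality. So \<open>y\<close> and \<open>y'\<close> have bounded derivatives and extend continuously.\<close>

lemma stationary_solution_extends:
  assumes X: "X > 0" and q: "continuous_on {0..X} q" and y: "stationary_solution q X y"
  obtains z z' where "continuous_on {0..X} z" "continuous_on {0..X} z'"
    "\<And>x. x \<in> {0<..<X} \<Longrightarrow> z x = y x"
    "\<And>x. x \<in> {0<..<X} \<Longrightarrow> (z has_real_derivative z' x) (at x)"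
    "\<And>x. x \<in> {0<..<X} \<Longrightarrow> (z' has_real_derivative q x * z x) (at x)"
    "z 0 = Lim (at_right 0) y" "z' 0 = Lim (at_right 0) (deriv y)"
proof -
  have d1: "(y has_real_derivative deriv y x) (at x)"
    and d2: "(deriv y has_real_derivative q x * y x) (at x)" if "x \<in> {0<..<X}" for x
  proof -
    have *: "y differentiable (at x)" "deriv y differentiable (at x)" "deriv (deriv y) x = q x * y x"
      using y that by (auto simp: stationary_solution_def)
    show "(y has_real_derivative deriv y x) (at x)"
      using *(1) by (simp add: DERIV_deriv_iff_real_differentiable)
    have "(deriv y has_real_derivative deriv (deriv y) x) (at x)"
      using *(2) by (simp add: DERIV_deriv_iff_real_differentiable)
    then show "(deriv y has_real_derivative q x * y x) (at x)" by (simp only: *(3))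
  qed
  obtain Q where Q: "\<forall>x\<in>{0..X}. \<bar>q x\<bar> \<le> Q" using continuous_on_interval_bounded[OF q] by blast
  have Q0: "Q \<ge> 0" using Q X by force
  \<comment> \<open>The derivative of \<open>E\<close> is \<open>2 (1 + q) y y'\<close>, which is at most \<open>(1 + Q) E\<close> in absolute value.\<close>
  define E where "E x = (y x)\<^sup>2 + (deriv y x)\<^sup>2" for x
  define E' where "E' x = 2 * (1 + q x) * (y x * deriv y x)" for x
  have Ed: "(E has_real_derivative E' x) (at x)" if x: "x \<in> {0<..<X}" for x
    unfolding E_def[abs_def] E'_def using d1[OF x] d2[OF x]
    by (auto intro!: derivative_eq_intros simp: algebra_simps power2_eq_square)
  have Ele: "\<bar>E' x\<bar> \<le> (1 + Q) * E x" if x: "x \<in> {0<..<X}" for x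
  proof -
    have "\<bar>q x\<bar> \<le> Q" using Q x by simp
    then have q1: "\<bar>1 + q x\<bar> \<le> 1 + Q" by linarith
    have yy: "2 * \<bar>y x * deriv y x\<bar> \<le> E x"
      using sum_squares_bound[of "\<bar>y x\<bar>" "\<bar>deriv y x\<bar>"] by (simp add: E_def abs_mult)
    have "\<bar>E' x\<bar> = \<bar>1 + q x\<bar> * (2 * \<bar>y x * deriv y x\<bar>)" unfolding E'_def abs_mult by simp
    also have "\<dots> \<le> (1 + Q) * E x" using q1 yy Q0 by (intro mult_mono) auto
    finally show ?thesis .
  qed
  define B where "B = E (X/2) * exp ((1 + Q) * X)"
  have E0: "E x \<ge> 0" for x by (simp add: E_def)
  have EB: "E x \<le> B" if x: "x \<in> {0<..<X}" for x
  proof -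
    have "E x \<le> E (X/2) * exp ((1 + Q) * \<bar>x - X/2\<bar>)"
      by (rule gronwall_two_sided[OF Ed Ele x]) (use X in auto)
    also have "\<dots> \<le> B"
      unfolding B_def using x Q0 by (intro mult_left_mono E0) (auto simp: abs_le_iff intro!: mult_left_mono)
    finally show ?thesis .
  qed
  have small: "\<bar>c\<bar> \<le> 1 + B" if "c\<^sup>2 \<le> E x" "x \<in> {0<..<X}" for c x
  proof -
    have "c\<^sup>2 \<le> B" using that EB[of x] by linarith
    moreover have "2 * \<bar>c\<bar> \<le> 1 + c\<^sup>2" using sum_squares_bound[of 1 "\<bar>c\<bar>"] by simp
    ultimately show ?thesis by linarith
  qed
  have b1: "\<bar>y x\<bar> \<le> 1 + B" and b2: "\<bar>deriv y x\<bar> \<le> 1 + B" if "x \<in> {0<..<X}" for x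
    using small[OF _ that] by (simp_all add: E_def)
  have b3: "\<bar>q x * y x\<bar> \<le> Q * (1 + B)" if x: "x \<in> {0<..<X}" for x
    unfolding abs_mult using Q x b1[OF x] by (intro mult_mono) (auto intro: Q0)
  obtain z where z: "continuous_on {0..X} z" "\<And>x. x \<in> {0<..<X} \<Longrightarrow> z x = y x" "z 0 = Lim (at_right 0) y"
    using bounded_derivative_extends[OF X d1 b2] by blast
  obtain z' where z': "continuous_on {0..X} z'" "\<And>x. x \<in> {0<..<X} \<Longrightarrow> z' x = deriv y x"
    "z' 0 = Lim (at_right 0) (deriv y)"
    using bounded_derivative_extends[OF X d2 b3] by blast
  have "(z has_real_derivative z' x) (at x)" "(z' has_real_derivative q x * z x) (at x)"
    if x: "x \<in> {0<..<X}" for x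
  proof -
    have "(z has_real_derivative deriv y x) (at x)"
      by (rule has_field_derivative_transform_within_open[OF d1[OF x], of "{0<..<X}"]) (use x z(2) in auto)
    then show "(z has_real_derivative z' x) (at x)" using z'(2)[OF x] by simp
    have "(z' has_real_derivative q x * y x) (at x)"
      by (rule has_field_derivative_transform_within_open[OF d2[OF x], of "{0<..<X}"]) (use x z'(2) in auto)
    then show "(z' has_real_derivative q x * z x) (at x)" using z(2)[OF x] by simp
  qed
  then show ?thesis using that z z' by blast
qed

section \<open>Duality between control and response\<close>

context string_fundamental
begin

lemma smooth_control_in_R_dom:
  assumes f: "smooth_on {0..} f" and f0: "f 0 = (0 :: real)"
  shows "f \<in> R_dom T"
proof -
  have "Ck_on (Suc 0) {0..} f" using f by (simp add: smooth_on_def)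
  then obtain f' where d: "\<forall>x\<in>{0..}. (f has_derivative f' x) (at x within {0..})"
    and c: "\<forall>v. continuous_on {0..} (\<lambda>x. f' x v)" by auto
  define g where "g x = f' x 1" for x
  have gc: "continuous_on {0..b} g" for b
    unfolding g_def by (rule continuous_on_subset[OF c[rule_format]]) auto
  have der: "(f has_vector_derivative g x) (at x within {0..t})" if "x \<in> {0..t}" for x t
  proof -
    have dx: "(f has_derivative f' x) (at x within {0..})" using d that by auto
    have "f' x h = g x * h" for h
      using linear_scale[OF has_derivative_linear[OF dx], of h 1] by (simp add: g_def)
    then have "f' x = (*) (g x)" by (rule ext)
    then have "(f has_real_derivative g x) (at x within {0..})" using dx by (simp add: has_field_derivative_def)
    then have "(f has_real_derivative g x) (at x within {0..t})" by (rule DERIV_subset) auto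
    then show ?thesis by (simp add: has_real_derivative_iff_has_vector_derivative)
  qed
  have "f t = f 0 + (LBINT s:{0<..<t}. g s)" if "t \<in> {0..T}" for t
  proof -
    have "(g has_integral (f t - f 0)) {0..t}"
      by (rule fundamental_theorem_of_calculus) (use that der in auto)
    then show ?thesis using continuous_integral_F(2)[OF gc[of t]] by (simp add: integral_unique)
  qed
  then show ?thesis using f0 continuous_L2_F[OF gc[of T]] unfolding R_dom_def by blast
qed

text \<open>A control that is silent up to time \<open>\<epsilon>\<close> leaves a neighbourhood of the front at rest.\<close>

lemma u_sol_vanishes_near_front:
  assumes f: "\<forall>t\<in>{0..<\<epsilon>}. f t = 0" and t: "t - \<tau> x < \<epsilon>"
  shows "u_sol \<rho> w f x t = 0"
proof -
  have "(LBINT s:{0<..<t - \<tau> x}. w x (t - s) * f s) = (LBINT s:{0<..<t - \<tau> x}. 0)"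
    by (rule set_lebesgue_integral_cong) (use f t in auto)
  moreover have "ext0 f (t - \<tau> x) = 0" using f t by (auto simp: ext0_def)
  ultimately show ?thesis by (simp add: u_sol_def)
qed

text \<open>Green's formula for the wave and the stationary solution, integrated in time against \<open>T - t\<close>. The
  functions \<open>z\<close> and \<open>z'\<close> are the continuous extensions of \<open>y\<close> and its derivative to \<open>[0, X]\<close>.\<close>

lemma smooth_control_duality:
  assumes f: "smooth_on {0..} f" and f0: "\<exists>\<epsilon>>0. \<forall>t\<in>{0..<\<epsilon>}. f t = 0"
    and y: "y \<in> L2 H"
    and z: "continuous_on {0..X} z" and z': "continuous_on {0..X} z'"
    and zy: "\<And>x. x \<in> {0<..<X} \<Longrightarrow> z x = y x"
    and zd: "\<And>x. x \<in> {0<..<X} \<Longrightarrow> (z has_real_derivative z' x) (at x)"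
    and zd': "\<And>x. x \<in> {0<..<X} \<Longrightarrow> (z' has_real_derivative q x * z x) (at x)"
  shows "L2_inner H (W f) y = z' 0 * L2_inner F f (kappa T) - z 0 * L2_inner F (R_op \<rho> w f) (kappa T)"
proof -
  define u where "u = u_sol \<rho> w f"
  have cs: "classical_solution \<rho> q f u" unfolding u_def using w f f0 by (simp add: regular_part_def)
  let ?Q = "{0..} \<times> {0..} :: (real \<times> real) set"
  have sec: "{x. (x, t) \<in> ?Q} = {0..}" "{s. (t, s) \<in> ?Q} = {0..}" if "t \<ge> 0" for t using that by auto
  have "Ck_on (Suc (Suc 0)) ?Q (\<lambda>(x, t). u x t)"
    using cs unfolding classical_solution_def smooth_on_def by blast
  then obtain ux ut where
    uxC: "Ck_on (Suc 0) ?Q (\<lambda>(x, t). ux x t)" and utC: "Ck_on (Suc 0) ?Q (\<lambda>(x, t). ut x t)" and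
    ux0: "\<forall>x t. (x, t) \<in> ?Q \<longrightarrow> ((\<lambda>z. u z t) has_real_derivative ux x t) (at x within {z. (z, t) \<in> ?Q})" and
    ut0: "\<forall>x t. (x, t) \<in> ?Q \<longrightarrow> ((\<lambda>s. u x s) has_real_derivative ut x t) (at t within {s. (x, s) \<in> ?Q})"
    using Ck_on_partials by blast
  obtain uxx where
    uxx0: "\<forall>x t. (x, t) \<in> ?Q \<longrightarrow> ((\<lambda>z. ux z t) has_real_derivative uxx x t) (at x within {z. (z, t) \<in> ?Q})"
    using Ck_on_partials[OF uxC] by blast
  obtain utt where uttC: "Ck_on 0 ?Q (\<lambda>(x, t). utt x t)" and
    utt0: "\<forall>x t. (x, t) \<in> ?Q \<longrightarrow> ((\<lambda>s. ut x s) has_real_derivative utt x t) (at t within {s. (x, s) \<in> ?Q})"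
    using Ck_on_partials[OF utC] by blast
  have ux: "((\<lambda>z. u z t) has_real_derivative ux x t) (at x within {0..})"
    and uxx: "((\<lambda>z. ux z t) has_real_derivative uxx x t) (at x within {0..})"
    and ut: "((\<lambda>s. u x s) has_real_derivative ut x t) (at t within {0..})"
    and utt: "((\<lambda>s. ut x s) has_real_derivative utt x t) (at t within {0..})" if "x \<ge> 0" "t \<ge> 0" for x t
    using ux0[rule_format, of x t] uxx0[rule_format, of x t] ut0[rule_format, of x t] utt0[rule_format, of x t] that unfolding sec[OF that(1)] sec[OF that(2)] by simp_all
  have interior: "at x within {0..} = at x" if "x > 0" for x :: real
    using at_within_interior[of x "{0..}"] that by simp
  have utt_cont: "continuous_on ?Q (\<lambda>(x, t). utt x t)" using uttC by simp
  have ux0_cont: "continuous_on {0..b} (\<lambda>t. ux 0 t)" for b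
  proof -
    have "continuous_on {0..b} (\<lambda>t. case (0, t) of (x, t) \<Rightarrow> ux x t)"
      by (rule continuous_on_compose2[OF Ck_on_imp_continuous_on[OF uxC]]) (auto intro!: continuous_intros)
    then show ?thesis by simp
  qed
  have u_cont: "continuous_on {0..} (\<lambda>x. u x t)" "continuous_on {0..} (\<lambda>x. ux x t)" if "t \<ge> 0" for t
    by (rule DERIV_continuous_on[OF ux] DERIV_continuous_on[OF uxx]; use that in simp)+
  have pde: "\<rho> x * utt x t = uxx x t - q x * u x t" if xt: "x > 0" "t > 0" for x t
  proof -
    have "\<forall>\<^sub>F s in nhds t. deriv (\<lambda>s. u x s) s = ut x s"
    proof (rule eventually_mono[OF eventually_nhds_in_open[of "{0<..}" t]])
      fix s :: real assume "s \<in> {0<..}"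
      then show "deriv (\<lambda>s. u x s) s = ut x s" using ut[of x s] xt by (intro DERIV_imp_deriv) (simp add: interior)
    qed (use xt in auto)
    then have "deriv (deriv (\<lambda>s. u x s)) t = deriv (\<lambda>s. ut x s) t" by (intro deriv_cong_ev refl)
    also have "\<dots> = utt x t" using utt[of x t] xt by (intro DERIV_imp_deriv) (simp add: interior)
    finally have 1: "deriv (deriv (\<lambda>s. u x s)) t = utt x t" .
    have "\<forall>\<^sub>F z in nhds x. deriv (\<lambda>z. u z t) z = ux z t"
    proof (rule eventually_mono[OF eventually_nhds_in_open[of "{0<..}" x]])
      fix z :: real assume "z \<in> {0<..}"
      then show "deriv (\<lambda>z. u z t) z = ux z t" using ux[of z t] xt by (intro DERIV_imp_deriv) (simp add: interior)
    qed (use xt in auto)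
    then have "deriv (deriv (\<lambda>z. u z t)) x = deriv (\<lambda>z. ux z t) x" by (intro deriv_cong_ev refl)
    also have "\<dots> = uxx x t" using uxx[of x t] xt by (intro DERIV_imp_deriv) (simp add: interior)
    finally have 2: "deriv (deriv (\<lambda>z. u z t)) x = uxx x t" .
    have "\<rho> x * deriv (deriv (\<lambda>s. u x s)) t - deriv (deriv (\<lambda>z. u z t)) x + q x * u x t = 0"
      using cs xt unfolding classical_solution_def by blast
    then show ?thesis unfolding 1 2 by linarith
  qed
  have u0: "u x 0 = 0" "ut x 0 = 0" if "x \<ge> 0" for x
  proof -
    have c: "u x 0 = 0" "((\<lambda>t. u x t) has_real_derivative 0) (at 0 within {0..})"
      using cs that unfolding classical_solution_def by blast+
    show "u x 0 = 0" by (rule c(1))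
    show "ut x 0 = 0"
      by (rule has_field_derivative_unique[OF ut[OF that order_refl] c(2)]) (simp add: at_within_Ici_at_right)
  qed
  have ub: "u 0 t = f t" if "t \<ge> 0" for t using cs that unfolding classical_solution_def by blast
  obtain \<epsilon> where \<epsilon>: "\<epsilon> > 0" "\<forall>t\<in>{0..<\<epsilon>}. f t = 0" using f0 by blast
  \<comment> \<open>The front has not reached \<open>X\<close> before time \<open>T\<close>, and the wave still vanishes near the front.\<close>
  have front: "u X t = 0" "ux X t = 0" if t: "t \<in> {0..T}" for t
  proof -
    define x2 where "x2 = xinv \<rho> (max 0 (T - \<epsilon>))"
    have x2: "x2 \<ge> 0" "\<tau> x2 = max 0 (T - \<epsilon>)" "x2 < X"
      using T \<epsilon>(1) xinv_less_iff[of "max 0 (T - \<epsilon>)" T] by (auto simp: x2_def xinv_nonneg tau_xinv)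
    have z: "u x t = 0" if "x > x2" for x
    proof -
      have "T - \<epsilon> < \<tau> x" using tau_less[OF x2(1) that] x2(2) by simp
      then show ?thesis unfolding u_def using t by (intro u_sol_vanishes_near_front[OF \<epsilon>(2)]) simp
    qed
    show "u X t = 0" using z x2(3) by simp
    have "((\<lambda>z. 0) has_real_derivative ux X t) (at X)"
      by (rule has_field_derivative_transform_within_open[of "\<lambda>z. u z t" _ _ "{x2<..}"])
        (use ux[of X t] X_pos t z x2(3) in \<open>auto simp: interior\<close>)
    then show "ux X t = 0" using DERIV_unique DERIV_const by blast
  qed
  \<comment> \<open>The boundary terms at \<open>X\<close> vanish; those at \<open>0\<close> contain the control and the response.\<close>
  have space_int: "integral {0..X} (\<lambda>x. \<rho> x * utt x t * z x) = f t * z' 0 - ux 0 t * z 0" if t: "t \<in> {0<..T}" for t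
  proof -
    define B where "B x = ux x t * z x - u x t * z' x" for x
    have t0: "t \<ge> 0" "t > 0" using t by auto
    have "((\<lambda>x. \<rho> x * utt x t * z x) has_integral (B X - B 0)) {0..X}"
    proof (rule fundamental_theorem_of_calculus_interior)
      show "0 \<le> X" using X_pos by simp
      note u_cont[OF t0(1)]
      then have "continuous_on {0..X} (\<lambda>x. u x t)" "continuous_on {0..X} (\<lambda>x. ux x t)"
        by (auto elim!: continuous_on_subset)
      then show "continuous_on {0..X} B" unfolding B_def by (intro continuous_intros z z')
      fix x assume x: "x \<in> {0<..<X}"
      then have x0: "x \<ge> 0" "x > 0" by auto
      have du: "((\<lambda>z. u z t) has_real_derivative ux x t) (at x)" "((\<lambda>z. ux z t) has_real_derivative uxx x t) (at x)"
        using ux[OF x0(1) t0(1)] uxx[OF x0(1) t0(1)] by (simp_all add: interior[OF x0(2)])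
      have "(B has_real_derivative (uxx x t * z x + z' x * ux x t) - (ux x t * z' x + q x * z x * u x t)) (at x)"
        unfolding B_def by (intro DERIV_diff DERIV_mult du zd[OF x] zd'[OF x])
      moreover have "(uxx x t * z x + z' x * ux x t) - (ux x t * z' x + q x * z x * u x t) = \<rho> x * utt x t * z x"
        unfolding pde[OF x0(2) t0(2)] by (simp add: algebra_simps)
      ultimately show "(B has_vector_derivative \<rho> x * utt x t * z x) (at x)"
        by (simp add: has_real_derivative_iff_has_vector_derivative)
    qed
    moreover have "B X = 0" using front[of t] t by (simp add: B_def)
    moreover have "B 0 = ux 0 t * z 0 - f t * z' 0" using ub[OF t0(1)] by (simp add: B_def)
    ultimately show ?thesis by (simp add: integral_unique)
  qed
  \<comment> \<open>The integrand is the derivative of \<open>(T - t) u\<^sub>t + u\<close>.\<close>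
  have time_int: "integral {0..T} (\<lambda>t. (T - t) * utt x t) = u x T" if x: "x \<ge> 0" for x
  proof -
    have "((\<lambda>t. (T - t) * utt x t) has_integral ((T - T) * ut x T + u x T) - ((T - 0) * ut x 0 + u x 0)) {0..T}"
    proof (rule fundamental_theorem_of_calculus)
      show "0 \<le> T" using T by simp
      fix t assume t: "t \<in> {0..T}"
      have d: "((\<lambda>s. u x s) has_real_derivative ut x t) (at t within {0..T})"
        "((\<lambda>s. ut x s) has_real_derivative utt x t) (at t within {0..T})"
        by (rule DERIV_subset[OF ut] DERIV_subset[OF utt]; use x t in auto)+
      have "((\<lambda>t. (T - t) * ut x t + u x t) has_real_derivative ((0 - 1) * ut x t + utt x t * (T - t)) + ut x t) (at t within {0..T})"
        by (intro DERIV_add DERIV_mult DERIV_diff DERIV_const DERIV_ident d)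
      then show "((\<lambda>t. (T - t) * ut x t + u x t) has_vector_derivative (T - t) * utt x t) (at t within {0..T})"
        by (simp add: has_real_derivative_iff_has_vector_derivative algebra_simps)
    qed
    then show ?thesis using u0[OF x] by (simp add: integral_unique)
  qed
  let ?\<Phi> = "\<lambda>x t. (T - t) * (\<rho> x * utt x t * z x)"
  have cont: "continuous_on (cbox (0, 0) (X, T)) (\<lambda>(x, t). ?\<Phi> x t)"
  proof -
    have sub: "cbox (0, 0) (X, T) \<subseteq> ?Q" by (auto simp: cbox_Pair_eq)
    have c1: "continuous_on (cbox (0, 0) (X, T)) (\<lambda>p. utt (fst p) (snd p))"
      using continuous_on_subset[OF utt_cont sub] by (simp add: case_prod_unfold)
    have c2: "continuous_on (cbox (0, 0) (X, T)) (\<lambda>p. \<rho> (fst p))"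
      by (rule continuous_on_compose2[OF rho_cont continuous_on_fst[OF continuous_on_id]]) (auto simp: cbox_Pair_eq)
    have c3: "continuous_on (cbox (0, 0) (X, T)) (\<lambda>p. z (fst p))"
      by (rule continuous_on_compose2[OF z continuous_on_fst[OF continuous_on_id]]) (auto simp: cbox_Pair_eq)
    show ?thesis unfolding case_prod_unfold by (intro continuous_intros c1 c2 c3)
  qed
  have swap: "integral {0..X} (\<lambda>x. integral {0..T} (?\<Phi> x)) = integral {0..T} (\<lambda>t. integral {0..X} (\<lambda>x. ?\<Phi> x t))"
    using integral_swap_continuous[OF cont] by simp
  have lhs: "integral {0..X} (\<lambda>x. integral {0..T} (?\<Phi> x)) = integral {0..X} (\<lambda>x. \<rho> x * (u x T * z x))"
  proof (rule integral_cong)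
    fix x assume x: "x \<in> {0..X}"
    have "integral {0..T} (?\<Phi> x) = integral {0..T} (\<lambda>t. (\<rho> x * z x) * ((T - t) * utt x t))"
      by (intro integral_cong) simp
    also have "\<dots> = (\<rho> x * z x) * integral {0..T} (\<lambda>t. (T - t) * utt x t)" by (rule integral_mult_right)
    finally show "integral {0..T} (?\<Phi> x) = \<rho> x * (u x T * z x)" using time_int[of x] x by simp
  qed
  have f_cont: "continuous_on {0..T} f"
    by (rule continuous_on_subset[OF smooth_on_imp_continuous_on[OF f]]) auto
  have rhs: "integral {0..T} (\<lambda>t. integral {0..X} (\<lambda>x. ?\<Phi> x t))
      = z' 0 * integral {0..T} (\<lambda>t. f t * (T - t)) - z 0 * integral {0..T} (\<lambda>t. ux 0 t * (T - t))"
  proof -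
    have "integral {0..T} (\<lambda>t. integral {0..X} (\<lambda>x. ?\<Phi> x t))
        = integral {0..T} (\<lambda>t. z' 0 * (f t * (T - t)) - z 0 * (ux 0 t * (T - t)))"
    \<comment> \<open>The wave equation is assumed for \<open>t > 0\<close> only.\<close>
    proof (rule integral_spike[of "{0}"])
      fix t assume "t \<in> {0..T} - {0}"
      then have t: "t \<in> {0<..T}" by auto
      have "integral {0..X} (\<lambda>x. ?\<Phi> x t) = (T - t) * integral {0..X} (\<lambda>x. \<rho> x * utt x t * z x)"
        by (rule integral_mult_right)
      then show "z' 0 * (f t * (T - t)) - z 0 * (ux 0 t * (T - t)) = integral {0..X} (\<lambda>x. ?\<Phi> x t)"
        unfolding space_int[OF t] by (simp add: algebra_simps)
    qed simp
    also have "\<dots> = integral {0..T} (\<lambda>t. z' 0 * (f t * (T - t))) - integral {0..T} (\<lambda>t. z 0 * (ux 0 t * (T - t)))"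
      by (rule Henstock_Kurzweil_Integration.integral_diff)
        (intro integrable_continuous_interval continuous_intros f_cont ux0_cont)+
    finally show ?thesis by simp
  qed
  have inner_H: "L2_inner H (W f) y = integral {0..X} (\<lambda>x. \<rho> x * (u x T * z x))"
  proof -
    have fL: "f \<in> L2 F" by (rule continuous_L2_F[OF f_cont])
    have m: "(\<lambda>x. W f x * y x) \<in> borel_measurable H"
      using W_L2[OF fL] y by (intro borel_measurable_times) (simp_all add: L2_def)
    have "L2_inner H (W f) y = (LBINT x:{0<..<X}. \<rho> x * (W f x * y x))"
      unfolding L2_inner_def by (rule H_integral_eq(2)[OF m])
    also have "\<dots> = (LBINT x:{0<..<X}. \<rho> x * (u x T * z x))"
      by (rule set_lebesgue_integral_cong) (auto simp: W_op_def u_def zy)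
    also have "\<dots> = integral {0..X} (\<lambda>x. \<rho> x * (u x T * z x))"
    proof (rule continuous_integral_F(2))
      note u_cont(1)[of T]
      then have "continuous_on {0..X} (\<lambda>x. u x T)" using T by (auto elim: continuous_on_subset)
      then show "continuous_on {0..X} (\<lambda>x. \<rho> x * (u x T * z x))"
        by (intro continuous_on_mult z continuous_on_subset[OF rho_cont]) auto
    qed
    finally show ?thesis .
  qed
  have inner_f: "L2_inner F f (kappa T) = integral {0..T} (\<lambda>t. f t * (T - t))"
    unfolding L2_inner_def integral_F kappa_def
    by (rule continuous_integral_F(2)) (intro continuous_intros f_cont)
  have R: "R_op \<rho> w f t = ux 0 t" if "t \<ge> 0" for t
    unfolding R_op_def u_def[symmetric]
    by (rule vector_derivative_within)
      (use ux[of 0 t] that in \<open>auto simp: at_within_Ici_at_right has_real_derivative_iff_has_vector_derivative\<close>)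
  have inner_R: "L2_inner F (R_op \<rho> w f) (kappa T) = integral {0..T} (\<lambda>t. ux 0 t * (T - t))"
  proof -
    have "L2_inner F (R_op \<rho> w f) (kappa T) = (LBINT t:{0<..<T}. ux 0 t * (T - t))"
      unfolding L2_inner_def integral_F kappa_def
      by (rule set_lebesgue_integral_cong) (auto simp: R)
    also have "\<dots> = integral {0..T} (\<lambda>t. ux 0 t * (T - t))"
      by (rule continuous_integral_F(2)) (intro continuous_intros ux0_cont)
    finally show ?thesis .
  qed
  show ?thesis unfolding inner_H inner_f inner_R lhs[symmetric] swap rhs ..
qed

end

theorem theorem2:
  fixes \<rho> q :: "real \<Rightarrow> real" and w :: "real \<Rightarrow> real \<Rightarrow> real" and T :: real and y :: "real \<Rightarrow> real"
  assumes coeffs: "admissible_coeffs \<rho> q"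
    and w: "regular_part \<rho> q w"
    and T: "T > 0"
    and y_L2: "y \<in> L2 (H_meas \<rho> T)"
    and y_sol: "stationary_solution q (xinv \<rho> T) y"
  defines "y0 \<equiv> Lim (at_right 0) y"
    and "y1 \<equiv> Lim (at_right 0) (deriv y)"
    and "Radj \<equiv> adj_op (F_meas T) (F_meas T) (R_dom T) (R_op \<rho> w)"
  shows "kappa T \<in> adj_dom (F_meas T) (F_meas T) (R_dom T) (R_op \<rho> w) \<and>
    (\<exists>f \<in> L2 (F_meas T).
       (\<forall>g \<in> L2 (F_meas T).
          (AE x in H_meas \<rho> T. W_op \<rho> w T g x = y x) \<longleftrightarrow> (AE t in F_meas T. g t = f t)) \<and>
       (\<forall>g \<in> L2 (F_meas T).
          (AE t in F_meas T. C_op \<rho> w T g t = y1 * kappa T t - y0 * Radj (kappa T) t)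
            \<longleftrightarrow> (AE t in F_meas T. g t = f t)))"
proof -
  interpret string_fundamental \<rho> q T w
    using coeffs w T by unfold_locales
  obtain z z' where z: "continuous_on {0..X} z" "continuous_on {0..X} z'"
    "\<And>x. x \<in> {0<..<X} \<Longrightarrow> z x = y x"
    "\<And>x. x \<in> {0<..<X} \<Longrightarrow> (z has_real_derivative z' x) (at x)"
    "\<And>x. x \<in> {0<..<X} \<Longrightarrow> (z' has_real_derivative q x * z x) (at x)"
    "z 0 = y0" "z' 0 = y1"
    unfolding y0_def y1_def
    by (rule stationary_solution_extends[OF X_pos continuous_on_subset[OF q_cont] y_sol]) auto
  have "adj_rel F F (R_dom T) (R_op \<rho> w) (kappa T) (Radj (kappa T))"
    using someI_ex[of "adj_rel F F (R_dom T) (R_op \<rho> w) (kappa T)"] kappa_in_adjoint_domain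
    unfolding adj_dom_def Radj_def adj_op_def by blast
  then have RL: "Radj (kappa T) \<in> L2 F"
    and R: "\<And>h. h \<in> R_dom T \<Longrightarrow> L2_inner F (R_op \<rho> w h) (kappa T) = L2_inner F h (Radj (kappa T))"
    by (auto simp: adj_rel_def)
  define b where "b t = y1 * kappa T t - y0 * Radj (kappa T) t" for t
  have bL: "b \<in> L2 F" unfolding b_def[abs_def] by (intro L2_diff L2_cmult kappa_L2 RL)
  have dual: "L2_inner H (W h) y = L2_inner F h b"
    if h: "smooth_on {0..} h" "\<exists>\<epsilon>>0. \<forall>t\<in>{0..<\<epsilon>}. h t = 0" for h
  proof -
    have h0: "h 0 = 0" using h(2) by auto
    have hL: "h \<in> L2 F"
      by (intro continuous_L2_F continuous_on_subset[OF smooth_on_imp_continuous_on[OF h(1)]]) auto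
    have "L2_inner H (W h) y = y1 * L2_inner F h (kappa T) - y0 * L2_inner F h (Radj (kappa T))"
      using smooth_control_duality[OF h y_L2 z(1-5)] R[OF smooth_control_in_R_dom[OF h(1) h0]] by (simp add: z(6,7))
    also have "\<dots> = L2_inner F h b"
      unfolding b_def[abs_def]
      by (simp add: L2_inner_diff_right[OF L2_cmult[OF kappa_L2] L2_cmult[OF RL] hL] L2_inner_cmult_right)
    finally show ?thesis .
  qed
  obtain f where f: "f \<in> L2 F" "\<forall>x\<in>{0<..<X}. W f x = z x" using W_onto_continuous[OF z(1)] by blast
  then have Wf: "\<forall>x\<in>{0<..<X}. W f x = y x" using z(3) by simp
  show ?thesis
    using kappa_in_adjoint_domain f(1) connecting_equation[OF y_L2 f(1) Wf bL dual] unfolding b_def by blast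
qed

end
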